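(* Let $k$ be a commutative ring and let $A$ be a Hopf category in $\mathcal M_k^{\mathrm f}(X)$, i.e. a Hopf $\mathcal M_k^{\mathrm f}$-category with underlying class $X$. For all $x,y\in X$, the map $$\alpha_{x,y}:\ \int^l_{A^*_{x,x}}\otimes A_{x,y}\to A^*_{x,y},\qquad \alpha_{x,y}(\varphi\otimes a)=\varphi\leftharpoonup a,$$ is an isomorphism.
   Context: $\mathcal M_k^{\mathrm f}$ is the category of finitely generated projective $k$-modules; $\otimes=\otimes_k$ and $(-)^*=\mathrm{Hom}_k(-,k)$. A Hopf $\mathcal M_k^{\mathrm f}$-category $A$ with underlying class $X$ consists of $k$-coalgebras $A_{x,y}$ ($x,y\in X$), finitely generated and projective as $k$-modules, with comultiplication $\Delta_{x,y}(h)=h_{(1)}\otimes h_{(2)}$ and counit $\varepsilon_{x,y}$, coalgebra morphisms $A_{x,y}\otimes A_{y,z}\to A_{x,z}$, $h\otimes l\mapsto hl$, and $k\to A_{x,x}$, $1\mapsto1_x$, which are associative and unital, and $k$-linear maps $S_{x,y}:A_{x,y}\to A_{y,x}$ with $h_{(1)}S_{x,y}(h_{(2)})=\varepsilon_{x,y}(h)1_x$, $S_{x,y}(h_{(1)})h_{(2)}=\varepsilon_{x,y}(h)1_y$ for all $h\in A_{x,y}$. $A_{x,x}^*$ is an algebra with the opposite convolution product $\langle a^*b^*,h\rangle=\langle a^*,h_{(2)}\rangle\langle b^*,h_{(1)}\rangle$, and $$\int^l_{A^*_{x,x}}=\{\varphi\in A^*_{x,x}\mid\varphi a^*=\langle a^*,1_x\rangle\varphi\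 \text{for all }a^*\in A^*_{x,x}\}$$ is the space of left integrals on the Hopf algebra $A_{x,x}$. For $\varphi\in A^*_{x,x}$ and $a\in A_{x,y}$, the element $\varphi\leftharpoonup a\in A^*_{x,y}$ is defined by $\langle\varphi\leftharpoonup a,b\rangle=\langle\varphi,bS_{x,y}(a)\rangle$ for all $b\in A_{x,y}$. *)

theory Defs
  imports "HOL-Algebra.Module" "HOL-Algebra.AbelCoset"
begin

section \<open>Modules over a commutative ring\<close>

text \<open>
  The record type of modules extends that of rings. The \<open>mult\<close> and \<open>one\<close> components of
  a record that is only used as a module play no role, and are left \<open>undefined\<close> below.
\<close>

definition linear_maps ::
  "('k, 'r) ring_scheme \<Rightarrow> ('k, 'a, 'm) module_scheme \<Rightarrow> ('k, 'b, 'n) module_scheme \<Rightarrow> ('a \<Rightarrow> 'b) set"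
  where "linear_maps R M N =
    {f \<in> carrier M \<rightarrow> carrier N.
      (\<forall>u\<in>carrier M. \<forall>v\<in>carrier M. f (u \<oplus>\<^bsub>M\<^esub> v) = f u \<oplus>\<^bsub>N\<^esub> f v) \<and>
      (\<forall>r\<in>carrier R. \<forall>u\<in>carrier M. f (r \<odot>\<^bsub>M\<^esub> u) = r \<odot>\<^bsub>N\<^esub> f u)}"

definition linear_isos ::
  "('k, 'r) ring_scheme \<Rightarrow> ('k, 'a, 'm) module_scheme \<Rightarrow> ('k, 'b, 'n) module_scheme \<Rightarrow> ('a \<Rightarrow> 'b) set"
  where "linear_isos R M N = {f \<in> linear_maps R M N. bij_betw f (carrier M) (carrier N)}"

definition self_module :: "('k, 'r) ring_scheme \<Rightarrow> ('k, 'k) module"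
  where "self_module R =
    \<lparr>carrier = carrier R, mult = mult R, one = one R, zero = zero R, add = add R, smult = mult R\<rparr>"

definition free_module :: "('k, 'r) ring_scheme \<Rightarrow> 'i set \<Rightarrow> ('k, 'i \<Rightarrow> 'k) module"
  where "free_module R I =
    \<lparr>carrier = {c. (\<forall>i. c i \<in> carrier R) \<and> (\<forall>i. i \<notin> I \<longrightarrow> c i = \<zero>\<^bsub>R\<^esub>) \<and> finite {i. c i \<noteq> \<zero>\<^bsub>R\<^esub>}},
     mult = undefined, one = undefined,
     zero = (\<lambda>i. \<zero>\<^bsub>R\<^esub>),
     add = (\<lambda>c d i. c i \<oplus>\<^bsub>R\<^esub> d i),
     smult = (\<lambda>r c i. r \<otimes>\<^bsub>R\<^esub> c i)\<rparr>"

definition free_basis :: "('k, 'r) ring_scheme \<Rightarrow> 'i \<Rightarrow> 'i \<Rightarrow> 'k"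
  where "free_basis R i = (\<lambda>j. if j = i then \<one>\<^bsub>R\<^esub> else \<zero>\<^bsub>R\<^esub>)"

definition finitely_generated :: "('k, 'r) ring_scheme \<Rightarrow> ('k, 'a, 'm) module_scheme \<Rightarrow> bool"
  where "finitely_generated R M \<longleftrightarrow>
    (\<exists>B. finite B \<and> B \<subseteq> carrier M \<and>
      (\<forall>u\<in>carrier M. \<exists>c\<in>B \<rightarrow> carrier R. u = (\<Oplus>\<^bsub>M\<^esub>b\<in>B. c b \<odot>\<^bsub>M\<^esub> b)))"

text \<open>
  A module is projective if it is a direct summand of a free module, that is, if it is a retract
  of some \<open>R\<^sup>(\<^sup>I\<^sup>)\<close>. Index sets \<open>I\<close> of elements of the type of \<open>M\<close> suffice, since
  \<open>I = carrier M\<close> gives a free module that maps onto \<open>M\<close>. (The lifting property would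
  quantify over modules of all types.)
\<close>

definition projective :: "('k, 'r) ring_scheme \<Rightarrow> ('k, 'a, 'm) module_scheme \<Rightarrow> bool"
  where "projective R M \<longleftrightarrow>
    (\<exists>(I :: 'a set) s p. s \<in> linear_maps R M (free_module R I) \<and> p \<in> linear_maps R (free_module R I) M \<and>
      (\<forall>u\<in>carrier M. p (s u) = u))"

definition generated_submodule ::
  "('k, 'r) ring_scheme \<Rightarrow> ('k, 'a, 'm) module_scheme \<Rightarrow> 'a set \<Rightarrow> 'a set"
  where "generated_submodule R M B = \<Inter>{H. submodule H R M \<and> B \<subseteq> H}"

definition quotient_module :: "('k, 'a, 'm) module_scheme \<Rightarrow> 'a set \<Rightarrow> ('k, 'a set) module"
  where "quotient_module M H =
    \<lparr>carrier = a_rcosets\<^bsub>M\<^esub> H,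
     mult = undefined, one = undefined,
     zero = H,
     add = set_add M,
     smult = (\<lambda>r U. \<Union>u\<in>U. H +>\<^bsub>M\<^esub> (r \<odot>\<^bsub>M\<^esub> u))\<rparr>"


section \<open>Tensor products\<close>

definition tensor_relations ::
  "('k, 'r) ring_scheme \<Rightarrow> ('k, 'a, 'm) module_scheme \<Rightarrow> ('k, 'b, 'n) module_scheme \<Rightarrow> ('a \<times> 'b \<Rightarrow> 'k) set"
  where "tensor_relations R M N =
    (let F = free_module R (carrier M \<times> carrier N); e = free_basis R in
      {e (u \<oplus>\<^bsub>M\<^esub> u', v) \<ominus>\<^bsub>F\<^esub> (e (u, v) \<oplus>\<^bsub>F\<^esub> e (u', v)) | u u' v.
          u \<in> carrier M \<and> u' \<in> carrier M \<and> v \<in> carrier N} \<union>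
      {e (u, v \<oplus>\<^bsub>N\<^esub> v') \<ominus>\<^bsub>F\<^esub> (e (u, v) \<oplus>\<^bsub>F\<^esub> e (u, v')) | u v v'.
          u \<in> carrier M \<and> v \<in> carrier N \<and> v' \<in> carrier N} \<union>
      {e (r \<odot>\<^bsub>M\<^esub> u, v) \<ominus>\<^bsub>F\<^esub> r \<odot>\<^bsub>F\<^esub> e (u, v) | r u v.
          r \<in> carrier R \<and> u \<in> carrier M \<and> v \<in> carrier N} \<union>
      {e (u, r \<odot>\<^bsub>N\<^esub> v) \<ominus>\<^bsub>F\<^esub> r \<odot>\<^bsub>F\<^esub> e (u, v) | r u v.
          r \<in> carrier R \<and> u \<in> carrier M \<and> v \<in> carrier N})"

definition tensor_kernel ::
  "('k, 'r) ring_scheme \<Rightarrow> ('k, 'a, 'm) module_scheme \<Rightarrow> ('k, 'b, 'n) module_scheme \<Rightarrow> ('a \<times> 'b \<Rightarrow> 'k) set"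
  where "tensor_kernel R M N =
    generated_submodule R (free_module R (carrier M \<times> carrier N)) (tensor_relations R M N)"

definition tensor ::
  "('k, 'r) ring_scheme \<Rightarrow> ('k, 'a, 'm) module_scheme \<Rightarrow> ('k, 'b, 'n) module_scheme \<Rightarrow>
    ('k, ('a \<times> 'b \<Rightarrow> 'k) set) module"
  where "tensor R M N =
    quotient_module (free_module R (carrier M \<times> carrier N)) (tensor_kernel R M N)"

text \<open>The element \<open>u \<otimes> v\<close>:\<close>

definition pure_tensor ::
  "('k, 'r) ring_scheme \<Rightarrow> ('k, 'a, 'm) module_scheme \<Rightarrow> ('k, 'b, 'n) module_scheme \<Rightarrow>
    'a \<Rightarrow> 'b \<Rightarrow> ('a \<times> 'b \<Rightarrow> 'k) set"
  where "pure_tensor R M N u v =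
    tensor_kernel R M N +>\<^bsub>free_module R (carrier M \<times> carrier N)\<^esub> free_basis R (u, v)"

text \<open>
  The map \<open>M \<otimes> N \<rightarrow> P\<close>, \<open>u \<otimes> v \<mapsto> f u v\<close> that a bilinear map
  \<open>f : M \<times> N \<rightarrow> P\<close> induces. The set passed to \<open>the_elem\<close> is a singleton when \<open>f\<close>
  is bilinear; for other \<open>f\<close> the value is meaningless.
\<close>

definition tensor_lift ::
  "('k, 'r) ring_scheme \<Rightarrow> ('k, 'c, 'p) module_scheme \<Rightarrow> ('a \<Rightarrow> 'b \<Rightarrow> 'c) \<Rightarrow> ('a \<times> 'b \<Rightarrow> 'k) set \<Rightarrow> 'c"
  where "tensor_lift R P f t =
    the_elem ((\<lambda>c. \<Oplus>\<^bsub>P\<^esub>z\<in>{z. c z \<noteq> \<zero>\<^bsub>R\<^esub>}. c z \<odot>\<^bsub>P\<^esub> f (fst z) (snd z)) ` t)"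


section \<open>Coalgebras\<close>

record ('k, 'a) coalgebra = "('k, 'a) module" +
  comult :: "'a \<Rightarrow> ('a \<times> 'a \<Rightarrow> 'k) set"
  counit :: "'a \<Rightarrow> 'k"

text \<open>\<open>sweedler R C P f h\<close> is \<open>f h\<^sub>(\<^sub>1\<^sub>) h\<^sub>(\<^sub>2\<^sub>)\<close> for bilinear \<open>f : C \<times> C \<rightarrow> P\<close>.\<close>

definition sweedler ::
  "('k, 'r) ring_scheme \<Rightarrow> ('k, 'a, 'm) coalgebra_scheme \<Rightarrow> ('k, 'c, 'p) module_scheme \<Rightarrow>
    ('a \<Rightarrow> 'a \<Rightarrow> 'c) \<Rightarrow> 'a \<Rightarrow> 'c"
  where "sweedler R C P f h = tensor_lift R P f (comult C h)"

text \<open>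
  Coassociativity is stated in \<open>C \<otimes> (C \<otimes> C)\<close>: the left hand side is the image of
  \<open>(\<Delta> \<otimes> id) (\<Delta> h)\<close> under the associativity isomorphism.
\<close>

locale coalgebra = module R C for R (structure) and C (structure) +
  assumes comult_linear: "comult C \<in> linear_maps R C (tensor R C C)"
    and counit_linear: "counit C \<in> linear_maps R C (self_module R)"
    and coassoc: "h \<in> carrier C \<Longrightarrow>
      sweedler R C (tensor R C (tensor R C C))
        (\<lambda>a b. sweedler R C (tensor R C (tensor R C C))
          (\<lambda>a1 a2. pure_tensor R C (tensor R C C) a1 (pure_tensor R C C a2 b)) a) h =
      sweedler R C (tensor R C (tensor R C C))
        (\<lambda>a b. pure_tensor R C (tensor R C C) a (comult C b)) h"
    and counit_left: "h \<in> carrier C \<Longrightarrow> sweedler R C C (\<lambda>a b. counit C a \<odot>\<^bsub>C\<^esub> b) h = h"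
    and counit_right: "h \<in> carrier C \<Longrightarrow> sweedler R C C (\<lambda>a b. counit C b \<odot>\<^bsub>C\<^esub> a) h = h"

definition coalgebra_homs ::
  "('k, 'r) ring_scheme \<Rightarrow> ('k, 'a, 'm) coalgebra_scheme \<Rightarrow> ('k, 'b, 'n) coalgebra_scheme \<Rightarrow> ('a \<Rightarrow> 'b) set"
  where "coalgebra_homs R C D =
    {f \<in> linear_maps R C D. \<forall>h\<in>carrier C.
      comult D (f h) = sweedler R C (tensor R D D) (\<lambda>a b. pure_tensor R D D (f a) (f b)) h \<and>
      counit D (f h) = counit C h}"

text \<open>The coalgebra \<open>k\<close>, with \<open>\<Delta>(r) = r (1 \<otimes> 1)\<close> and \<open>\<epsilon>(r) = r\<close>.\<close>

definition unit_coalgebra :: "('k, 'r) ring_scheme \<Rightarrow> ('k, 'k) coalgebra"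
  where "unit_coalgebra R =
    (let K = self_module R in
      module.extend K
        (coalgebra.fields
          (\<lambda>r. r \<odot>\<^bsub>tensor R K K\<^esub> pure_tensor R K K \<one>\<^bsub>R\<^esub> \<one>\<^bsub>R\<^esub>)
          (\<lambda>r. r)))"

text \<open>
  The coalgebra \<open>C \<otimes> D\<close>, with
  \<open>\<Delta>(c \<otimes> d) = (c\<^sub>(\<^sub>1\<^sub>) \<otimes> d\<^sub>(\<^sub>1\<^sub>)) \<otimes> (c\<^sub>(\<^sub>2\<^sub>) \<otimes> d\<^sub>(\<^sub>2\<^sub>))\<close>
  and \<open>\<epsilon>(c \<otimes> d) = \<epsilon>(c) \<epsilon>(d)\<close>.
\<close>

definition tensor_coalgebra ::
  "('k, 'r) ring_scheme \<Rightarrow> ('k, 'a, 'm) coalgebra_scheme \<Rightarrow> ('k, 'b, 'n) coalgebra_scheme \<Rightarrow>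
    ('k, ('a \<times> 'b \<Rightarrow> 'k) set) coalgebra"
  where "tensor_coalgebra R C D =
    (let T = tensor R C D; TT = tensor R T T in
      module.extend T
        (coalgebra.fields
          (tensor_lift R TT (\<lambda>c d.
            sweedler R C TT (\<lambda>c1 c2.
              sweedler R D TT (\<lambda>d1 d2.
                pure_tensor R T T (pure_tensor R C D c1 d1) (pure_tensor R C D c2 d2)) d) c))
          (tensor_lift R (self_module R) (\<lambda>c d. counit C c \<otimes>\<^bsub>R\<^esub> counit D d))))"


section \<open>Hopf categories\<close>

text \<open>
  \<open>Mor A x y\<close> is \<open>A\<^sub>x\<^sub>,\<^sub>y\<close>, \<open>comp_map A x y z\<close> is the map
  \<open>A\<^sub>x\<^sub>,\<^sub>y \<otimes> A\<^sub>y\<^sub>,\<^sub>z \<rightarrow> A\<^sub>x\<^sub>,\<^sub>z\<close>, and \<open>ident A x\<close> is \<open>1\<^sub>x\<close>. The carriers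
  of all \<open>A\<^sub>x\<^sub>,\<^sub>y\<close> are sets of elements of one type \<open>'a\<close>; they need not be disjoint or related.
\<close>

record ('x, 'k, 'a) hopf_category =
  Obj :: "'x set"
  Mor :: "'x \<Rightarrow> 'x \<Rightarrow> ('k, 'a) coalgebra"
  comp_map :: "'x \<Rightarrow> 'x \<Rightarrow> 'x \<Rightarrow> ('a \<times> 'a \<Rightarrow> 'k) set \<Rightarrow> 'a"
  ident :: "'x \<Rightarrow> 'a"
  antipode :: "'x \<Rightarrow> 'x \<Rightarrow> 'a \<Rightarrow> 'a"

text \<open>The product \<open>h l\<close> of \<open>h \<in> A\<^sub>x\<^sub>,\<^sub>y\<close> and \<open>l \<in> A\<^sub>y\<^sub>,\<^sub>z\<close>:\<close>

definition cat_mult ::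
  "('k, 'r) ring_scheme \<Rightarrow> ('x, 'k, 'a, 'h) hopf_category_scheme \<Rightarrow> 'x \<Rightarrow> 'x \<Rightarrow> 'x \<Rightarrow> 'a \<Rightarrow> 'a \<Rightarrow> 'a"
  where "cat_mult R A x y z h l = comp_map A x y z (pure_tensor R (Mor A x y) (Mor A y z) h l)"

locale hopf_category = cring R for R (structure) and A (structure) +
  assumes Mor_coalgebra: "\<lbrakk>x \<in> Obj A; y \<in> Obj A\<rbrakk> \<Longrightarrow> coalgebra R (Mor A x y)"
    and Mor_finitely_generated: "\<lbrakk>x \<in> Obj A; y \<in> Obj A\<rbrakk> \<Longrightarrow> finitely_generated R (Mor A x y)"
    and Mor_projective: "\<lbrakk>x \<in> Obj A; y \<in> Obj A\<rbrakk> \<Longrightarrow> projective R (Mor A x y)"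
    and comp_coalgebra_hom: "\<lbrakk>x \<in> Obj A; y \<in> Obj A; z \<in> Obj A\<rbrakk> \<Longrightarrow>
      comp_map A x y z \<in>
        coalgebra_homs R (tensor_coalgebra R (Mor A x y) (Mor A y z)) (Mor A x z)"
    and ident_closed: "x \<in> Obj A \<Longrightarrow> ident A x \<in> carrier (Mor A x x)"
    and ident_coalgebra_hom: "x \<in> Obj A \<Longrightarrow>
      (\<lambda>r. r \<odot>\<^bsub>Mor A x x\<^esub> ident A x) \<in> coalgebra_homs R (unit_coalgebra R) (Mor A x x)"
    and cat_assoc: "\<lbrakk>w \<in> Obj A; x \<in> Obj A; y \<in> Obj A; z \<in> Obj A;
        h \<in> carrier (Mor A w x); l \<in> carrier (Mor A x y); m \<in> carrier (Mor A y z)\<rbrakk> \<Longrightarrow>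
      cat_mult R A w y z (cat_mult R A w x y h l) m = cat_mult R A w x z h (cat_mult R A x y z l m)"
    and ident_left: "\<lbrakk>x \<in> Obj A; y \<in> Obj A; h \<in> carrier (Mor A x y)\<rbrakk> \<Longrightarrow>
      cat_mult R A x x y (ident A x) h = h"
    and ident_right: "\<lbrakk>x \<in> Obj A; y \<in> Obj A; h \<in> carrier (Mor A x y)\<rbrakk> \<Longrightarrow>
      cat_mult R A x y y h (ident A y) = h"
    and antipode_linear: "\<lbrakk>x \<in> Obj A; y \<in> Obj A\<rbrakk> \<Longrightarrow>
      antipode A x y \<in> linear_maps R (Mor A x y) (Mor A y x)"
    and antipode_right: "\<lbrakk>x \<in> Obj A; y \<in> Obj A; h \<in> carrier (Mor A x y)\<rbrakk> \<Longrightarrow>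
      sweedler R (Mor A x y) (Mor A x x) (\<lambda>a b. cat_mult R A x y x a (antipode A x y b)) h =
        counit (Mor A x y) h \<odot>\<^bsub>Mor A x x\<^esub> ident A x"
    and antipode_left: "\<lbrakk>x \<in> Obj A; y \<in> Obj A; h \<in> carrier (Mor A x y)\<rbrakk> \<Longrightarrow>
      sweedler R (Mor A x y) (Mor A y y) (\<lambda>a b. cat_mult R A y x y (antipode A x y a) b) h =
        counit (Mor A x y) h \<odot>\<^bsub>Mor A y y\<^esub> ident A y"


section \<open>Duals and integrals\<close>

text \<open>
  The dual \<open>C\<^sup>* = Hom(C, k)\<close>, with the opposite convolution product
  \<open>\<langle>f g, h\<rangle> = \<langle>f, h\<^sub>(\<^sub>2\<^sub>)\<rangle> \<langle>g, h\<^sub>(\<^sub>1\<^sub>)\<rangle>\<close>. Functionals are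
  extensional, so that they are equal if they agree on \<open>carrier C\<close>.
\<close>

definition dual :: "('k, 'r) ring_scheme \<Rightarrow> ('k, 'a, 'm) coalgebra_scheme \<Rightarrow> ('k, 'a \<Rightarrow> 'k) module"
  where "dual R C =
    \<lparr>carrier = linear_maps R C (self_module R) \<inter> extensional (carrier C),
     mult = (\<lambda>f g. \<lambda>h\<in>carrier C. sweedler R C (self_module R) (\<lambda>a b. f b \<otimes>\<^bsub>R\<^esub> g a) h),
     one = restrict (counit C) (carrier C),
     zero = (\<lambda>h\<in>carrier C. \<zero>\<^bsub>R\<^esub>),
     add = (\<lambda>f g. \<lambda>h\<in>carrier C. f h \<oplus>\<^bsub>R\<^esub> g h),
     smult = (\<lambda>r f. \<lambda>h\<in>carrier C. r \<otimes>\<^bsub>R\<^esub> f h)\<rparr>"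

definition left_integrals ::
  "('k, 'r) ring_scheme \<Rightarrow> ('x, 'k, 'a, 'h) hopf_category_scheme \<Rightarrow> 'x \<Rightarrow> ('k, 'a \<Rightarrow> 'k) module"
  where "left_integrals R A x =
    (let D = dual R (Mor A x x) in
      D\<lparr>carrier := {\<phi> \<in> carrier D. \<forall>f\<in>carrier D. \<phi> \<otimes>\<^bsub>D\<^esub> f = f (ident A x) \<odot>\<^bsub>D\<^esub> \<phi>}\<rparr>)"

text \<open>\<open>\<phi> \<leftharpoonup> a \<in> A\<^sub>x\<^sub>,\<^sub>y\<^sup>*\<close> for \<open>\<phi> \<in> A\<^sub>x\<^sub>,\<^sub>x\<^sup>*\<close> and \<open>a \<in> A\<^sub>x\<^sub>,\<^sub>y\<close>:\<close>

definition harpoon ::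
  "('k, 'r) ring_scheme \<Rightarrow> ('x, 'k, 'a, 'h) hopf_category_scheme \<Rightarrow> 'x \<Rightarrow> 'x \<Rightarrow> ('a \<Rightarrow> 'k) \<Rightarrow> 'a \<Rightarrow> 'a \<Rightarrow> 'k"
  where "harpoon R A x y \<phi> a =
    (\<lambda>b\<in>carrier (Mor A x y). \<phi> (cat_mult R A x y x b (antipode A x y a)))"

definition alpha ::
  "('k, 'r) ring_scheme \<Rightarrow> ('x, 'k, 'a, 'h) hopf_category_scheme \<Rightarrow> 'x \<Rightarrow> 'x \<Rightarrow>
    (('a \<Rightarrow> 'k) \<times> 'a \<Rightarrow> 'k) set \<Rightarrow> 'a \<Rightarrow> 'k"
  where "alpha R A x y = tensor_lift R (dual R (Mor A x y)) (harpoon R A x y)"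

end

theory Submission
  imports Defs
begin

text \<open>
  This is the fundamental theorem of Hopf modules for the functor \<open>y \<mapsto> A\<^sub>x\<^sub>,\<^sub>y\<^sup>*\<close>.
  The action \<open>\<leftharpoonup>\<close> extends to \<open>A\<^sub>x\<^sub>,\<^sub>y\<^sup>* \<otimes> A\<^sub>y\<^sub>,\<^sub>z \<rightarrow> A\<^sub>x\<^sub>,\<^sub>z\<^sup>*\<close>, and since
  \<open>A\<^sub>x\<^sub>,\<^sub>y\<close> is finitely generated projective, convolution turns into a coaction
  \<open>\<rho>(\<psi>) = \<psi>\<^sub>0 \<otimes> \<psi>\<^sub>1 \<in> A\<^sub>x\<^sub>,\<^sub>y\<^sup>* \<otimes> A\<^sub>x\<^sub>,\<^sub>y\<close>. Because \<open>S\<close> reverses products and coproducts,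
  \<open>\<rho>(\<psi> \<leftharpoonup> a) = \<psi>\<^sub>0 \<leftharpoonup> a\<^sub>(\<^sub>1\<^sub>) \<otimes> \<psi>\<^sub>1 a\<^sub>(\<^sub>2\<^sub>)\<close>. The left integrals are the coinvariants
  \<open>\<rho>(\<phi>) = \<phi> \<otimes> 1\<^sub>x\<close>, the map \<open>\<psi> \<mapsto> \<psi>\<^sub>0 \<leftharpoonup> S(\<psi>\<^sub>1)\<close> takes values in them, and the inverse of
  \<open>\<alpha>\<^sub>x\<^sub>,\<^sub>y\<close> is \<open>\<psi> \<mapsto> (\<psi>\<^sub>0 \<leftharpoonup> S(\<psi>\<^sub>1)) \<otimes> \<psi>\<^sub>2\<close>.
\<close>

subsection \<open>Linear and bilinear maps\<close>

text \<open>Sweedler sums are not sums here: h_1 and h_2 exist only through the bilinear map that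
  consumes them. \<open>sweedler R C P f h\<close> is the value at the coproduct of h of the linear
  map induced by f, so a calculation is a chain of equations between nested induced maps.
  Coassociativity, the counit and the antipode axioms may be used only where the surrounding
  expression is linear in each variable; \<open>lin\<close> and \<open>lin_dual\<close> collect the
  rules for this.

  Tensors over the dual of A_{x,y} cannot be compared term by term. As A_{x,y} is finitely generated
  projective, its dual tensored with Q is the module of linear maps A_{x,y} \<rightarrow> Q, so two
  tensors are equal if their values at every h are. This determines the coaction by \<psi>_0(h)
  \<psi>_1 = \<psi>(h_2) h_1 and turns its properties into identities in A.

  That S reverses products and coproducts is not among the axioms. The uniqueness argument for
  convolution inverses is carried out across varying objects, by inserting counits and expanding
  them with the antipode axioms.\<close>

lemma linear_mapsI:
  assumes "\<And>u. u \<in> carrier M \<Longrightarrow> f u \<in> carrier N"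
    and "\<And>u v. \<lbrakk>u \<in> carrier M; v \<in> carrier M\<rbrakk> \<Longrightarrow> f (u \<oplus>\<^bsub>M\<^esub> v) = f u \<oplus>\<^bsub>N\<^esub> f v"
    and "\<And>r u. \<lbrakk>r \<in> carrier R; u \<in> carrier M\<rbrakk> \<Longrightarrow> f (r \<odot>\<^bsub>M\<^esub> u) = r \<odot>\<^bsub>N\<^esub> f u"
  shows "f \<in> linear_maps R M N"
  using assms unfolding linear_maps_def by auto

lemma linear_maps_closed: "\<lbrakk>f \<in> linear_maps R M N; u \<in> carrier M\<rbrakk> \<Longrightarrow> f u \<in> carrier N"
  and linear_maps_add: "\<lbrakk>f \<in> linear_maps R M N; u \<in> carrier M; v \<in> carrier M\<rbrakk> \<Longrightarrow>
    f (u \<oplus>\<^bsub>M\<^esub> v) = f u \<oplus>\<^bsub>N\<^esub> f v"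
  and linear_maps_smult: "\<lbrakk>f \<in> linear_maps R M N; r \<in> carrier R; u \<in> carrier M\<rbrakk> \<Longrightarrow>
    f (r \<odot>\<^bsub>M\<^esub> u) = r \<odot>\<^bsub>N\<^esub> f u"
  unfolding linear_maps_def by auto

text \<open>\<open>linear_maps\<close> constrains a function only on the carrier. This allows
  passing between a functional and its restriction, which is what \<open>dual\<close>
  contains.\<close>

lemma linear_maps_cong:
  assumes "module R M" "\<And>u. u \<in> carrier M \<Longrightarrow> f u = g u"
  shows "f \<in> linear_maps R M N \<longleftrightarrow> g \<in> linear_maps R M N"
proof -
  interpret module R M by fact
  show ?thesis using assms(2) unfolding linear_maps_def by (auto simp: Pi_iff)
qed

lemma linear_maps_zero:
  assumes "module R M" "module R N" "f \<in> linear_maps R M N"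
  shows "f \<zero>\<^bsub>M\<^esub> = \<zero>\<^bsub>N\<^esub>"
proof -
  interpret M: module R M by fact
  interpret N: module R N by fact
  have "f (\<zero>\<^bsub>R\<^esub> \<odot>\<^bsub>M\<^esub> \<zero>\<^bsub>M\<^esub>) = \<zero>\<^bsub>R\<^esub> \<odot>\<^bsub>N\<^esub> f \<zero>\<^bsub>M\<^esub>"
    using assms(3) by (simp add: linear_maps_smult del: M.smult_l_null M.smult_r_null)
  then show ?thesis using linear_maps_closed[OF assms(3)] by simp
qed

lemma linear_maps_minus:
  assumes "module R M" "module R N" "f \<in> linear_maps R M N" "u \<in> carrier M"
  shows "f (\<ominus>\<^bsub>M\<^esub> u) = \<ominus>\<^bsub>N\<^esub> f u"
proof -
  interpret M: module R M by fact
  interpret N: module R N by fact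
  have "f (\<ominus>\<^bsub>M\<^esub> u) \<oplus>\<^bsub>N\<^esub> f u = \<zero>\<^bsub>N\<^esub>"
    using assms linear_maps_add[OF assms(3), of "\<ominus>\<^bsub>M\<^esub> u" u] linear_maps_zero[OF assms(1-3)]
    by (simp add: M.l_neg)
  then show ?thesis
    using assms linear_maps_closed[OF assms(3)] by (simp add: N.minus_equality)
qed

lemma linear_maps_diff:
  assumes "module R M" "module R N" "f \<in> linear_maps R M N" "u \<in> carrier M" "v \<in> carrier M"
  shows "f (u \<ominus>\<^bsub>M\<^esub> v) = f u \<ominus>\<^bsub>N\<^esub> f v"
proof -
  interpret M: module R M by fact
  interpret N: module R N by fact
  show ?thesis
    using assms by (simp add: a_minus_def linear_maps_add linear_maps_minus)
qed

lemma linear_maps_finsum: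
  assumes "module R M" "module R N" "f \<in> linear_maps R M N" "g \<in> I \<rightarrow> carrier M"
  shows "f (finsum M g I) = (\<Oplus>\<^bsub>N\<^esub>i\<in>I. f (g i))"
proof -
  interpret M: module R M by fact
  interpret N: module R N by fact
  show ?thesis using assms(4)
  proof (induction I rule: infinite_finite_induct)
    case (insert i I)
    then have "f (finsum M g (insert i I)) = f (g i) \<oplus>\<^bsub>N\<^esub> f (finsum M g I)"
      using assms(3) by (simp add: M.finsum_insert M.finsum_closed linear_maps_add)
    with insert show ?case
      using linear_maps_closed[OF assms(3)] by (simp add: N.finsum_insert Pi_iff)
  \<comment> \<open>Over an infinite index set both sums are zero by convention, as over the empty
    one, so these cases reduce to f mapping zero to zero.\<close>
  qed (use linear_maps_zero[OF assms(1-3)] in \<open>simp_all add: M.finsum_infinite N.finsum_infinite\<close>)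
qed

lemma linear_maps_ident: "(\<lambda>u. u) \<in> linear_maps R M M"
  by (rule linear_mapsI) simp_all

lemma linear_maps_compose:
  assumes "g \<in> linear_maps R N P" "f \<in> linear_maps R M N"
  shows "(\<lambda>u. g (f u)) \<in> linear_maps R M P"
  using assms unfolding linear_maps_def by (auto simp: Pi_iff)

lemma linear_maps_plus:
  assumes "module R M" "module R N" "f \<in> linear_maps R M N" "g \<in> linear_maps R M N"
  shows "(\<lambda>u. f u \<oplus>\<^bsub>N\<^esub> g u) \<in> linear_maps R M N"
proof -
  interpret M: module R M by fact
  interpret N: module R N by fact
  note [simp] = linear_maps_closed[OF assms(3)] linear_maps_closed[OF assms(4)]
    linear_maps_add[OF assms(3)] linear_maps_add[OF assms(4)]
    linear_maps_smult[OF assms(3)] linear_maps_smult[OF assms(4)]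
  show ?thesis
    by (rule linear_mapsI) (simp_all add: N.a_ac N.smult_r_distr)
qed

lemma linear_maps_finsum_pointwise:
  assumes "module R M" "module R N" "\<And>i. i \<in> I \<Longrightarrow> f i \<in> linear_maps R M N"
  shows "(\<lambda>u. \<Oplus>\<^bsub>N\<^esub>i\<in>I. f i u) \<in> linear_maps R M N"
proof -
  interpret M: module R M by fact
  interpret N: module R N by fact
  have zero: "(\<lambda>u. \<zero>\<^bsub>N\<^esub>) \<in> linear_maps R M N"
    by (rule linear_mapsI) simp_all
  show ?thesis using assms(3)
  proof (induction I rule: infinite_finite_induct)
    case (insert i I)
    have lin: "(\<lambda>u. f i u \<oplus>\<^bsub>N\<^esub> (\<Oplus>\<^bsub>N\<^esub>i\<in>I. f i u)) \<in> linear_maps R M N"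
      using insert by (intro linear_maps_plus assms(1,2)) auto
    have "f j u \<in> carrier N" if "j \<in> insert i I" "u \<in> carrier M" for j u
      using linear_maps_closed[OF insert.prems[OF that(1)] that(2)] .
    then have "f i u \<oplus>\<^bsub>N\<^esub> (\<Oplus>\<^bsub>N\<^esub>i\<in>I. f i u) = (\<Oplus>\<^bsub>N\<^esub>i\<in>insert i I. f i u)" if "u \<in> carrier M" for u
      using that insert.hyps by (simp add: N.finsum_insert Pi_iff)
    then show ?case
      using lin by (rule linear_maps_cong[OF assms(1), THEN iffD1])
  qed (simp_all add: N.finsum_infinite zero)
qed

text \<open>Curried and unrestricted off the carriers, so that a lambda term from a Sweedler
  calculation qualifies as it stands and a partial application \<open>f u\<close> is itself a linear
  map.\<close>

definition bilinear_maps ::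
  "('k, 'r) ring_scheme \<Rightarrow> ('k, 'a, 'm) module_scheme \<Rightarrow> ('k, 'b, 'n) module_scheme \<Rightarrow>
    ('k, 'c, 'p) module_scheme \<Rightarrow> ('a \<Rightarrow> 'b \<Rightarrow> 'c) set"
  where "bilinear_maps R M N P =
    {f. (\<forall>u\<in>carrier M. f u \<in> linear_maps R N P) \<and>
      (\<forall>v\<in>carrier N. (\<lambda>u. f u v) \<in> linear_maps R M P)}"

lemma bilinear_mapsI:
  assumes "\<And>u. u \<in> carrier M \<Longrightarrow> f u \<in> linear_maps R N P"
    and "\<And>v. v \<in> carrier N \<Longrightarrow> (\<lambda>u. f u v) \<in> linear_maps R M P"
  shows "f \<in> bilinear_maps R M N P"
  using assms unfolding bilinear_maps_def by auto

lemma bilinear_maps_left: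
    "\<lbrakk>f \<in> bilinear_maps R M N P; v \<in> carrier N\<rbrakk> \<Longrightarrow> (\<lambda>u. f u v) \<in> linear_maps R M P"
  and bilinear_maps_right:
    "\<lbrakk>f \<in> bilinear_maps R M N P; u \<in> carrier M\<rbrakk> \<Longrightarrow> f u \<in> linear_maps R N P"
  unfolding bilinear_maps_def by auto

lemma bilinear_maps_closed:
  "\<lbrakk>f \<in> bilinear_maps R M N P; u \<in> carrier M; v \<in> carrier N\<rbrakk> \<Longrightarrow> f u v \<in> carrier P"
  by (meson bilinear_maps_right linear_maps_closed)

lemma bilinear_maps_compose_left:
  assumes "f \<in> bilinear_maps R M N P" "g \<in> linear_maps R Q M" "v \<in> carrier N"
  shows "(\<lambda>u. f (g u) v) \<in> linear_maps R Q P"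
  using linear_maps_compose[OF bilinear_maps_left[OF assms(1,3)] assms(2)] .

lemma bilinear_maps_compose_right:
  assumes "f \<in> bilinear_maps R M N P" "g \<in> linear_maps R Q N" "u \<in> carrier M"
  shows "(\<lambda>v. f u (g v)) \<in> linear_maps R Q P"
  using linear_maps_compose[OF bilinear_maps_right[OF assms(1,3)] assms(2)] .

lemma bilinear_maps_compose:
  assumes "g \<in> linear_maps R P Q" "f \<in> bilinear_maps R M N P"
  shows "(\<lambda>u v. g (f u v)) \<in> bilinear_maps R M N Q"
  using assms unfolding bilinear_maps_def by (auto intro: linear_maps_compose)


subsection \<open>The base ring and free modules\<close>

lemma self_module_simps [simp]:
  "carrier (self_module R) = carrier R" "add (self_module R) = add R"
  "smult (self_module R) = mult R" "zero (self_module R) = zero R"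
  unfolding self_module_def by simp_all

lemma self_module_module: "cring R \<Longrightarrow> module R (self_module R)"
proof -
  assume "cring R"
  then interpret cring R .
  show ?thesis
    by (intro moduleI abelian_groupI is_cring) 
      (auto simp: a_ac m_assoc l_distr r_distr intro: l_neg)
qed

text \<open>Seen as a map from k and M to M, scalar multiplication is one more bilinear map.
  Linearity of a scalar multiple in either factor, also for M = k, then follows by
  composition.\<close>

lemma smult_bilinear:
  assumes "module R M"
  shows "smult M \<in> bilinear_maps R (self_module R) M M"
proof -
  interpret module R M by fact
  show ?thesis
    by (intro bilinear_mapsI linear_mapsI)
      (auto simp: smult_l_distr smult_r_distr smult_assoc1[symmetric] m_comm)
qed

lemma linear_maps_smult_left:
  assumes "module R P" "g \<in> linear_maps R M (self_module R)" "p \<in> carrier P"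
  shows "(\<lambda>u. g u \<odot>\<^bsub>P\<^esub> p) \<in> linear_maps R M P"
  by (rule bilinear_maps_compose_left[OF smult_bilinear[OF assms(1)] assms(2,3)])

lemma linear_maps_smult_right:
  assumes "module R P" "g \<in> linear_maps R M P" "r \<in> carrier R"
  shows "(\<lambda>u. r \<odot>\<^bsub>P\<^esub> g u) \<in> linear_maps R M P"
  using bilinear_maps_compose_right[OF smult_bilinear[OF assms(1)] assms(2)] assms(3) by simp

lemma linear_maps_mult_left:
  assumes "cring R" "g \<in> linear_maps R M (self_module R)" "r \<in> carrier R"
  shows "(\<lambda>u. g u \<otimes>\<^bsub>R\<^esub> r) \<in> linear_maps R M (self_module R)"
  using linear_maps_smult_left[OF self_module_module[OF assms(1)] assms(2)] assms(3) by simp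

lemma linear_maps_mult_right:
  assumes "cring R" "g \<in> linear_maps R M (self_module R)" "r \<in> carrier R"
  shows "(\<lambda>u. r \<otimes>\<^bsub>R\<^esub> g u) \<in> linear_maps R M (self_module R)"
  using linear_maps_smult_right[OF self_module_module[OF assms(1)] assms(2,3)] by simp

lemma free_module_simps [simp]:
  "carrier (free_module R I) =
    {c. (\<forall>i. c i \<in> carrier R) \<and> (\<forall>i. i \<notin> I \<longrightarrow> c i = \<zero>\<^bsub>R\<^esub>) \<and> finite {i. c i \<noteq> \<zero>\<^bsub>R\<^esub>}}"
  "add (free_module R I) = (\<lambda>c d i. c i \<oplus>\<^bsub>R\<^esub> d i)"
  "smult (free_module R I) = (\<lambda>r c i. r \<otimes>\<^bsub>R\<^esub> c i)"
  "zero (free_module R I) = (\<lambda>i. \<zero>\<^bsub>R\<^esub>)"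
  unfolding free_module_def by simp_all

lemma free_module_module: 
  assumes "cring R"
  shows "module R (free_module R I)"
proof -
  interpret cring R by fact
  have supp_add: "finite {i. c i \<oplus>\<^bsub>R\<^esub> d i \<noteq> \<zero>\<^bsub>R\<^esub>}"
    if "finite {i. c i \<noteq> \<zero>\<^bsub>R\<^esub>}" "finite {i. d i \<noteq> \<zero>\<^bsub>R\<^esub>}" for c d :: "'c \<Rightarrow> 'a"
    by (rule finite_subset[OF _ finite_UnI[OF that]]) auto
  have supp_smult: "finite {i. r \<otimes>\<^bsub>R\<^esub> c i \<noteq> \<zero>\<^bsub>R\<^esub>}"
    if "finite {i. c i \<noteq> \<zero>\<^bsub>R\<^esub>}" "r \<in> carrier R" for c :: "'c \<Rightarrow> 'a" and r
    by (rule finite_subset[OF _ that(1)]) (use that(2) in auto)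
  have supp_neg: "finite {i. \<ominus>\<^bsub>R\<^esub> c i \<noteq> \<zero>\<^bsub>R\<^esub>}"
    if "finite {i. c i \<noteq> \<zero>\<^bsub>R\<^esub>}" for c :: "'c \<Rightarrow> 'a"
    by (rule finite_subset[OF _ that(1)]) auto
  show ?thesis
  proof (intro moduleI abelian_groupI is_cring)
    fix c assume c: "c \<in> carrier (free_module R I)"
    then show "\<exists>d\<in>carrier (free_module R I).
        d \<oplus>\<^bsub>free_module R I\<^esub> c = \<zero>\<^bsub>free_module R I\<^esub>"
      by (intro bexI[of _ "\<lambda>i. \<ominus>\<^bsub>R\<^esub> c i"]) (auto simp: supp_neg l_neg)
  qed (auto simp: supp_add supp_smult fun_eq_iff a_ac m_assoc l_distr r_distr)
qed

lemma free_basis_closed: "\<lbrakk>cring R; i \<in> I\<rbrakk> \<Longrightarrow> free_basis R i \<in> carrier (free_module R I)"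
proof -
  assume "cring R" "i \<in> I"
  then interpret cring R by simp
  have "finite {j. free_basis R i j \<noteq> \<zero>\<^bsub>R\<^esub>}"
    by (rule finite_subset[of _ "{i}"]) (auto simp: free_basis_def)
  then show ?thesis using \<open>i \<in> I\<close> by (auto simp: free_basis_def)
qed

text \<open>Equality of functions is checked index by index. Evaluation at j is linear, so it passes
  through the sum, in which only the term i = j can survive.\<close>

lemma free_module_expand:
  assumes "cring R" and c: "c \<in> carrier (free_module R I)"
  shows "c = (\<Oplus>\<^bsub>free_module R I\<^esub>i\<in>{i. c i \<noteq> \<zero>\<^bsub>R\<^esub>}. c i \<odot>\<^bsub>free_module R I\<^esub> free_basis R i)"
proof
  fix j
  interpret cring R by fact
  let ?F = "free_module R I" and ?S = "{i. c i \<noteq> \<zero>\<^bsub>R\<^esub>}"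
  interpret F: module R ?F by (rule free_module_module) fact
  have ev: "(\<lambda>c. c j) \<in> linear_maps R ?F (self_module R)"
    by (rule linear_mapsI) auto
  have S: "?S \<subseteq> I" "finite ?S" and cR: "c i \<in> carrier R" for i
    using c by auto
  have clo: "(\<lambda>i. c i \<odot>\<^bsub>?F\<^esub> free_basis R i) \<in> ?S \<rightarrow> carrier ?F"
    using free_basis_closed[OF assms(1), of _ I] S(1) cR by (intro Pi_I F.smult_closed) auto
  have "(\<Oplus>\<^bsub>?F\<^esub>i\<in>?S. c i \<odot>\<^bsub>?F\<^esub> free_basis R i) j =
      (\<Oplus>\<^bsub>self_module R\<^esub>i\<in>?S. (c i \<odot>\<^bsub>?F\<^esub> free_basis R i) j)"
    by (rule linear_maps_finsum[OF F.module_axioms self_module_module[OF assms(1)] ev clo])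
  also have "\<dots> = (\<Oplus>\<^bsub>self_module R\<^esub>i\<in>?S. if j = i then c i else \<zero>\<^bsub>self_module R\<^esub>)"
    using cR by (intro arg_cong[of _ _ "\<lambda>g. finsum (self_module R) g ?S"] ext) (simp add: free_basis_def)
  also have "\<dots> = c j"
  proof (cases "j \<in> ?S")
    interpret K: module R "self_module R" by (rule self_module_module) fact
    case True
    then show ?thesis
      using K.finsum_singleton[OF True S(2), of c] cR by (simp add: Pi_iff)
  next
    interpret K: module R "self_module R" by (rule self_module_module) fact
    case False
    then have "(\<Oplus>\<^bsub>self_module R\<^esub>i\<in>?S. if j = i then c i else \<zero>\<^bsub>self_module R\<^esub>) =
        (\<Oplus>\<^bsub>self_module R\<^esub>i\<in>?S. \<zero>\<^bsub>self_module R\<^esub>)"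
      by (intro K.add.finprod_cong') auto
    with False show ?thesis using K.finsum_zero by simp
  qed
  finally show "c j = (\<Oplus>\<^bsub>?F\<^esub>i\<in>?S. c i \<odot>\<^bsub>?F\<^esub> free_basis R i) j" by simp
qed

lemma free_module_ext:
  assumes "cring R" "module R P" "f \<in> linear_maps R (free_module R I) P"
    "g \<in> linear_maps R (free_module R I) P" "\<And>i. i \<in> I \<Longrightarrow> f (free_basis R i) = g (free_basis R i)"
    "c \<in> carrier (free_module R I)"
  shows "f c = g c"
proof -
  let ?F = "free_module R I" and ?S = "{i. c i \<noteq> \<zero>\<^bsub>R\<^esub>}"
  interpret F: module R ?F by (rule free_module_module) fact
  interpret P: module R P by fact
  have S: "?S \<subseteq> I" and cR: "c i \<in> carrier R" for i
    using assms(6) by auto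
  have b: "free_basis R i \<in> carrier ?F" if "i \<in> ?S" for i
    using that S free_basis_closed[OF assms(1), of i I] by auto
  then have clo: "(\<lambda>i. c i \<odot>\<^bsub>?F\<^esub> free_basis R i) \<in> ?S \<rightarrow> carrier ?F"
    using cR by (intro Pi_I F.smult_closed)
  have expand: "h c = (\<Oplus>\<^bsub>P\<^esub>i\<in>?S. c i \<odot>\<^bsub>P\<^esub> h (free_basis R i))"
    if h: "h \<in> linear_maps R ?F P" for h
  proof -
    have "h c = h (\<Oplus>\<^bsub>?F\<^esub>i\<in>?S. c i \<odot>\<^bsub>?F\<^esub> free_basis R i)"
      using free_module_expand[OF assms(1,6)] by simp
    also have "\<dots> = (\<Oplus>\<^bsub>P\<^esub>i\<in>?S. h (c i \<odot>\<^bsub>?F\<^esub> free_basis R i))"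
      by (rule linear_maps_finsum[OF F.module_axioms assms(2) h clo])
    also have "\<dots> = (\<Oplus>\<^bsub>P\<^esub>i\<in>?S. c i \<odot>\<^bsub>P\<^esub> h (free_basis R i))"
      using b cR h by (intro P.finsum_cong') (auto simp: linear_maps_smult linear_maps_closed simp del: free_module_simps)
    finally show ?thesis .
  qed
  show ?thesis
    unfolding expand[OF assms(3)] expand[OF assms(4)]
    using b cR assms(4,5) S
    by (intro P.finsum_cong') (auto simp: linear_maps_closed simp del: free_module_simps)
qed

text \<open>The linear extension of g from the basis. The sum over the support has the shape used in
  \<open>tensor_lift\<close>, which therefore sends a coset to its image under a
  \<open>free_lift\<close>.\<close>

definition free_lift :: "('k, 'r) ring_scheme \<Rightarrow> ('k, 'c, 'p) module_scheme \<Rightarrow> ('i \<Rightarrow> 'c) \<Rightarrow> ('i \<Rightarrow> 'k) \<Rightarrow> 'c"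
  where "free_lift R P g c = (\<Oplus>\<^bsub>P\<^esub>i\<in>{i. c i \<noteq> \<zero>\<^bsub>R\<^esub>}. c i \<odot>\<^bsub>P\<^esub> g i)"

lemma free_lift_linear:
  assumes "module R P" "g \<in> I \<rightarrow> carrier P"
  shows "free_lift R P g \<in> linear_maps R (free_module R I) P"
proof -
  interpret P: module R P by fact
  interpret F: module R "free_module R I" by (rule free_module_module) (rule P.is_cring)
  \<comment> \<open>The supports of c, d and their sum differ. Padding with zero terms lets all
    three sums run over one finite set.\<close>
  have superset: "free_lift R P g c = (\<Oplus>\<^bsub>P\<^esub>i\<in>S. c i \<odot>\<^bsub>P\<^esub> g i)"
    if "finite S" "{i. c i \<noteq> \<zero>\<^bsub>R\<^esub>} \<subseteq> S" "S \<subseteq> I" "\<And>i. c i \<in> carrier R" for c S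
    unfolding free_lift_def using that assms(2)
    by (intro P.add.finprod_mono_neutral_cong_left) (auto simp: Pi_iff subset_iff)
  have clo: "(\<lambda>i. c i \<odot>\<^bsub>P\<^esub> g i) \<in> S \<rightarrow> carrier P" if "S \<subseteq> I" "\<And>i. c i \<in> carrier R" for c S
    using that assms(2) by auto
  show ?thesis
  proof (rule linear_mapsI)
    fix c assume "c \<in> carrier (free_module R I)"
    then show "free_lift R P g c \<in> carrier P"
      unfolding free_lift_def by (intro P.finsum_closed clo) auto
  next
    fix c d assume cd: "c \<in> carrier (free_module R I)" "d \<in> carrier (free_module R I)"
    then have cd': "c \<oplus>\<^bsub>free_module R I\<^esub> d \<in> carrier (free_module R I)" by blast
    let ?S = "{i. c i \<noteq> \<zero>\<^bsub>R\<^esub>} \<union> {i. d i \<noteq> \<zero>\<^bsub>R\<^esub>}"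
    have S: "finite ?S" "?S \<subseteq> I" using cd by auto
    have "free_lift R P g (c \<oplus>\<^bsub>free_module R I\<^esub> d) = (\<Oplus>\<^bsub>P\<^esub>i\<in>?S. (c i \<oplus>\<^bsub>R\<^esub> d i) \<odot>\<^bsub>P\<^esub> g i)"
      using S cd by (subst superset) auto
    also have "\<dots> = (\<Oplus>\<^bsub>P\<^esub>i\<in>?S. c i \<odot>\<^bsub>P\<^esub> g i \<oplus>\<^bsub>P\<^esub> d i \<odot>\<^bsub>P\<^esub> g i)"
      using S cd assms(2) by (intro P.finsum_cong') (auto simp: P.smult_l_distr Pi_iff subset_iff)
    also have "\<dots> = (\<Oplus>\<^bsub>P\<^esub>i\<in>?S. c i \<odot>\<^bsub>P\<^esub> g i) \<oplus>\<^bsub>P\<^esub> (\<Oplus>\<^bsub>P\<^esub>i\<in>?S. d i \<odot>\<^bsub>P\<^esub> g i)"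
      using S cd by (intro P.finsum_addf clo) auto
    also have "\<dots> = free_lift R P g c \<oplus>\<^bsub>P\<^esub> free_lift R P g d"
      using S cd by (subst (1 2) superset[of ?S]) auto
    finally show "free_lift R P g (c \<oplus>\<^bsub>free_module R I\<^esub> d) = free_lift R P g c \<oplus>\<^bsub>P\<^esub> free_lift R P g d" .
  next
    fix r c assume r: "r \<in> carrier R" and c: "c \<in> carrier (free_module R I)"
    let ?S = "{i. c i \<noteq> \<zero>\<^bsub>R\<^esub>}"
    have S: "finite ?S" "?S \<subseteq> I" using c by auto
    have "free_lift R P g (r \<odot>\<^bsub>free_module R I\<^esub> c) = (\<Oplus>\<^bsub>P\<^esub>i\<in>?S. (r \<otimes>\<^bsub>R\<^esub> c i) \<odot>\<^bsub>P\<^esub> g i)"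
      using S c r by (subst superset[of ?S]) auto
    also have "\<dots> = (\<Oplus>\<^bsub>P\<^esub>i\<in>?S. r \<odot>\<^bsub>P\<^esub> (c i \<odot>\<^bsub>P\<^esub> g i))"
      using S c r assms(2) by (intro P.finsum_cong') (auto simp: P.smult_assoc1 Pi_iff subset_iff)
    also have "\<dots> = r \<odot>\<^bsub>P\<^esub> free_lift R P g c"
      unfolding free_lift_def using S c r by (intro P.finsum_smult_ldistr[symmetric] clo) auto
    finally show "free_lift R P g (r \<odot>\<^bsub>free_module R I\<^esub> c) = r \<odot>\<^bsub>P\<^esub> free_lift R P g c" .
  qed
qed

lemma free_lift_basis:
  assumes "module R P" "g i \<in> carrier P"
  shows "free_lift R P g (free_basis R i) = g i"
proof -
  interpret P: module R P by fact
  show ?thesis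
  proof (cases "\<one>\<^bsub>R\<^esub> = \<zero>\<^bsub>R\<^esub>")
    \<comment> \<open>In the zero ring the basis vector has empty support and the sum is zero;
      \<open>g i\<close> is zero too, being 1 times itself.\<close>
    case True
    then have "g i = \<zero>\<^bsub>P\<^esub>"
      using P.smult_one[OF assms(2)] P.smult_l_null[OF assms(2)] by simp
    then show ?thesis using True by (simp add: free_lift_def free_basis_def)
  next
    case False
    then have "{j. free_basis R i j \<noteq> \<zero>\<^bsub>R\<^esub>} = {i}"
      by (auto simp: free_basis_def)
    then show ?thesis using assms(2) by (simp add: free_lift_def free_basis_def)
  qed
qed

subsection \<open>Quotients and tensor products\<close>

context module
begin

lemma submodule_abelian_subgroup:
  "submodule H R M \<Longrightarrow> abelian_subgroup H M"
  by (intro abelian_subgroupI3 additive_subgroupI abelian_group_axioms) (rule submodule.axioms)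

text \<open>In \<open>quotient_module\<close> the scalar multiple of a coset is a union over its
  representatives. H is closed under scalars, so all sets in this union are the same coset.\<close>

lemma quotient_smult:
  assumes H: "submodule H R M" and "r \<in> carrier R" "u \<in> carrier M"
  shows "r \<odot>\<^bsub>quotient_module M H\<^esub> (H +>\<^bsub>M\<^esub> u) = H +>\<^bsub>M\<^esub> (r \<odot>\<^bsub>M\<^esub> u)"
proof -
  interpret H: abelian_subgroup H M by (rule submodule_abelian_subgroup) fact
  have eq: "H +>\<^bsub>M\<^esub> (r \<odot>\<^bsub>M\<^esub> v) = H +>\<^bsub>M\<^esub> (r \<odot>\<^bsub>M\<^esub> u)" if v: "v \<in> H +>\<^bsub>M\<^esub> u" for v
  proof -
    obtain w where w: "w \<in> H" "v = w \<oplus>\<^bsub>M\<^esub> u"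
      using v unfolding a_r_coset_def' by auto
    then have "r \<odot>\<^bsub>M\<^esub> w \<in> H" "w \<in> carrier M"
      using submodule.smult_closed[OF H] assms H.a_subset by auto
    then have "r \<odot>\<^bsub>M\<^esub> v \<in> H +>\<^bsub>M\<^esub> (r \<odot>\<^bsub>M\<^esub> u)"
      using w assms by (simp add: smult_r_distr a_rcosI H.a_subset)
    then show ?thesis
      using assms H.a_subgroup by (simp add: a_repr_independence)
  qed
  have "u \<in> H +>\<^bsub>M\<^esub> u" by (rule H.a_rcos_self) fact
  moreover have "(\<Union>v\<in>H +>\<^bsub>M\<^esub> u. H +>\<^bsub>M\<^esub> (r \<odot>\<^bsub>M\<^esub> v)) = (\<Union>v\<in>H +>\<^bsub>M\<^esub> u. H +>\<^bsub>M\<^esub> (r \<odot>\<^bsub>M\<^esub> u))"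
    by (rule SUP_cong[OF refl]) (rule eq)
  ultimately show ?thesis by (auto simp: quotient_module_def)
qed

lemma quotient_add:
  assumes H: "submodule H R M" and "u \<in> carrier M" "v \<in> carrier M"
  shows "(H +>\<^bsub>M\<^esub> u) \<oplus>\<^bsub>quotient_module M H\<^esub> (H +>\<^bsub>M\<^esub> v) = H +>\<^bsub>M\<^esub> (u \<oplus>\<^bsub>M\<^esub> v)"
proof -
  interpret H: abelian_subgroup H M by (rule submodule_abelian_subgroup) fact
  show ?thesis using assms by (simp add: quotient_module_def H.a_rcos_sum)
qed

lemma quotient_carrier:
  "carrier (quotient_module M H) = (\<lambda>u. H +>\<^bsub>M\<^esub> u) ` carrier M"
  by (auto simp: quotient_module_def A_RCOSETS_def')

lemma quotient_module_module:
  assumes H: "submodule H R M"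
  shows "module R (quotient_module M H)"
proof -
  interpret H: abelian_subgroup H M by (rule submodule_abelian_subgroup) fact
  have zero: "\<zero>\<^bsub>quotient_module M H\<^esub> = H +>\<^bsub>M\<^esub> \<zero>\<^bsub>M\<^esub>"
    using H.a_subset by (simp add: quotient_module_def)
  \<comment> \<open>Keeps the zero of the quotient written as the coset of \<zero>, the form to
    which \<open>quotient_add\<close> applies.\<close>
  note [simp del] = a_coset_add_zero
  have "abelian_group (quotient_module M H)"
  proof (rule abelian_groupI)
    fix U assume "U \<in> carrier (quotient_module M H)"
    then obtain u where u: "u \<in> carrier M" "U = H +>\<^bsub>M\<^esub> u" by (auto simp: quotient_carrier)
    show "\<exists>V\<in>carrier (quotient_module M H). V \<oplus>\<^bsub>quotient_module M H\<^esub> U = \<zero>\<^bsub>quotient_module M H\<^esub>"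
      using u by (intro bexI[of _ "H +>\<^bsub>M\<^esub> (\<ominus>\<^bsub>M\<^esub> u)"])
        (auto simp: quotient_add H l_neg quotient_carrier zero)
    show "\<zero>\<^bsub>quotient_module M H\<^esub> \<oplus>\<^bsub>quotient_module M H\<^esub> U = U"
      using u by (simp add: quotient_add H zero)
  next
    show "\<zero>\<^bsub>quotient_module M H\<^esub> \<in> carrier (quotient_module M H)"
      by (simp add: quotient_carrier zero)
  qed (auto simp: quotient_carrier quotient_add H a_ac intro!: imageI)
  then show ?thesis
    by (intro moduleI is_cring)
      (auto simp: quotient_carrier quotient_add quotient_smult H smult_l_distr smult_r_distr
        smult_assoc1)
qed

lemma quotient_projection_linear:
  "submodule H R M \<Longrightarrow> (\<lambda>u. H +>\<^bsub>M\<^esub> u) \<in> linear_maps R M (quotient_module M H)"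
  by (intro linear_mapsI) (auto simp: quotient_carrier quotient_add quotient_smult)

lemma generated_submodule_submodule:
  assumes "B \<subseteq> carrier M"
  shows "submodule (generated_submodule R M B) R M"
proof (rule submoduleI)
  show "generated_submodule R M B \<subseteq> carrier M"
    unfolding generated_submodule_def using carrier_is_submodule assms by blast
  have zero: "\<zero>\<^bsub>M\<^esub> \<in> H" if "submodule H R M" for H
    using that submodule_abelian_subgroup[OF that]
    by (simp add: abelian_subgroup_def additive_subgroup.zero_closed)
  show "\<zero>\<^bsub>M\<^esub> \<in> generated_submodule R M B"
    unfolding generated_submodule_def using zero by blast
qed (auto simp: generated_submodule_def intro: submoduleE(3-5))

text \<open>Once a linear map kills a set of relations, its kernel is one of the submodules
  intersected in \<open>generated_submodule\<close>, so it kills everything that they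
  generate.\<close>

lemma kernel_submodule:
  assumes "module R N" "f \<in> linear_maps R M N"
  shows "submodule {u \<in> carrier M. f u = \<zero>\<^bsub>N\<^esub>} R M"
proof -
  interpret N: module R N by fact
  show ?thesis
    by (rule submoduleI)
      (auto simp: linear_maps_zero[OF module_axioms assms] linear_maps_minus[OF module_axioms assms]
        linear_maps_add[OF assms(2)] linear_maps_smult[OF assms(2)])
qed

end

section \<open>The tensor product and its universal property\<close>

lemma tensor_relations_closed:
  assumes "module R M" "module R N"
  shows "tensor_relations R M N \<subseteq> carrier (free_module R (carrier M \<times> carrier N))"
proof -
  interpret M: module R M by fact
  interpret N: module R N by fact
  let ?F = "free_module R (carrier M \<times> carrier N)"
  interpret F: module R ?F by (rule free_module_module) (rule M.is_cring)
  note b = free_basis_closed[OF M.is_cring, of _ "carrier M \<times> carrier N"]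
  show ?thesis unfolding tensor_relations_def Let_def
    by (auto simp del: free_module_simps intro!: F.minus_closed F.add.m_closed F.smult_closed b)
qed

lemma tensor_kernel_submodule:
  assumes "module R M" "module R N"
  shows "submodule (tensor_kernel R M N) R (free_module R (carrier M \<times> carrier N))"
proof -
  interpret M: module R M by fact
  interpret F: module R "free_module R (carrier M \<times> carrier N)"
    by (rule free_module_module) (rule M.is_cring)
  show ?thesis unfolding tensor_kernel_def
    by (rule F.generated_submodule_submodule) (rule tensor_relations_closed[OF assms])
qed

lemma tensor_module:
  assumes "module R M" "module R N"
  shows "module R (tensor R M N)"
proof -
  interpret M: module R M by fact
  interpret F: module R "free_module R (carrier M \<times> carrier N)"
    by (rule free_module_module) (rule M.is_cring)
  show ?thesis unfolding tensor_def
    by (rule F.quotient_module_module) (rule tensor_kernel_submodule[OF assms])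
qed

lemma pure_tensor_bilinear:
  assumes "module R M" "module R N"
  shows "pure_tensor R M N \<in> bilinear_maps R M N (tensor R M N)"
proof -
  interpret M: module R M by fact
  interpret N: module R N by fact
  let ?F = "free_module R (carrier M \<times> carrier N)" and ?K = "tensor_kernel R M N"
    and ?e = "free_basis R"
  interpret F: module R ?F by (rule free_module_module) (rule M.is_cring)
  note b [simp, intro] = free_basis_closed[OF M.is_cring, of _ "carrier M \<times> carrier N"]
  note K = tensor_kernel_submodule[OF assms]
  interpret K: abelian_subgroup ?K ?F by (rule F.submodule_abelian_subgroup[OF K])
  \<comment> \<open>Each bilinearity law is one of the four kinds of relation, hence an equality of
    cosets.\<close>
  have rel: "?K +>\<^bsub>?F\<^esub> c = ?K +>\<^bsub>?F\<^esub> d"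
    if "c \<ominus>\<^bsub>?F\<^esub> d \<in> tensor_relations R M N" "c \<in> carrier ?F" "d \<in> carrier ?F" for c d
  proof -
    have "c \<oplus>\<^bsub>?F\<^esub> \<ominus>\<^bsub>?F\<^esub> d \<in> ?K"
      using that(1) unfolding tensor_kernel_def generated_submodule_def a_minus_def by blast
    then have "?K +>\<^bsub>?F\<^esub> (c \<oplus>\<^bsub>?F\<^esub> \<ominus>\<^bsub>?F\<^esub> d) = ?K"
      using that(2,3) by (intro F.a_coset_join2 K.a_subgroup) (simp_all del: free_module_simps)
    then show ?thesis
      using that(2,3) by (intro F.a_coset_add_inv1 K.a_subset) (simp_all del: free_module_simps)
  qed
  have carr: "pure_tensor R M N u v \<in> carrier (tensor R M N)"
    if "u \<in> carrier M" "v \<in> carrier N" for u v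
    using that by (simp add: pure_tensor_def tensor_def F.quotient_carrier del: free_module_simps)
  note [simp del] = free_module_simps
  note add = F.quotient_add[OF K, symmetric, folded tensor_def]
  note smult = F.quotient_smult[OF K, symmetric, folded tensor_def]
  show ?thesis
  proof (intro bilinear_mapsI linear_mapsI carr; (assumption)?)
    fix u u' v assume "u \<in> carrier M" "u' \<in> carrier M" "v \<in> carrier N"
    then show "pure_tensor R M N (u \<oplus>\<^bsub>M\<^esub> u') v =
        pure_tensor R M N u v \<oplus>\<^bsub>tensor R M N\<^esub> pure_tensor R M N u' v"
      unfolding pure_tensor_def
      by (subst add[symmetric], simp, simp, intro rel) (auto simp: tensor_relations_def Let_def)
  next
    fix u v v' assume "u \<in> carrier M" "v' \<in> carrier N" "v \<in> carrier N"
    then show "pure_tensor R M N u (v \<oplus>\<^bsub>N\<^esub> v') =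
        pure_tensor R M N u v \<oplus>\<^bsub>tensor R M N\<^esub> pure_tensor R M N u v'"
      unfolding pure_tensor_def
      by (subst add[symmetric], simp, simp, intro rel) (auto simp: tensor_relations_def Let_def)
  next
    fix r u v assume "r \<in> carrier R" "u \<in> carrier M" "v \<in> carrier N"
    then show "pure_tensor R M N (r \<odot>\<^bsub>M\<^esub> u) v = r \<odot>\<^bsub>tensor R M N\<^esub> pure_tensor R M N u v"
      unfolding pure_tensor_def
      by (subst smult[symmetric], simp, simp, intro rel) (auto simp: tensor_relations_def Let_def)
  next
    fix r u v assume "r \<in> carrier R" "u \<in> carrier M" "v \<in> carrier N"
    then show "pure_tensor R M N u (r \<odot>\<^bsub>N\<^esub> v) = r \<odot>\<^bsub>tensor R M N\<^esub> pure_tensor R M N u v"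
      unfolding pure_tensor_def
      by (subst smult[symmetric], simp, simp, intro rel) (auto simp: tensor_relations_def Let_def)
  qed
qed

text \<open>Composed with the projection from the free module, a linear map is determined by its
  values on the basis vectors, whose classes are the pure tensors. This is the uniqueness half of
  the universal property.\<close>

lemma tensor_ext:
  assumes "module R M" "module R N" "module R P"
    and f: "f \<in> linear_maps R (tensor R M N) P" and g: "g \<in> linear_maps R (tensor R M N) P"
    and pure: "\<And>u v. \<lbrakk>u \<in> carrier M; v \<in> carrier N\<rbrakk> \<Longrightarrow>
      f (pure_tensor R M N u v) = g (pure_tensor R M N u v)"
    and t: "t \<in> carrier (tensor R M N)"
  shows "f t = g t"
proof -
  interpret M: module R M by fact
  let ?F = "free_module R (carrier M \<times> carrier N)" and ?K = "tensor_kernel R M N"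
  interpret F: module R ?F by (rule free_module_module) (rule M.is_cring)
  obtain c where c: "c \<in> carrier ?F" "t = ?K +>\<^bsub>?F\<^esub> c"
    using t by (auto simp: tensor_def F.quotient_carrier simp del: free_module_simps)
  note pr = F.quotient_projection_linear[OF tensor_kernel_submodule[OF assms(1,2)], folded tensor_def]
  have "f (?K +>\<^bsub>?F\<^esub> c) = g (?K +>\<^bsub>?F\<^esub> c)"
    by (rule free_module_ext[OF M.is_cring assms(3) linear_maps_compose[OF f pr] linear_maps_compose[OF g pr] _ c(1)])
      (auto simp: pure[unfolded pure_tensor_def])
  with c show ?thesis by simp
qed

text \<open>The linear extension of f vanishes on the defining relations because f is bilinear,
  hence on the whole kernel. So it is constant on a coset, and \<open>the_elem\<close> in
  \<open>tensor_lift\<close> is applied to a singleton.\<close>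

lemma tensor_lift_coset:
  assumes "module R M" "module R N" "module R P" and f: "f \<in> bilinear_maps R M N P"
    and c: "c \<in> carrier (free_module R (carrier M \<times> carrier N))"
  shows "tensor_lift R P f (tensor_kernel R M N +>\<^bsub>free_module R (carrier M \<times> carrier N)\<^esub> c) =
    free_lift R P (\<lambda>z. f (fst z) (snd z)) c"
proof -
  interpret M: module R M by fact
  interpret N: module R N by fact
  interpret P: module R P by fact
  let ?F = "free_module R (carrier M \<times> carrier N)" and ?K = "tensor_kernel R M N"
  let ?L = "free_lift R P (\<lambda>z. f (fst z) (snd z))"
  interpret F: module R ?F by (rule free_module_module) (rule M.is_cring)
  note K = tensor_kernel_submodule[OF assms(1,2)]
  interpret K: abelian_subgroup ?K ?F by (rule F.submodule_abelian_subgroup[OF K])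
  have L: "?L \<in> linear_maps R ?F P"
    using bilinear_maps_closed[OF f] by (intro free_lift_linear assms) auto
  note b [simp] = free_basis_closed[OF M.is_cring, of _ "carrier M \<times> carrier N"]
  note fc [simp] = bilinear_maps_closed[OF f]
  note [simp] = linear_maps_add[OF L] linear_maps_smult[OF L]
      linear_maps_diff[OF F.module_axioms assms(3) L] free_lift_basis[OF assms(3)]
      linear_maps_add[OF bilinear_maps_right[OF f]] linear_maps_smult[OF bilinear_maps_right[OF f]]
      linear_maps_add[OF bilinear_maps_left[OF f]] linear_maps_smult[OF bilinear_maps_left[OF f]]
  note [simp del] = free_module_simps
  have "tensor_relations R M N \<subseteq> {c \<in> carrier ?F. ?L c = \<zero>\<^bsub>P\<^esub>}"
    using tensor_relations_closed[OF assms(1,2)]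
    unfolding tensor_relations_def Let_def
    by (auto simp: P.minus_eq P.r_neg)
  then have "?K \<subseteq> {c \<in> carrier ?F. ?L c = \<zero>\<^bsub>P\<^esub>}"
    using F.kernel_submodule[OF assms(3) L] unfolding tensor_kernel_def generated_submodule_def by blast
  then have "?L d = ?L c" if "d \<in> ?K +>\<^bsub>?F\<^esub> c" for d
    using that c linear_maps_closed[OF L c] by (auto simp: a_r_coset_def')
  moreover have "c \<in> ?K +>\<^bsub>?F\<^esub> c" by (rule K.a_rcos_self) fact
  ultimately have "?L ` (?K +>\<^bsub>?F\<^esub> c) = {?L c}" by blast
  moreover have "tensor_lift R P f t = the_elem (?L ` t)" for t
    by (simp add: tensor_lift_def free_lift_def image_def)
  ultimately show ?thesis by simp
qed

lemma tensor_lift_linear: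
  assumes "module R M" "module R N" "module R P" and f: "f \<in> bilinear_maps R M N P"
  shows "tensor_lift R P f \<in> linear_maps R (tensor R M N) P"
proof -
  interpret M: module R M by fact
  let ?F = "free_module R (carrier M \<times> carrier N)" and ?K = "tensor_kernel R M N"
  interpret F: module R ?F by (rule free_module_module) (rule M.is_cring)
  note K = tensor_kernel_submodule[OF assms(1,2)]
  have L: "free_lift R P (\<lambda>z. f (fst z) (snd z)) \<in> linear_maps R ?F P"
    using bilinear_maps_closed[OF f] by (intro free_lift_linear assms) auto
  show ?thesis
    by (rule linear_mapsI; unfold tensor_def)
      (auto simp: F.quotient_carrier F.quotient_add[OF K] F.quotient_smult[OF K]
        tensor_lift_coset[OF assms] linear_maps_closed[OF L] linear_maps_add[OF L]
        linear_maps_smult[OF L] simp del: free_module_simps)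
qed

lemma tensor_lift_pure:
  assumes "module R M" "module R N" "module R P" "f \<in> bilinear_maps R M N P"
    "u \<in> carrier M" "v \<in> carrier N"
  shows "tensor_lift R P f (pure_tensor R M N u v) = f u v"
proof -
  interpret M: module R M by fact
  show ?thesis
    using assms free_basis_closed[OF M.is_cring, of "(u, v)" "carrier M \<times> carrier N"]
    by (simp add: pure_tensor_def tensor_lift_coset free_lift_basis bilinear_maps_closed
        del: free_module_simps)
qed

subsection \<open>Calculus of induced maps\<close>

text \<open>The recursion behind \<open>finsum\<close> consults the summand only at elements of the
  index set. Agreement there suffices even for values outside the carrier, which permits rewriting
  under a sum before any closure is known.\<close>

lemma finsum_cong_any:
  assumes "\<And>i. i \<in> I \<Longrightarrow> f i = g i"
  shows "finsum P f I = finsum P g I"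
proof -
  have "(I, z) \<in> foldSetD D (h \<circ> g') e"
    if "(I, z) \<in> foldSetD D (h \<circ> f') e" "\<And>i. i \<in> I \<Longrightarrow> f' i = g' i"
    for D e z and h :: "'b \<Rightarrow> 'b \<Rightarrow> 'b" and f' g' :: "'a \<Rightarrow> 'b"
    using that
  proof (induction rule: foldSetD.induct)
    case (insertI i A y)
    then have "(insert i A, (h \<circ> g') i y) \<in> foldSetD D (h \<circ> g') e"
      by (intro foldSetD.insertI) auto
    with insertI show ?case by (simp add: comp_def)
  qed (rule foldSetD.emptyI)
  from this[of _ _ _ f _ g] this[of _ _ _ g _ f]
  have "(I, z) \<in> foldSetD D (h \<circ> f) e \<longleftrightarrow> (I, z) \<in> foldSetD D (h \<circ> g) e" for z D e and h :: "'b \<Rightarrow> 'b \<Rightarrow> 'b"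
    using assms by metis
  then show ?thesis unfolding finsum_def finprod_def foldD_def by simp
qed

text \<open>Every representative of t is supported in \<open>carrier M \<times> carrier N\<close>,
  so the images of t under the two sums agree already before \<open>the_elem\<close>. Rewriting
  inside a Sweedler expression thus creates no linearity conditions.\<close>

lemma tensor_lift_cong:
  assumes "module R M" "module R N" "t \<in> carrier (tensor R M N)"
    and "\<And>u v. \<lbrakk>u \<in> carrier M; v \<in> carrier N\<rbrakk> \<Longrightarrow> f u v = g u v"
  shows "tensor_lift R P f t = tensor_lift R P g t"
proof -
  interpret M: module R M by fact
  let ?F = "free_module R (carrier M \<times> carrier N)" and ?K = "tensor_kernel R M N"
  interpret F: module R ?F by (rule free_module_module) (rule M.is_cring)
  interpret K: abelian_subgroup ?K ?F
    by (rule F.submodule_abelian_subgroup[OF tensor_kernel_submodule[OF assms(1,2)]])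
  have "c \<in> carrier ?F" if "c \<in> t" for c
    using assms(3) F.a_r_coset_subset_G[OF K.a_subset] that
    by (auto simp: tensor_def F.quotient_carrier simp del: free_module_simps)
  then have "c z \<odot>\<^bsub>P\<^esub> f (fst z) (snd z) = c z \<odot>\<^bsub>P\<^esub> g (fst z) (snd z)" if "c \<in> t" "c z \<noteq> \<zero>\<^bsub>R\<^esub>" for c z
  proof -
    have "z \<in> carrier M \<times> carrier N"
      using \<open>\<And>c. c \<in> t \<Longrightarrow> c \<in> carrier ?F\<close>[OF that(1)] that(2) by (auto simp del: split_paired_All)
    then show ?thesis by (auto simp: assms(4))
  qed
  then have "(\<Oplus>\<^bsub>P\<^esub>z\<in>{z. c z \<noteq> \<zero>\<^bsub>R\<^esub>}. c z \<odot>\<^bsub>P\<^esub> f (fst z) (snd z)) =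
      (\<Oplus>\<^bsub>P\<^esub>z\<in>{z. c z \<noteq> \<zero>\<^bsub>R\<^esub>}. c z \<odot>\<^bsub>P\<^esub> g (fst z) (snd z))" if "c \<in> t" for c
    using that by (intro finsum_cong_any) blast
  then show ?thesis
    unfolding tensor_lift_def by (metis (no_types, lifting) image_cong)
qed

lemma bilinear_tensor_lift_commute:
  assumes "module R M" "module R N" "module R P" "module R Q"
    "f \<in> bilinear_maps R M N P" "g \<in> linear_maps R P Q" "t \<in> carrier (tensor R M N)"
  shows "g (tensor_lift R P f t) = tensor_lift R Q (\<lambda>u v. g (f u v)) t"
  by (rule tensor_ext[OF assms(1,2,4)
        linear_maps_compose[OF assms(6) tensor_lift_linear[OF assms(1-3,5)]]
        tensor_lift_linear[OF assms(1,2,4) bilinear_maps_compose[OF assms(6,5)]] _ assms(7)])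
    (simp add: tensor_lift_pure[OF assms(1-3,5)]
      tensor_lift_pure[OF assms(1,2,4) bilinear_maps_compose[OF assms(6,5)]])

lemma tensor_lift_ident:
  assumes "module R M" "module R N" "t \<in> carrier (tensor R M N)"
  shows "tensor_lift R (tensor R M N) (pure_tensor R M N) t = t"
  using tensor_lift_pure[OF assms(1,2) tensor_module pure_tensor_bilinear] assms
  by (intro tensor_ext[OF assms(1,2) tensor_module tensor_lift_linear linear_maps_ident _ assms(3)]
      pure_tensor_bilinear tensor_module) simp_all

text \<open>Here t is fixed and the bilinear map varies. Additivity and homogeneity in x are
  equations between linear functions of t, and on pure tensors they are the assumption
  \<open>lin\<close>. This handles a variable that occurs in the body of a Sweedler sum.\<close>

lemma tensor_lift_linear_param:
  assumes "module R M" "module R N" "module R P"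
    and lin: "\<And>u v. \<lbrakk>u \<in> carrier M; v \<in> carrier N\<rbrakk> \<Longrightarrow> (\<lambda>x. F x u v) \<in> linear_maps R Q P"
    and bil: "\<And>x. x \<in> carrier Q \<Longrightarrow> F x \<in> bilinear_maps R M N P"
    and t: "t \<in> carrier (tensor R M N)" and "module R Q"
  shows "(\<lambda>x. tensor_lift R P (F x) t) \<in> linear_maps R Q P"
proof -
  interpret Q: module R Q by fact
  interpret P: module R P by fact
  note lift = tensor_lift_linear[OF assms(1-3) bil]
  show ?thesis
  proof (rule linear_mapsI)
    fix x y assume xy: "x \<in> carrier Q" "y \<in> carrier Q"
    show "tensor_lift R P (F (x \<oplus>\<^bsub>Q\<^esub> y)) t = tensor_lift R P (F x) t \<oplus>\<^bsub>P\<^esub> tensor_lift R P (F y) t"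
      using xy by (intro tensor_ext[OF assms(1-3) _ _ _ t, where g = "\<lambda>t. tensor_lift R P (F x) t \<oplus>\<^bsub>P\<^esub> tensor_lift R P (F y) t"]
          lift linear_maps_plus tensor_module assms(1-3))
        (simp_all add: tensor_lift_pure[OF assms(1-3) bil] linear_maps_add[OF lin])
  next
    fix r x assume rx: "r \<in> carrier R" "x \<in> carrier Q"
    show "tensor_lift R P (F (r \<odot>\<^bsub>Q\<^esub> x)) t = r \<odot>\<^bsub>P\<^esub> tensor_lift R P (F x) t"
      using rx by (intro tensor_ext[OF assms(1-3) _ _ _ t, where g = "\<lambda>t. r \<odot>\<^bsub>P\<^esub> tensor_lift R P (F x) t"]
          lift linear_maps_smult_right tensor_module assms(1-3))
        (simp_all add: tensor_lift_pure[OF assms(1-3) bil] linear_maps_smult[OF lin])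
  qed (rule linear_maps_closed[OF lift t])
qed

text \<open>A Fubini rule. For fixed t both sides are linear in t', and for a pure tensor t' both
  reduce to the same single sum over t.\<close>

lemma tensor_lift_swap:
  assumes "module R M" "module R N" "module R M'" "module R N'" "module R P"
    and bil: "\<And>u v. \<lbrakk>u \<in> carrier M; v \<in> carrier N\<rbrakk> \<Longrightarrow> F u v \<in> bilinear_maps R M' N' P"
    and bil': "\<And>u' v'. \<lbrakk>u' \<in> carrier M'; v' \<in> carrier N'\<rbrakk> \<Longrightarrow>
      (\<lambda>u v. F u v u' v') \<in> bilinear_maps R M N P"
    and t: "t \<in> carrier (tensor R M N)" and t': "t' \<in> carrier (tensor R M' N')"
  shows "tensor_lift R P (\<lambda>u v. tensor_lift R P (F u v) t') t =
    tensor_lift R P (\<lambda>u' v'. tensor_lift R P (\<lambda>u v. F u v u' v') t) t'"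
proof -
  note T = tensor_module[OF assms(1,2)] and T' = tensor_module[OF assms(3,4)]
  have biL: "(\<lambda>u v. tensor_lift R P (F u v) s) \<in> bilinear_maps R M N P"
    if "s \<in> carrier (tensor R M' N')" for s
    by (rule bilinear_mapsI; rule tensor_lift_linear_param[OF assms(3-5) _ _ that])
      (simp_all add: bilinear_maps_left[OF bil'] bilinear_maps_right[OF bil'] bil assms(1,2))
  have biR: "(\<lambda>u' v'. tensor_lift R P (\<lambda>u v. F u v u' v') t) \<in> bilinear_maps R M' N' P"
    by (rule bilinear_mapsI; rule tensor_lift_linear_param[OF assms(1,2,5) _ _ t])
      (simp_all add: bilinear_maps_left[OF bil] bilinear_maps_right[OF bil] bil' assms(3,4))
  show ?thesis
  proof (rule tensor_ext[OF assms(3-5), where f = "\<lambda>s. tensor_lift R P (\<lambda>u v. tensor_lift R P (F u v) s) t"])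
    show "(\<lambda>s. tensor_lift R P (\<lambda>u v. tensor_lift R P (F u v) s) t) \<in> linear_maps R (tensor R M' N') P"
      by (intro tensor_lift_linear_param[OF assms(1,2,5)] tensor_lift_linear assms bil biL t T')
    show "tensor_lift R P (\<lambda>u' v'. tensor_lift R P (\<lambda>u v. F u v u' v') t) \<in> linear_maps R (tensor R M' N') P"
      by (intro tensor_lift_linear assms biR)
    fix u' v' assume uv: "u' \<in> carrier M'" "v' \<in> carrier N'"
    have "tensor_lift R P (\<lambda>u v. tensor_lift R P (F u v) (pure_tensor R M' N' u' v')) t =
        tensor_lift R P (\<lambda>u v. F u v u' v') t"
      using uv by (intro tensor_lift_cong[OF assms(1,2) t]) (simp add: tensor_lift_pure[OF assms(3-5) bil])
    then show "tensor_lift R P (\<lambda>u v. tensor_lift R P (F u v) (pure_tensor R M' N' u' v')) t =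
        tensor_lift R P (\<lambda>u' v'. tensor_lift R P (\<lambda>u v. F u v u' v') t) (pure_tensor R M' N' u' v')"
      using uv by (simp add: tensor_lift_pure[OF assms(3-5) biR])
  qed (rule t')
qed


subsection \<open>Coalgebras\<close>

context coalgebra
begin

lemma comult_closed: "h \<in> carrier C \<Longrightarrow> comult C h \<in> carrier (tensor R C C)"
  using comult_linear by (rule linear_maps_closed)

lemma sweedler_cong:
  assumes "h \<in> carrier C" "\<And>a b. \<lbrakk>a \<in> carrier C; b \<in> carrier C\<rbrakk> \<Longrightarrow> f a b = g a b"
  shows "sweedler R C P f h = sweedler R C P g h"
  unfolding sweedler_def
  by (intro tensor_lift_cong[OF module_axioms module_axioms] comult_closed assms)

lemma sweedler_linear:
  assumes "module R P" "f \<in> bilinear_maps R C C P"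
  shows "sweedler R C P f \<in> linear_maps R C P"
  unfolding sweedler_def[abs_def]
  by (intro linear_maps_compose[OF _ comult_linear] tensor_lift_linear module_axioms assms)

lemma sweedler_linear_param:
  assumes "module R Q" "module R P" "h \<in> carrier C"
    "\<And>a b. \<lbrakk>a \<in> carrier C; b \<in> carrier C\<rbrakk> \<Longrightarrow> (\<lambda>x. F x a b) \<in> linear_maps R Q P"
    "\<And>x. x \<in> carrier Q \<Longrightarrow> F x \<in> bilinear_maps R C C P"
  shows "(\<lambda>x. sweedler R C P (F x) h) \<in> linear_maps R Q P"
  unfolding sweedler_def
  by (intro tensor_lift_linear_param[where M = C and N = C] comult_closed module_axioms assms)

lemma sweedler_commute:
  assumes "module R P" "module R Q" "h \<in> carrier C" "f \<in> bilinear_maps R C C P"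
    "g \<in> linear_maps R P Q"
  shows "g (sweedler R C P f h) = sweedler R C Q (\<lambda>a b. g (f a b)) h"
  unfolding sweedler_def
  by (intro bilinear_tensor_lift_commute[where M = C and N = C and P = P] comult_closed module_axioms assms)

text \<open>The axiom is an equation in C \<otimes> (C \<otimes> C). A trilinear F induces a linear
  map \<open>?g\<close> on that module, and applying \<open>?g\<close> to the axiom gives the
  equation for F, with values in any module P.\<close>

lemma sweedler_coassoc:
  assumes P: "module R P" and h: "h \<in> carrier C"
    and 1: "\<And>a b. \<lbrakk>a \<in> carrier C; b \<in> carrier C\<rbrakk> \<Longrightarrow> (\<lambda>c. F a b c) \<in> linear_maps R C P"
    and 2: "\<And>a c. \<lbrakk>a \<in> carrier C; c \<in> carrier C\<rbrakk> \<Longrightarrow> (\<lambda>b. F a b c) \<in> linear_maps R C P"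
    and 3: "\<And>b c. \<lbrakk>b \<in> carrier C; c \<in> carrier C\<rbrakk> \<Longrightarrow> (\<lambda>a. F a b c) \<in> linear_maps R C P"
  shows "sweedler R C P (\<lambda>d c. sweedler R C P (\<lambda>a b. F a b c) d) h =
    sweedler R C P (\<lambda>a d. sweedler R C P (\<lambda>b c. F a b c) d) h"
proof -
  let ?T = "tensor R C C" and ?TT = "tensor R C (tensor R C C)"
  note C = module_axioms
  note T = tensor_module[OF C C] note TT = tensor_module[OF C T]
  note p = pure_tensor_bilinear[OF C C] note q = pure_tensor_bilinear[OF C T]
  have bil: "F a \<in> bilinear_maps R C C P" if "a \<in> carrier C" for a
    using that 1 2 by (intro bilinear_mapsI) auto
  let ?G = "\<lambda>a t. tensor_lift R P (F a) t"
  have G: "?G \<in> bilinear_maps R C ?T P"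
    by (rule bilinear_mapsI[OF tensor_lift_linear[OF C C P bil] tensor_lift_linear_param[OF C C P 3 bil _ C]])
  let ?g = "tensor_lift R P ?G"
  have g: "?g \<in> linear_maps R ?TT P"
    by (intro tensor_lift_linear C T P G)
  have gp: "?g (pure_tensor R C ?T a (pure_tensor R C C b c)) = F a b c"
    if "a \<in> carrier C" "b \<in> carrier C" "c \<in> carrier C" for a b c
    using that bilinear_maps_closed[OF p]
    by (simp add: tensor_lift_pure[OF C T P G] tensor_lift_pure[OF C C P bil])
  let ?H = "\<lambda>a1 a2 b. pure_tensor R C ?T a1 (pure_tensor R C C a2 b)"
  have H1: "(\<lambda>a b. ?H a b c) \<in> bilinear_maps R C C ?TT" if "c \<in> carrier C" for c
    using that bilinear_maps_left[OF q] bilinear_maps_compose_right[OF q bilinear_maps_left[OF p]]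
      bilinear_maps_closed[OF p]
    by (intro bilinear_mapsI) auto
  have H2: "(\<lambda>c. ?H a b c) \<in> linear_maps R C ?TT" if "a \<in> carrier C" "b \<in> carrier C" for a b
    using that by (intro bilinear_maps_compose_right[OF q] bilinear_maps_right[OF p])
  have H3: "(\<lambda>d c. sweedler R C ?TT (\<lambda>a b. ?H a b c) d) \<in> bilinear_maps R C C ?TT"
    by (intro bilinear_mapsI sweedler_linear sweedler_linear_param TT C H1 H2)
  have H4: "(\<lambda>a b. pure_tensor R C ?T a (comult C b)) \<in> bilinear_maps R C C ?TT"
    by (intro bilinear_mapsI bilinear_maps_compose_right[OF q] comult_linear bilinear_maps_left[OF q] comult_closed)
  have "sweedler R C P (\<lambda>d c. sweedler R C P (\<lambda>a b. F a b c) d) h =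
      sweedler R C P (\<lambda>d c. ?g (sweedler R C ?TT (\<lambda>a b. ?H a b c) d)) h"
    using h by (intro sweedler_cong) (simp_all add: sweedler_commute[OF TT P _ H1 g] gp cong: sweedler_cong)
  also have "\<dots> = ?g (sweedler R C ?TT (\<lambda>d c. sweedler R C ?TT (\<lambda>a b. ?H a b c) d) h)"
    by (rule sweedler_commute[OF TT P h H3 g, symmetric])
  also have "\<dots> = ?g (sweedler R C ?TT (\<lambda>a b. pure_tensor R C ?T a (comult C b)) h)"
    using coassoc[OF h] by simp
  also have "\<dots> = sweedler R C P (\<lambda>a b. ?g (pure_tensor R C ?T a (comult C b))) h"
    by (rule sweedler_commute[OF TT P h H4 g])
  also have "\<dots> = sweedler R C P (\<lambda>a d. sweedler R C P (\<lambda>b c. F a b c) d) h"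
    using h by (intro sweedler_cong) (simp_all add: tensor_lift_pure[OF C T P G] comult_closed sweedler_def)
  finally show ?thesis .
qed

text \<open>The linear map g is applied to the counit axiom. Read from right to left, the rule
  inserts a counit factor, which the antipode axioms can then expand into a product.\<close>

lemma sweedler_counit_left:
  assumes P: "module R P" and h: "h \<in> carrier C" and g: "g \<in> linear_maps R C P"
  shows "sweedler R C P (\<lambda>a b. counit C a \<odot>\<^bsub>P\<^esub> g b) h = g h"
proof -
  have eps: "(\<lambda>a b. counit C a \<odot>\<^bsub>C\<^esub> b) \<in> bilinear_maps R C C C"
    by (intro bilinear_mapsI bilinear_maps_compose_left[OF smult_bilinear[OF module_axioms] counit_linear]
        bilinear_maps_right[OF smult_bilinear[OF module_axioms]] linear_maps_closed[OF counit_linear])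
  have "g (sweedler R C C (\<lambda>a b. counit C a \<odot>\<^bsub>C\<^esub> b) h) = sweedler R C P (\<lambda>a b. g (counit C a \<odot>\<^bsub>C\<^esub> b)) h"
    by (rule sweedler_commute[OF module_axioms P h eps g])
  also have "\<dots> = sweedler R C P (\<lambda>a b. counit C a \<odot>\<^bsub>P\<^esub> g b) h"
    using h linear_maps_closed[OF counit_linear]
    by (intro sweedler_cong) (simp_all add: linear_maps_smult[OF g])
  finally show ?thesis using counit_left[OF h] by simp
qed

lemma sweedler_counit_right:
  assumes P: "module R P" and h: "h \<in> carrier C" and g: "g \<in> linear_maps R C P"
  shows "sweedler R C P (\<lambda>a b. counit C b \<odot>\<^bsub>P\<^esub> g a) h = g h"
proof -
  have eps: "(\<lambda>a b. counit C b \<odot>\<^bsub>C\<^esub> a) \<in> bilinear_maps R C C C"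
    by (intro bilinear_mapsI bilinear_maps_compose_left[OF smult_bilinear[OF module_axioms] counit_linear]
        bilinear_maps_right[OF smult_bilinear[OF module_axioms]] linear_maps_closed[OF counit_linear])
      (use linear_maps_closed[OF counit_linear] in auto)
  have "g (sweedler R C C (\<lambda>a b. counit C b \<odot>\<^bsub>C\<^esub> a) h) = sweedler R C P (\<lambda>a b. g (counit C b \<odot>\<^bsub>C\<^esub> a)) h"
    by (rule sweedler_commute[OF module_axioms P h eps g])
  also have "\<dots> = sweedler R C P (\<lambda>a b. counit C b \<odot>\<^bsub>P\<^esub> g a) h"
    using h linear_maps_closed[OF counit_linear]
    by (intro sweedler_cong) (simp_all add: linear_maps_smult[OF g])
  finally show ?thesis using counit_right[OF h] by simp
qed

end


subsection \<open>Duals of finitely generated projective modules\<close>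

lemma dual_simps [simp]:
  "add (dual R C) = (\<lambda>f g. \<lambda>h\<in>carrier C. f h \<oplus>\<^bsub>R\<^esub> g h)"
  "smult (dual R C) = (\<lambda>r f. \<lambda>h\<in>carrier C. r \<otimes>\<^bsub>R\<^esub> f h)"
  "zero (dual R C) = (\<lambda>h\<in>carrier C. \<zero>\<^bsub>R\<^esub>)"
  "mult (dual R C) = (\<lambda>f g. \<lambda>h\<in>carrier C. sweedler R C (self_module R) (\<lambda>a b. f b \<otimes>\<^bsub>R\<^esub> g a) h)"
  unfolding dual_def by simp_all

lemma dual_linear: "f \<in> carrier (dual R C) \<Longrightarrow> f \<in> linear_maps R C (self_module R)"
  and dual_extensional: "f \<in> carrier (dual R C) \<Longrightarrow> f \<in> extensional (carrier C)"
  unfolding dual_def by auto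

lemma dual_closed: "\<lbrakk>f \<in> carrier (dual R C); h \<in> carrier C\<rbrakk> \<Longrightarrow> f h \<in> carrier R"
  using linear_maps_closed[OF dual_linear] by fastforce

lemma dual_eqI:
  "\<lbrakk>f \<in> carrier (dual R C); g \<in> carrier (dual R C); \<And>h. h \<in> carrier C \<Longrightarrow> f h = g h\<rbrakk> \<Longrightarrow> f = g"
  by (metis extensionalityI dual_extensional)

lemma dual_restrictI:
  assumes "module R C" "f \<in> linear_maps R C (self_module R)"
  shows "restrict f (carrier C) \<in> carrier (dual R C)"
  using linear_maps_cong[OF assms(1), of f "restrict f (carrier C)" "self_module R"] assms(2)
  by (simp add: dual_def)

lemma dual_module:
  assumes "module R C"
  shows "module R (dual R C)"
proof -
  interpret C: module R C by fact
  note K = self_module_module[OF C.is_cring]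
  note [simp] = dual_closed[of _ R C]
  have zero: "(\<lambda>h. \<zero>\<^bsub>R\<^esub>) \<in> linear_maps R C (self_module R)"
    by (rule linear_mapsI) simp_all
  have add: "f \<oplus>\<^bsub>dual R C\<^esub> g \<in> carrier (dual R C)"
    if "f \<in> carrier (dual R C)" "g \<in> carrier (dual R C)" for f g
    using dual_restrictI[OF assms linear_maps_plus[OF assms K dual_linear dual_linear], of f g] that by simp
  have smult: "r \<odot>\<^bsub>dual R C\<^esub> f \<in> carrier (dual R C)"
    if "f \<in> carrier (dual R C)" "r \<in> carrier R" for f r
    using dual_restrictI[OF assms linear_maps_smult_right[OF K dual_linear[OF that(1)] that(2)]] that by simp
  show ?thesis
  proof (intro moduleI abelian_groupI C.is_cring add smult; (assumption)?)
    show "\<zero>\<^bsub>dual R C\<^esub> \<in> carrier (dual R C)"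
      using dual_restrictI[OF assms zero] by simp
    then show "\<zero>\<^bsub>dual R C\<^esub> \<oplus>\<^bsub>dual R C\<^esub> f = f" if "f \<in> carrier (dual R C)" for f
      using that by (intro dual_eqI[of _ R C]) (auto intro!: add simp del: dual_simps, simp)
    \<comment> \<open>The additive inverse of f is -1 times f, whose membership in the dual is
      already known.\<close>
    show "\<exists>g\<in>carrier (dual R C). g \<oplus>\<^bsub>dual R C\<^esub> f = \<zero>\<^bsub>dual R C\<^esub>" if "f \<in> carrier (dual R C)" for f
      using that smult[OF that, of "\<ominus>\<^bsub>R\<^esub> \<one>\<^bsub>R\<^esub>"]
      by (intro bexI[of _ "\<ominus>\<^bsub>R\<^esub> \<one>\<^bsub>R\<^esub> \<odot>\<^bsub>dual R C\<^esub> f"])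
        (auto simp: C.R.l_minus C.R.l_neg dual_closed[OF that] intro!: restrict_ext)
    show "\<one>\<^bsub>R\<^esub> \<odot>\<^bsub>dual R C\<^esub> f = f" if "f \<in> carrier (dual R C)" for f
      using that smult[OF that, of "\<one>\<^bsub>R\<^esub>"] by (intro dual_eqI[of _ R C]) (simp_all)
  qed (auto simp: C.R.a_ac C.R.l_distr C.R.r_distr C.R.m_assoc intro!: restrict_ext)
qed

lemma dual_eval_linear:
  assumes "module R C" "h \<in> carrier C"
  shows "(\<lambda>f. f h) \<in> linear_maps R (dual R C) (self_module R)"
  using assms dual_closed by (intro linear_mapsI) auto

lemma dual_eval_bilinear:
  assumes "module R M" "module R Q" "h \<in> carrier M"
  shows "(\<lambda>f q. f h \<odot>\<^bsub>Q\<^esub> q) \<in> bilinear_maps R (dual R M) Q Q"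
proof (rule bilinear_mapsI)
  fix f assume "f \<in> carrier (dual R M)"
  then show "smult Q (f h) \<in> linear_maps R Q Q"
    using bilinear_maps_right[OF smult_bilinear[OF assms(2)], of "f h"] dual_closed[of f R M h] assms(3) by simp
qed (rule bilinear_maps_compose_left[OF smult_bilinear[OF assms(2)] dual_eval_linear[OF assms(1,3)]])

lemma linear_maps_into_dual:
  assumes "module R M" "\<And>u. u \<in> carrier M \<Longrightarrow> f u \<in> carrier (dual R C)"
    and "\<And>h. h \<in> carrier C \<Longrightarrow> (\<lambda>u. f u h) \<in> linear_maps R M (self_module R)"
    and "module R C"
  shows "f \<in> linear_maps R M (dual R C)"
proof -
  interpret M: module R M by fact
  interpret D: module R "dual R C" by (rule dual_module) fact
  note lin = linear_maps_add[OF assms(3)] linear_maps_smult[OF assms(3)]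
  show ?thesis
    using assms(2) by (intro linear_mapsI dual_eqI[of _ R C] D.add.m_closed D.smult_closed) (simp_all add: lin)
qed

text \<open>Projectivity makes M a retract of a free module on a possibly infinite index set. Finite
  generation cuts it down: the images under s of the generators have a finite joint support J, so by
  linearity every \<open>s u\<close> vanishes off J. The dual basis consists of the coordinates of s
  in J and the images under p of the basis vectors there.\<close>

lemma dual_basis_obtain:
  fixes M :: "('k, 'a, 'm) module_scheme"
  assumes M: "module R M" and fg: "finitely_generated R M" and pr: "projective R M"
  obtains J :: "'a set" and e \<theta> where "finite J" "e \<in> J \<rightarrow> carrier M"
    "\<theta> \<in> J \<rightarrow> linear_maps R M (self_module R)"
    "\<forall>u\<in>carrier M. (\<Oplus>\<^bsub>M\<^esub>j\<in>J. \<theta> j u \<odot>\<^bsub>M\<^esub> e j) = u"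
proof -
  interpret M: module R M by fact
  obtain I :: "'a set" and s p where s: "s \<in> linear_maps R M (free_module R I)"
    and p: "p \<in> linear_maps R (free_module R I) M" and ps: "\<And>u. u \<in> carrier M \<Longrightarrow> p (s u) = u"
    using pr unfolding projective_def by blast
  interpret F: module R "free_module R I" by (rule free_module_module) (rule M.is_cring)
  obtain B where B: "finite B" "B \<subseteq> carrier M"
    and gen: "\<And>u. u \<in> carrier M \<Longrightarrow> \<exists>c\<in>B \<rightarrow> carrier R. u = (\<Oplus>\<^bsub>M\<^esub>b\<in>B. c b \<odot>\<^bsub>M\<^esub> b)"
    using fg unfolding finitely_generated_def by blast
  define J where "J = (\<Union>b\<in>B. {i. s b i \<noteq> \<zero>\<^bsub>R\<^esub>})"
  have sF: "s u \<in> carrier (free_module R I)" if "u \<in> carrier M" for u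
    using linear_maps_closed[OF s that] .
  have sB: "s b \<in> carrier (free_module R I)" if "b \<in> B" for b
    using sF B(2) that by (auto simp only: subset_iff)
  have finJ: "finite J" unfolding J_def using B(1) sB by simp
  have JI: "J \<subseteq> I" unfolding J_def using sB by auto
  have ev: "(\<lambda>u. s u i) \<in> linear_maps R M (self_module R)" for i
  proof -
    have "(\<lambda>c. c i) \<in> linear_maps R (free_module R I) (self_module R)"
      by (rule linear_mapsI) auto
    from linear_maps_compose[OF this s] show ?thesis .
  qed
  have supp: "s u i = \<zero>\<^bsub>R\<^esub>" if u: "u \<in> carrier M" and i: "i \<notin> J" for u i
  proof -
    obtain c where c: "c \<in> B \<rightarrow> carrier R" "u = (\<Oplus>\<^bsub>M\<^esub>b\<in>B. c b \<odot>\<^bsub>M\<^esub> b)" using gen[OF u] by blast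
    interpret K: module R "self_module R" by (rule self_module_module) (rule M.is_cring)
    have "s u i = (\<Oplus>\<^bsub>self_module R\<^esub>b\<in>B. s (c b \<odot>\<^bsub>M\<^esub> b) i)"
      unfolding c(2) using c(1) B by (intro linear_maps_finsum[OF M K.module_axioms ev]) auto
    also have "\<dots> = (\<Oplus>\<^bsub>self_module R\<^esub>b\<in>B. \<zero>\<^bsub>self_module R\<^esub>)"
    proof (intro finsum_cong_any)
      fix b assume b: "b \<in> B"
      then have "s b i = \<zero>\<^bsub>R\<^esub>" using i by (auto simp: J_def)
      then show "s (c b \<odot>\<^bsub>M\<^esub> b) i = \<zero>\<^bsub>self_module R\<^esub>"
        using linear_maps_smult[OF ev, of "c b" b i] b c(1) B by (auto simp: Pi_iff)
    qed
    finally show ?thesis using K.finsum_zero by simp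
  qed
  have "(\<Oplus>\<^bsub>M\<^esub>j\<in>J. s u j \<odot>\<^bsub>M\<^esub> p (free_basis R j)) = u" if u: "u \<in> carrier M" for u
  proof -
    have pb: "p (free_basis R j) \<in> carrier M" if "j \<in> I" for j
      using linear_maps_closed[OF p free_basis_closed[OF M.is_cring that]] .
    have sR: "s u j \<in> carrier R" for j using sF[OF u] by auto
    have "u = p (free_lift R (free_module R I) (free_basis R) (s u))"
      unfolding free_lift_def using free_module_expand[OF M.is_cring sF[OF u]] ps[OF u] by simp
    also have "\<dots> = (\<Oplus>\<^bsub>M\<^esub>j\<in>{i. s u i \<noteq> \<zero>\<^bsub>R\<^esub>}. p (s u j \<odot>\<^bsub>free_module R I\<^esub> free_basis R j))"
      unfolding free_lift_def using sF[OF u] free_basis_closed[OF M.is_cring, of _ I]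
      by (intro linear_maps_finsum[OF F.module_axioms M p] Pi_I F.smult_closed) auto
    also have "\<dots> = (\<Oplus>\<^bsub>M\<^esub>j\<in>{i. s u i \<noteq> \<zero>\<^bsub>R\<^esub>}. s u j \<odot>\<^bsub>M\<^esub> p (free_basis R j))"
      using sF[OF u] free_basis_closed[OF M.is_cring, of _ I]
      by (intro finsum_cong_any linear_maps_smult[OF p]) auto
    also have "\<dots> = (\<Oplus>\<^bsub>M\<^esub>j\<in>J. s u j \<odot>\<^bsub>M\<^esub> p (free_basis R j))"
      using supp[OF u] finJ JI pb sR
      by (intro M.add.finprod_mono_neutral_cong_left) (auto simp: subset_iff)
    finally show ?thesis by simp
  qed
  moreover have "(\<lambda>j. p (free_basis R j)) \<in> J \<rightarrow> carrier M"
    using JI linear_maps_closed[OF p free_basis_closed[OF M.is_cring]] by blast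
  moreover have "(\<lambda>j u. s u j) \<in> J \<rightarrow> linear_maps R M (self_module R)" using ev by blast
  ultimately show ?thesis using finJ that by meson
qed

text \<open>An element of \<open>M\<^sup>* \<otimes> Q\<close> is the sum of the \<open>\<theta>\<^sub>j \<otimes> q\<^sub>j\<close>, where \<open>q\<^sub>j\<close> is its value at
  \<open>e\<^sub>j\<close> when it is seen as a map \<open>M \<rightarrow> Q\<close>.\<close>

lemma dual_tensor_eqI:
  fixes M :: "('k, 'a, 'm) coalgebra_scheme"
  assumes M: "module R M" "finitely_generated R M" "projective R M" and Q: "module R Q"
    and t: "t \<in> carrier (tensor R (dual R M) Q)" "t' \<in> carrier (tensor R (dual R M) Q)"
    and eq: "\<And>h. h \<in> carrier M \<Longrightarrow>
      tensor_lift R Q (\<lambda>f q. f h \<odot>\<^bsub>Q\<^esub> q) t = tensor_lift R Q (\<lambda>f q. f h \<odot>\<^bsub>Q\<^esub> q) t'"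
  shows "t = t'"
proof -
  interpret M: module R M by fact
  interpret Q: module R Q by fact
  let ?D = "dual R M"
  note D = dual_module[OF M(1)]
  let ?T = "tensor R ?D Q"
  note T = tensor_module[OF D Q]
  interpret T: module R ?T by (rule T)
  interpret D: module R ?D by (rule D)
  obtain J :: "'a set" and e \<theta> where J: "finite J" "e \<in> J \<rightarrow> carrier M" and th: "\<theta> \<in> J \<rightarrow> linear_maps R M (self_module R)"
    and basis: "\<forall>u\<in>carrier M. (\<Oplus>\<^bsub>M\<^esub>j\<in>J. \<theta> j u \<odot>\<^bsub>M\<^esub> e j) = u"
    by (rule dual_basis_obtain[OF M])
  let ?th = "\<lambda>j. restrict (\<theta> j) (carrier M)"
  have thD: "?th j \<in> carrier ?D" if "j \<in> J" for j
    using th that by (intro dual_restrictI M) auto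
  have thR: "\<theta> j u \<in> carrier R" if "j \<in> J" "u \<in> carrier M" for j u
    using linear_maps_closed[of "\<theta> j" R M "self_module R" u] th that by auto
  have bil: "(\<lambda>f q. f h \<odot>\<^bsub>Q\<^esub> q) \<in> bilinear_maps R ?D Q Q" if "h \<in> carrier M" for h
    by (rule dual_eval_bilinear[OF M(1) Q that])
  note p = pure_tensor_bilinear[OF D Q]
  have expand: "s = (\<Oplus>\<^bsub>?T\<^esub>j\<in>J. pure_tensor R ?D Q (?th j) (tensor_lift R Q (\<lambda>f q. f (e j) \<odot>\<^bsub>Q\<^esub> q) s))"
    if "s \<in> carrier ?T" for s
  proof (rule tensor_ext[OF D Q T linear_maps_ident _ _ that])
    show "(\<lambda>s. \<Oplus>\<^bsub>?T\<^esub>j\<in>J. pure_tensor R ?D Q (?th j) (tensor_lift R Q (\<lambda>f q. f (e j) \<odot>\<^bsub>Q\<^esub> q) s)) \<in> linear_maps R ?T ?T"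
      using J by (intro linear_maps_finsum_pointwise T bilinear_maps_compose_right[OF p] tensor_lift_linear D Q bil thD) auto
    fix f q assume f: "f \<in> carrier ?D" and q: "q \<in> carrier Q"
    have fe: "f (e j) \<in> carrier R" if "j \<in> J" for j using dual_closed[OF f] J that by auto
    have clo: "(\<lambda>j. f (e j) \<odot>\<^bsub>?D\<^esub> ?th j) \<in> J \<rightarrow> carrier ?D"
      using fe thD by (auto simp del: dual_simps)
    \<comment> \<open>Applying f to the expansion of h in the dual basis shows that f is the
      combination of the \<open>?th j\<close> with coefficients \<open>f (e j)\<close>.\<close>
    have "f = (\<Oplus>\<^bsub>?D\<^esub>j\<in>J. f (e j) \<odot>\<^bsub>?D\<^esub> ?th j)"
    proof (rule dual_eqI[OF f])
      show "(\<Oplus>\<^bsub>?D\<^esub>j\<in>J. f (e j) \<odot>\<^bsub>?D\<^esub> ?th j) \<in> carrier ?D"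
        by (rule D.finsum_closed[OF clo])
      fix h assume h: "h \<in> carrier M"
      have "f h = f (\<Oplus>\<^bsub>M\<^esub>j\<in>J. \<theta> j h \<odot>\<^bsub>M\<^esub> e j)" using bspec[OF basis h] by simp
      also have "\<dots> = (\<Oplus>\<^bsub>self_module R\<^esub>j\<in>J. f (\<theta> j h \<odot>\<^bsub>M\<^esub> e j))"
        using J thR h by (intro linear_maps_finsum[OF M(1) self_module_module[OF M.is_cring] dual_linear[OF f]]) auto
      also have "\<dots> = (\<Oplus>\<^bsub>self_module R\<^esub>j\<in>J. (f (e j) \<odot>\<^bsub>?D\<^esub> ?th j) h)"
        using J thR h fe by (intro finsum_cong_any) (auto simp: linear_maps_smult[OF dual_linear[OF f]] M.m_comm Pi_iff)
      also have "\<dots> = (\<Oplus>\<^bsub>?D\<^esub>j\<in>J. f (e j) \<odot>\<^bsub>?D\<^esub> ?th j) h"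
        by (rule linear_maps_finsum[OF D self_module_module[OF M.is_cring] dual_eval_linear[OF M(1) h] clo, symmetric])
      finally show "f h = \<dots>" .
    qed
    then have "pure_tensor R ?D Q f q = pure_tensor R ?D Q (\<Oplus>\<^bsub>?D\<^esub>j\<in>J. f (e j) \<odot>\<^bsub>?D\<^esub> ?th j) q"
      by (rule arg_cong)
    also have "\<dots> = (\<Oplus>\<^bsub>?T\<^esub>j\<in>J. pure_tensor R ?D Q (f (e j) \<odot>\<^bsub>?D\<^esub> ?th j) q)"
      by (rule linear_maps_finsum[OF D T bilinear_maps_left[OF p q] clo])
    also have "\<dots> = (\<Oplus>\<^bsub>?T\<^esub>j\<in>J. pure_tensor R ?D Q (?th j) (f (e j) \<odot>\<^bsub>Q\<^esub> q))"
      using fe thD q by (intro finsum_cong_any)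
        (simp add: linear_maps_smult[OF bilinear_maps_left[OF p]] linear_maps_smult[OF bilinear_maps_right[OF p]] del: dual_simps)
    also have "\<dots> = (\<Oplus>\<^bsub>?T\<^esub>j\<in>J. pure_tensor R ?D Q (?th j) (tensor_lift R Q (\<lambda>f q. f (e j) \<odot>\<^bsub>Q\<^esub> q) (pure_tensor R ?D Q f q)))"
      using J f q by (intro finsum_cong_any) (subst tensor_lift_pure[OF D Q Q bil], auto)
    finally show "pure_tensor R ?D Q f q = \<dots>" .
  qed
  have "t = (\<Oplus>\<^bsub>?T\<^esub>j\<in>J. pure_tensor R ?D Q (?th j) (tensor_lift R Q (\<lambda>f q. f (e j) \<odot>\<^bsub>Q\<^esub> q) t))"
    by (rule expand[OF t(1)])
  also have "\<dots> = (\<Oplus>\<^bsub>?T\<^esub>j\<in>J. pure_tensor R ?D Q (?th j) (tensor_lift R Q (\<lambda>f q. f (e j) \<odot>\<^bsub>Q\<^esub> q) t'))"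
    using eq J(2) by (intro finsum_cong_any) (auto simp: Pi_iff)
  also have "\<dots> = t'"
    by (rule expand[OF t(2), symmetric])
  finally show ?thesis .
qed

text \<open>Surjectivity of the map from M* \<otimes> Q to the linear maps M \<rightarrow> Q: a dual
  basis yields the preimage of g as the sum of the \<theta>_j \<otimes> g(e_j).\<close>

lemma dual_tensor_exists:
  fixes M :: "('k, 'a, 'm) coalgebra_scheme"
  assumes M: "module R M" "finitely_generated R M" "projective R M" and Q: "module R Q"
    and g: "g \<in> linear_maps R M Q"
  shows "\<exists>t\<in>carrier (tensor R (dual R M) Q). \<forall>h\<in>carrier M. tensor_lift R Q (\<lambda>f q. f h \<odot>\<^bsub>Q\<^esub> q) t = g h"
proof -
  interpret M: module R M by fact
  interpret Q: module R Q by fact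
  let ?D = "dual R M"
  note D = dual_module[OF M(1)]
  let ?T = "tensor R ?D Q"
  note T = tensor_module[OF D Q]
  interpret T: module R ?T by (rule T)
  obtain J :: "'a set" and e \<theta> where J: "finite J" "e \<in> J \<rightarrow> carrier M" and th: "\<theta> \<in> J \<rightarrow> linear_maps R M (self_module R)"
    and basis: "\<forall>u\<in>carrier M. (\<Oplus>\<^bsub>M\<^esub>j\<in>J. \<theta> j u \<odot>\<^bsub>M\<^esub> e j) = u"
    by (rule dual_basis_obtain[OF M])
  let ?th = "\<lambda>j. restrict (\<theta> j) (carrier M)"
  have thD: "?th j \<in> carrier ?D" if "j \<in> J" for j
    using th that by (intro dual_restrictI M) auto
  have thR: "\<theta> j u \<in> carrier R" if "j \<in> J" "u \<in> carrier M" for j u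
    using linear_maps_closed[of "\<theta> j" R M "self_module R" u] th that by auto
  have bil: "(\<lambda>f q. f h \<odot>\<^bsub>Q\<^esub> q) \<in> bilinear_maps R ?D Q Q" if "h \<in> carrier M" for h
    by (rule dual_eval_bilinear[OF M(1) Q that])
  have ge: "g (e j) \<in> carrier Q" if "j \<in> J" for j
    using linear_maps_closed[OF g] J that by auto
  note p = pure_tensor_bilinear[OF D Q]
  let ?t = "\<Oplus>\<^bsub>?T\<^esub>j\<in>J. pure_tensor R ?D Q (?th j) (g (e j))"
  have clo: "(\<lambda>j. pure_tensor R ?D Q (?th j) (g (e j))) \<in> J \<rightarrow> carrier ?T"
    using bilinear_maps_closed[OF p thD ge] by auto
  have "tensor_lift R Q (\<lambda>f q. f h \<odot>\<^bsub>Q\<^esub> q) ?t = g h" if h: "h \<in> carrier M" for h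
  proof -
    have "tensor_lift R Q (\<lambda>f q. f h \<odot>\<^bsub>Q\<^esub> q) ?t =
        (\<Oplus>\<^bsub>Q\<^esub>j\<in>J. tensor_lift R Q (\<lambda>f q. f h \<odot>\<^bsub>Q\<^esub> q) (pure_tensor R ?D Q (?th j) (g (e j))))"
      by (rule linear_maps_finsum[OF T Q tensor_lift_linear[OF D Q Q bil[OF h]] clo])
    also have "\<dots> = (\<Oplus>\<^bsub>Q\<^esub>j\<in>J. g (\<theta> j h \<odot>\<^bsub>M\<^esub> e j))"
      using h thD ge thR J by (intro finsum_cong_any)
        (auto simp: tensor_lift_pure[OF D Q Q bil] linear_maps_smult[OF g] Pi_iff)
    also have "\<dots> = g (\<Oplus>\<^bsub>M\<^esub>j\<in>J. \<theta> j h \<odot>\<^bsub>M\<^esub> e j)"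
      using thR h J by (intro linear_maps_finsum[OF M(1) Q g, symmetric]) auto
    finally show ?thesis using bspec[OF basis h] by simp
  qed
  then show ?thesis using T.finsum_closed[OF clo] by blast
qed

text \<open>The coordinates in a dual basis are functionals. This turns the definition of an
  integral, which quantifies over functionals, into an equation in A_{x,x}.\<close>

lemma dual_separates:
  fixes M :: "('k, 'a, 'm) coalgebra_scheme"
  assumes M: "module R M" "finitely_generated R M" "projective R M"
    and u: "u \<in> carrier M" "v \<in> carrier M" and eq: "\<And>f. f \<in> carrier (dual R M) \<Longrightarrow> f u = f v"
  shows "u = v"
proof -
  obtain J :: "'a set" and e \<theta> where "finite J" and J: "e \<in> J \<rightarrow> carrier M" and th: "\<theta> \<in> J \<rightarrow> linear_maps R M (self_module R)"
    and basis: "\<forall>u\<in>carrier M. (\<Oplus>\<^bsub>M\<^esub>j\<in>J. \<theta> j u \<odot>\<^bsub>M\<^esub> e j) = u"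
    by (rule dual_basis_obtain[OF M])
  have "\<theta> j u = \<theta> j v" if "j \<in> J" for j
    using eq[OF dual_restrictI[OF M(1), of "\<theta> j"]] th that u by auto
  then have "(\<Oplus>\<^bsub>M\<^esub>j\<in>J. \<theta> j u \<odot>\<^bsub>M\<^esub> e j) = (\<Oplus>\<^bsub>M\<^esub>j\<in>J. \<theta> j v \<odot>\<^bsub>M\<^esub> e j)"
    by (intro finsum_cong_any) simp
  then show ?thesis using basis u by simp
qed

lemma linear_maps_pure_left:
  assumes "module R M" "module R N" "g \<in> linear_maps R Q M" "v \<in> carrier N"
  shows "(\<lambda>u. pure_tensor R M N (g u) v) \<in> linear_maps R Q (tensor R M N)"
  by (rule bilinear_maps_compose_left[OF pure_tensor_bilinear[OF assms(1,2)] assms(3,4)])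

lemma linear_maps_pure_right:
  assumes "module R M" "module R N" "g \<in> linear_maps R Q N" "v \<in> carrier M"
  shows "(\<lambda>u. pure_tensor R M N v (g u)) \<in> linear_maps R Q (tensor R M N)"
  by (rule bilinear_maps_compose_right[OF pure_tensor_bilinear[OF assms(1,2)] assms(3,4)])

section \<open>Structure maps of the tensor product coalgebra and of the base coalgebra\<close>

lemma tensor_coalgebra_simps [simp]:
  "carrier (tensor_coalgebra R C D) = carrier (tensor R C D)"
  "add (tensor_coalgebra R C D) = add (tensor R C D)"
  "smult (tensor_coalgebra R C D) = smult (tensor R C D)"
  "comult (tensor_coalgebra R C D) =
    tensor_lift R (tensor R (tensor R C D) (tensor R C D)) (\<lambda>c d.
      sweedler R C (tensor R (tensor R C D) (tensor R C D)) (\<lambda>c1 c2.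
        sweedler R D (tensor R (tensor R C D) (tensor R C D)) (\<lambda>d1 d2.
          pure_tensor R (tensor R C D) (tensor R C D) (pure_tensor R C D c1 d1) (pure_tensor R C D c2 d2)) d) c)"
  "counit (tensor_coalgebra R C D) =
    tensor_lift R (self_module R) (\<lambda>c d. counit C c \<otimes>\<^bsub>R\<^esub> counit D d)"
  by (simp_all add: tensor_coalgebra_def Let_def module.extend_def coalgebra.fields_def)

lemma unit_coalgebra_simps [simp]:
  "carrier (unit_coalgebra R) = carrier R"
  "comult (unit_coalgebra R) = (\<lambda>r. r \<odot>\<^bsub>tensor R (self_module R) (self_module R)\<^esub>
    pure_tensor R (self_module R) (self_module R) \<one>\<^bsub>R\<^esub> \<one>\<^bsub>R\<^esub>)"
  "counit (unit_coalgebra R) = (\<lambda>r. r)"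
  by (simp_all add: unit_coalgebra_def Let_def module.extend_def coalgebra.fields_def)

subsection \<open>Hopf categories and the antipode\<close>

context hopf_category
begin

abbreviation "C \<equiv> Mor A"
abbreviation "S \<equiv> antipode A"
abbreviation "K \<equiv> self_module R"
abbreviation "mul \<equiv> cat_mult R A"
abbreviation "eps x y \<equiv> counit (Mor A x y)"
abbreviation "sw x y \<equiv> sweedler R (Mor A x y)"

section \<open>Linearity and closure rules\<close>

lemma Mor_module: "\<lbrakk>x \<in> Obj A; y \<in> Obj A\<rbrakk> \<Longrightarrow> module R (C x y)"
  using Mor_coalgebra by (rule coalgebra.axioms)

lemma K_module: "module R K"
  by (rule self_module_module) (rule is_cring)

lemma comp_map_linear:
  "\<lbrakk>x \<in> Obj A; y \<in> Obj A; z \<in> Obj A\<rbrakk> \<Longrightarrow>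
    comp_map A x y z \<in> linear_maps R (tensor R (C x y) (C y z)) (C x z)"
  using comp_coalgebra_hom[of x y z] by (simp add: coalgebra_homs_def linear_maps_def)

lemma mul_bilinear:
  "\<lbrakk>x \<in> Obj A; y \<in> Obj A; z \<in> Obj A\<rbrakk> \<Longrightarrow> mul x y z \<in> bilinear_maps R (C x y) (C y z) (C x z)"
  unfolding cat_mult_def[abs_def]
  by (intro bilinear_maps_compose[OF comp_map_linear] pure_tensor_bilinear Mor_module)

lemma counit_linear: "\<lbrakk>x \<in> Obj A; y \<in> Obj A\<rbrakk> \<Longrightarrow> eps x y \<in> linear_maps R (C x y) K"
  by (rule coalgebra.counit_linear[OF Mor_coalgebra])

lemma lin_mul_left:
  "\<lbrakk>g \<in> linear_maps R M (C x y); l \<in> carrier (C y z); x \<in> Obj A; y \<in> Obj A; z \<in> Obj A\<rbrakk> \<Longrightarrow>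
    (\<lambda>u. mul x y z (g u) l) \<in> linear_maps R M (C x z)"
  by (rule bilinear_maps_compose_left[OF mul_bilinear])

lemma lin_mul_right:
  "\<lbrakk>g \<in> linear_maps R M (C y z); l \<in> carrier (C x y); x \<in> Obj A; y \<in> Obj A; z \<in> Obj A\<rbrakk> \<Longrightarrow>
    (\<lambda>u. mul x y z l (g u)) \<in> linear_maps R M (C x z)"
  by (rule bilinear_maps_compose_right[OF mul_bilinear])

lemma lin_antipode:
  "\<lbrakk>g \<in> linear_maps R M (C x y); x \<in> Obj A; y \<in> Obj A\<rbrakk> \<Longrightarrow>
    (\<lambda>u. S x y (g u)) \<in> linear_maps R M (C y x)"
  by (rule linear_maps_compose[OF antipode_linear])

lemma lin_counit:
  "\<lbrakk>g \<in> linear_maps R M (C x y); x \<in> Obj A; y \<in> Obj A\<rbrakk> \<Longrightarrow>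
    (\<lambda>u. eps x y (g u)) \<in> linear_maps R M K"
  by (rule linear_maps_compose[OF counit_linear])

lemma lin_sw:
  "\<lbrakk>g \<in> linear_maps R M (C x y); f \<in> bilinear_maps R (C x y) (C x y) P; module R P; x \<in> Obj A; y \<in> Obj A\<rbrakk> \<Longrightarrow>
    (\<lambda>u. sw x y P f (g u)) \<in> linear_maps R M P"
  by (rule linear_maps_compose[OF coalgebra.sweedler_linear[OF Mor_coalgebra]])

lemma lin_sw_param:
  "\<lbrakk>\<And>a b. \<lbrakk>a \<in> carrier (C x y); b \<in> carrier (C x y)\<rbrakk> \<Longrightarrow> (\<lambda>u. F u a b) \<in> linear_maps R M P;
    \<And>u. u \<in> carrier M \<Longrightarrow> F u \<in> bilinear_maps R (C x y) (C x y) P;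
    h \<in> carrier (C x y); module R M; module R P; x \<in> Obj A; y \<in> Obj A\<rbrakk> \<Longrightarrow>
    (\<lambda>u. sw x y P (F u) h) \<in> linear_maps R M P"
  by (rule coalgebra.sweedler_linear_param[OF Mor_coalgebra])

lemma mul_closed:
  "\<lbrakk>h \<in> carrier (C x y); l \<in> carrier (C y z); x \<in> Obj A; y \<in> Obj A; z \<in> Obj A\<rbrakk> \<Longrightarrow>
    mul x y z h l \<in> carrier (C x z)"
  by (rule bilinear_maps_closed[OF mul_bilinear])

lemma antipode_closed:
  "\<lbrakk>h \<in> carrier (C x y); x \<in> Obj A; y \<in> Obj A\<rbrakk> \<Longrightarrow> S x y h \<in> carrier (C y x)"
  by (rule linear_maps_closed[OF antipode_linear])

lemma counit_closed:
  "\<lbrakk>h \<in> carrier (C x y); x \<in> Obj A; y \<in> Obj A\<rbrakk> \<Longrightarrow> eps x y h \<in> carrier R"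
  using linear_maps_closed[OF counit_linear] by simp

lemma sw_closed:
  "\<lbrakk>h \<in> carrier (C x y); f \<in> bilinear_maps R (C x y) (C x y) P; module R P; x \<in> Obj A; y \<in> Obj A\<rbrakk> \<Longrightarrow>
    sw x y P f h \<in> carrier P"
  by (rule linear_maps_closed[OF coalgebra.sweedler_linear[OF Mor_coalgebra]])

lemma pure_closed:
  "\<lbrakk>u \<in> carrier M; v \<in> carrier N; module R M; module R N\<rbrakk> \<Longrightarrow>
    pure_tensor R M N u v \<in> carrier (tensor R M N)"
  by (rule bilinear_maps_closed[OF pure_tensor_bilinear])

text \<open>Used as introduction rules, these follow the syntax of a Sweedler expression and split
  the claim that it is linear in one variable into memberships in carriers. The variable may sit in
  the argument of a sum (\<open>lin_sw\<close>) or in its body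
  (\<open>lin_sw_param\<close>).\<close>

lemmas lin = linear_maps_ident linear_maps_smult_left linear_maps_smult_right
  linear_maps_mult_left[OF is_cring] linear_maps_mult_right[OF is_cring]
  linear_maps_pure_left linear_maps_pure_right lin_mul_left lin_mul_right lin_antipode lin_counit
  lin_sw lin_sw_param bilinear_mapsI
  mul_closed antipode_closed counit_closed sw_closed pure_closed ident_closed module.smult_closed
  Mor_module K_module tensor_module

lemmas sw_cong = coalgebra.sweedler_cong[OF Mor_coalgebra]
lemmas sw_commute = coalgebra.sweedler_commute[OF Mor_coalgebra]
lemmas sw_coassoc = coalgebra.sweedler_coassoc[OF Mor_coalgebra]
lemmas sw_counit_left = coalgebra.sweedler_counit_left[OF Mor_coalgebra]
lemmas sw_counit_right = coalgebra.sweedler_counit_right[OF Mor_coalgebra]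

lemma sw_swap:
  assumes "x \<in> Obj A" "y \<in> Obj A" "x' \<in> Obj A" "y' \<in> Obj A" "module R P"
    "h \<in> carrier (C x y)" "l \<in> carrier (C x' y')"
    "\<And>a b. \<lbrakk>a \<in> carrier (C x y); b \<in> carrier (C x y)\<rbrakk> \<Longrightarrow>
      F a b \<in> bilinear_maps R (C x' y') (C x' y') P"
    "\<And>c d. \<lbrakk>c \<in> carrier (C x' y'); d \<in> carrier (C x' y')\<rbrakk> \<Longrightarrow>
      (\<lambda>a b. F a b c d) \<in> bilinear_maps R (C x y) (C x y) P"
  shows "sw x y P (\<lambda>a b. sw x' y' P (F a b) l) h = sw x' y' P (\<lambda>c d. sw x y P (\<lambda>a b. F a b c d) h) l"
  unfolding sweedler_def
  by (rule tensor_lift_swap[of R "C x y" "C x y" "C x' y'" "C x' y'"])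
    (use assms in \<open>simp_all add: Mor_module coalgebra.comult_closed[OF Mor_coalgebra]\<close>)

text \<open>The coproduct is multiplicative because composition is a morphism of coalgebras. The
  coproduct of h \<otimes> l in the tensor coalgebra is the double sum \<open>?D h l\<close>, and
  the linear map \<open>?G\<close> carries it into P.\<close>

lemma sw_mul:
  assumes xyz: "x \<in> Obj A" "y \<in> Obj A" "z \<in> Obj A" and P: "module R P"
    and h: "h \<in> carrier (C x y)" and l: "l \<in> carrier (C y z)"
    and F: "F \<in> bilinear_maps R (C x z) (C x z) P"
  shows "sw x z P F (mul x y z h l) =
    sw x y P (\<lambda>a b. sw y z P (\<lambda>c d. F (mul x y z a c) (mul x y z b d)) l) h"
proof -
  let ?T = "tensor R (C x y) (C y z)" and ?f = "comp_map A x y z"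
  let ?TT = "tensor R ?T ?T" and ?t = "pure_tensor R (C x y) (C y z)"
  note [simp] = xyz h l
  have T: "module R ?T" and TT: "module R ?TT"
    by (intro tensor_module Mor_module; simp)+
  have t: "?t h l \<in> carrier ?T"
    by (intro lin; simp)
  let ?d = "\<lambda>c1 c2 d1 d2. pure_tensor R ?T ?T (?t c1 d1) (?t c2 d2)"
  let ?D = "\<lambda>c d. sw x y ?TT (\<lambda>c1 c2. sw y z ?TT (\<lambda>d1 d2. ?d c1 c2 d1 d2) d) c"
  have D: "?D \<in> bilinear_maps R (C x y) (C y z) ?TT"
    by (intro lin; simp)
  have comult_t: "comult (tensor_coalgebra R (C x y) (C y z)) (?t h l) = ?D h l"
    by (simp add: tensor_lift_pure[OF Mor_module Mor_module TT D])
  let ?g = "\<lambda>a b. pure_tensor R (C x z) (C x z) (?f a) (?f b)"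
  note f = comp_map_linear[OF xyz]
  have g: "?g \<in> bilinear_maps R ?T ?T (tensor R (C x z) (C x z))"
    by (intro lin linear_maps_compose[OF f] linear_maps_closed[OF f]; simp)
  have Fg: "(\<lambda>a b. F (?f a) (?f b)) \<in> bilinear_maps R ?T ?T P"
    by (intro lin bilinear_maps_compose_left[OF F] bilinear_maps_compose_right[OF F]
        linear_maps_compose[OF f] linear_maps_closed[OF f]; simp)
  let ?G = "tensor_lift R P (\<lambda>a b. F (?f a) (?f b))"
  have G: "?G \<in> linear_maps R ?TT P"
    by (rule tensor_lift_linear[OF T T P Fg])
  have Dhl: "?D h l \<in> carrier ?TT"
    using bilinear_maps_closed[OF D h l] .
  have "sw x z P F (mul x y z h l) = tensor_lift R P F (comult (C x z) (?f (?t h l)))"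
    by (simp add: sweedler_def cat_mult_def)
  also have "comult (C x z) (?f (?t h l)) =
      sweedler R (tensor_coalgebra R (C x y) (C y z)) (tensor R (C x z) (C x z)) ?g (?t h l)"
    using comp_coalgebra_hom[OF xyz] t by (simp add: coalgebra_homs_def)
  also have "\<dots> = tensor_lift R (tensor R (C x z) (C x z)) ?g (?D h l)"
    by (simp only: sweedler_def[where C = "tensor_coalgebra R (C x y) (C y z)"] comult_t)
  also have "tensor_lift R P F \<dots> = tensor_lift R P (\<lambda>a b. tensor_lift R P F (?g a b)) (?D h l)"
    by (intro bilinear_tensor_lift_commute[OF T T _ P g _ Dhl] tensor_lift_linear P F lin; simp)
  also have "\<dots> = ?G (?D h l)"
    using linear_maps_closed[OF f]
    by (intro tensor_lift_cong[OF T T Dhl])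
      (simp add: tensor_lift_pure[OF Mor_module Mor_module P F])
  also have "\<dots> = sw x y P (\<lambda>c1 c2. ?G (sw y z ?TT (\<lambda>d1 d2. ?d c1 c2 d1 d2) l)) h"
    by (intro sw_commute[OF _ _ TT P h _ G] lin; simp)
  also have "\<dots> = sw x y P (\<lambda>c1 c2. sw y z P (\<lambda>d1 d2. ?G (?d c1 c2 d1 d2)) l) h"
    by (intro sw_cong[OF _ _ h] sw_commute[OF _ _ TT P l _ G] lin; simp)
  also have "\<dots> = sw x y P (\<lambda>a b. sw y z P (\<lambda>c d. F (mul x y z a c) (mul x y z b d)) l) h"
    by (intro sw_cong[OF _ _ h] sw_cong[OF _ _ l]; simp?)
      (subst tensor_lift_pure[OF T T P Fg]; (intro lin; simp)?; simp add: cat_mult_def)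
  finally show ?thesis .
qed

lemma counit_mul:
  assumes xyz: "x \<in> Obj A" "y \<in> Obj A" "z \<in> Obj A"
    and h: "h \<in> carrier (C x y)" and l: "l \<in> carrier (C y z)"
  shows "eps x z (mul x y z h l) = eps x y h \<otimes> eps y z l"
proof -
  note [simp] = xyz h l
  have "pure_tensor R (C x y) (C y z) h l \<in> carrier (tensor R (C x y) (C y z))"
    by (intro lin; simp)
  moreover have "(\<lambda>c d. eps x y c \<otimes> eps y z d) \<in> bilinear_maps R (C x y) (C y z) K"
    by (intro lin; simp)
  ultimately show ?thesis
    using comp_coalgebra_hom[OF xyz]
    by (simp add: coalgebra_homs_def cat_mult_def tensor_lift_pure Mor_module K_module)
qed

lemma counit_ident: "x \<in> Obj A \<Longrightarrow> eps x x (ident A x) = \<one>"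
proof -
  assume x: "x \<in> Obj A"
  then have "counit (C x x) (\<one> \<odot>\<^bsub>C x x\<^esub> ident A x) = \<one>"
    using ident_coalgebra_hom[OF x] by (simp add: coalgebra_homs_def)
  then show ?thesis using module.smult_one[OF Mor_module[OF x x] ident_closed[OF x]] by simp
qed

text \<open>The identity is group-like, being the image of 1 under the coalgebra morphism k
  \<rightarrow> A_{x,x}, and the coproduct of 1 in k is 1 \<otimes> 1.\<close>

lemma sw_ident:
  assumes x: "x \<in> Obj A" and P: "module R P" and F: "F \<in> bilinear_maps R (C x x) (C x x) P"
  shows "sw x x P F (ident A x) = F (ident A x) (ident A x)"
proof -
  let ?TT = "tensor R (C x x) (C x x)" and ?KK = "tensor R K K"
  let ?i = "\<lambda>r. r \<odot>\<^bsub>C x x\<^esub> ident A x"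
  note [simp] = x ident_closed[OF x]
  note M = Mor_module[OF x x]
  interpret KK: module R ?KK by (intro lin)
  have bil: "(\<lambda>a b. pure_tensor R (C x x) (C x x) (?i a) (?i b)) \<in> bilinear_maps R K K ?TT"
    by (intro lin; simp add: M module.smult_closed)
  have p1: "pure_tensor R K K \<one> \<one> \<in> carrier ?KK"
    by (intro lin; simp)
  have "comult (C x x) (\<one> \<odot>\<^bsub>C x x\<^esub> ident A x) =
      tensor_lift R ?TT (\<lambda>a b. pure_tensor R (C x x) (C x x) (?i a) (?i b)) (\<one> \<odot>\<^bsub>?KK\<^esub> pure_tensor R K K \<one> \<one>)"
    using ident_coalgebra_hom[OF x] by (simp add: coalgebra_homs_def sweedler_def)
  also have "\<dots> = pure_tensor R (C x x) (C x x) (\<one> \<odot>\<^bsub>C x x\<^esub> ident A x) (\<one> \<odot>\<^bsub>C x x\<^esub> ident A x)"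
    using p1 by (simp add: tensor_lift_pure[OF K_module K_module tensor_module[OF M M] bil])
  finally have "comult (C x x) (ident A x) = pure_tensor R (C x x) (C x x) (ident A x) (ident A x)"
    by (simp add: module.smult_one[OF M])
  then show ?thesis
    by (simp add: sweedler_def tensor_lift_pure[OF M M P F])
qed

section \<open>The antipode reverses products and coproducts\<close>

lemma sw_antipode_right:
  assumes xy: "x \<in> Obj A" "y \<in> Obj A" and P: "module R P" and h: "h \<in> carrier (C x y)"
    and g: "g \<in> linear_maps R (C x x) P"
  shows "sw x y P (\<lambda>a b. g (mul x y x a (S x y b))) h = eps x y h \<odot>\<^bsub>P\<^esub> g (ident A x)"
proof -
  note [simp] = xy h
  have bil: "(\<lambda>a b. mul x y x a (S x y b)) \<in> bilinear_maps R (C x y) (C x y) (C x x)"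
    by (intro lin; simp)
  show ?thesis
    using sw_commute[OF xy Mor_module[OF xy(1,1)] P h bil g] antipode_right[OF xy h]
    by (simp add: linear_maps_smult[OF g] counit_closed ident_closed)
qed

lemma sw_antipode_left:
  assumes xy: "x \<in> Obj A" "y \<in> Obj A" and P: "module R P" and h: "h \<in> carrier (C x y)"
    and g: "g \<in> linear_maps R (C y y) P"
  shows "sw x y P (\<lambda>a b. g (mul y x y (S x y a) b)) h = eps x y h \<odot>\<^bsub>P\<^esub> g (ident A y)"
proof -
  note [simp] = xy h
  have bil: "(\<lambda>a b. mul y x y (S x y a) b) \<in> bilinear_maps R (C x y) (C x y) (C y y)"
    by (intro lin; simp)
  show ?thesis
    using sw_commute[OF xy Mor_module[OF xy(2,2)] P h bil g] antipode_left[OF xy h]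
    by (simp add: linear_maps_smult[OF g] counit_closed ident_closed)
qed

text \<open>For the group-like element 1_x the antipode axiom reads 1_x S(1_x) = \<epsilon>(1_x)
  1_x.\<close>

lemma antipode_ident:
  assumes x: "x \<in> Obj A"
  shows "S x x (ident A x) = ident A x"
proof -
  note [simp] = x ident_closed[OF x]
  have bil: "(\<lambda>a b. mul x x x a (S x x b)) \<in> bilinear_maps R (C x x) (C x x) (C x x)"
    by (intro lin; simp)
  show ?thesis
    using sw_ident[OF x Mor_module[OF x x] bil] antipode_right[of x x "ident A x"]
    by (simp add: ident_left antipode_closed counit_ident module.smult_one[OF Mor_module])
qed

text \<open>Start from \<epsilon>(l) S(h) = S(h_1) \<epsilon>(h_2 l) and expand the counit of h_2 l
  by the antipode axiom. This gives S(h_1) h_2 l_1 S(h_3 l_2), in which S(h_1) h_2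
  collapses.\<close>

lemma antipode_mul_aux:
  assumes xyz: "x \<in> Obj A" "y \<in> Obj A" "z \<in> Obj A"
    and h: "h \<in> carrier (C x y)" and l: "l \<in> carrier (C y z)"
  shows "sw y z (C y x) (\<lambda>l1 l2. mul y z x l1 (S x z (mul x y z h l2))) l = eps y z l \<odot>\<^bsub>C y x\<^esub> S x y h"
    (is "?lhs = _")
proof -
  note [simp] = xyz h l
  let ?P = "C y x"
  have P: "module R ?P" by (intro lin; simp)
  interpret P: module R ?P by (rule P)
  \<comment> \<open>The separate argument w holds the factor S(h_1) h_2, so that
    \<open>sw_antipode_left\<close> applies with the linear map that sends w to
    \<open>?f w b\<close>.\<close>
  let ?f = "\<lambda>w b. sw y z ?P (\<lambda>l1 l2. mul y y x w (mul y z x l1 (S x z (mul x y z b l2)))) l"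
  have "eps y z l \<odot>\<^bsub>?P\<^esub> S x y h = sw x y ?P (\<lambda>h1 h2. eps x y h2 \<odot>\<^bsub>?P\<^esub> (eps y z l \<odot>\<^bsub>?P\<^esub> S x y h1)) h"
    by (rule sw_counit_right[symmetric]; (intro lin)?; simp)
  also have "\<dots> = sw x y ?P (\<lambda>h1 h2. sw x y ?P (\<lambda>a b. ?f (mul y x y (S x y h1) a) b) h2) h"
  proof (rule sw_cong; simp?)
    fix h1 h2 assume h12 [simp]: "h1 \<in> carrier (C x y)" "h2 \<in> carrier (C x y)"
    have "eps x y h2 \<odot>\<^bsub>?P\<^esub> (eps y z l \<odot>\<^bsub>?P\<^esub> S x y h1) = eps x z (mul x y z h2 l) \<odot>\<^bsub>?P\<^esub> S x y h1"
      by (simp add: counit_mul P.smult_assoc1 counit_closed antipode_closed)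
    also have "\<dots> = eps x z (mul x y z h2 l) \<odot>\<^bsub>?P\<^esub> mul y x x (S x y h1) (ident A x)"
      by (simp add: ident_right antipode_closed)
    also have "\<dots> = sw x z ?P (\<lambda>u v. mul y x x (S x y h1) (mul x z x u (S x z v))) (mul x y z h2 l)"
      by (rule sw_antipode_right[symmetric]; (intro lin)?; simp)
    also have "\<dots> = sw x y ?P (\<lambda>a b. sw y z ?P (\<lambda>c d. mul y x x (S x y h1)
        (mul x z x (mul x y z a c) (S x z (mul x y z b d)))) l) h2"
      by (rule sw_mul; (intro lin)?; simp)
    also have "\<dots> = sw x y ?P (\<lambda>a b. ?f (mul y x y (S x y h1) a) b) h2"
      by (intro sw_cong; simp add: cat_assoc mul_closed antipode_closed)
    finally show "eps x y h2 \<odot>\<^bsub>?P\<^esub> (eps y z l \<odot>\<^bsub>?P\<^esub> S x y h1) = \<dots>" .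
  qed
  also have "\<dots> = sw x y ?P (\<lambda>k b. sw x y ?P (\<lambda>h1 a. ?f (mul y x y (S x y h1) a) b) k) h"
    by (rule sw_coassoc[symmetric]; (intro lin)?; simp)
  also have "\<dots> = sw x y ?P (\<lambda>k b. eps x y k \<odot>\<^bsub>?P\<^esub> ?f (ident A y) b) h"
    by (intro sw_cong sw_antipode_left lin; simp)
  also have "\<dots> = ?f (ident A y) h"
    by (rule sw_counit_left; (intro lin)?; simp)
  also have "\<dots> = ?lhs"
    by (intro sw_cong; simp add: ident_left mul_closed antipode_closed)
  finally show ?thesis by simp
qed

text \<open>S(h l) = S(l_1) l_2 S(h l_3), where the auxiliary identity turns l_2 S(h l_3) into
  \<epsilon>(l_2) S(h) and the counit leaves S(l) S(h). This is uniqueness of convolution inverses,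
  spelt out across different objects.\<close>

lemma antipode_mul:
  assumes xyz: "x \<in> Obj A" "y \<in> Obj A" "z \<in> Obj A"
    and h: "h \<in> carrier (C x y)" and l: "l \<in> carrier (C y z)"
  shows "S x z (mul x y z h l) = mul z y x (S y z l) (S x y h)"
proof -
  note [simp] = xyz h l
  let ?P = "C z x"
  have P: "module R ?P" by (intro lin; simp)
  interpret P: module R ?P by (rule P)
  let ?g = "\<lambda>w b. mul z z x w (S x z (mul x y z h b))"
  have "S x z (mul x y z h l) = ?g (ident A z) l"
    by (simp add: ident_left mul_closed antipode_closed)
  also have "\<dots> = sw y z ?P (\<lambda>k b. eps y z k \<odot>\<^bsub>?P\<^esub> ?g (ident A z) b) l"
    by (rule sw_counit_left[symmetric]; (intro lin)?; simp)
  also have "\<dots> = sw y z ?P (\<lambda>k b. sw y z ?P (\<lambda>l1 l2. ?g (mul z y z (S y z l1) l2) b) k) l"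
    by (intro sw_cong sw_antipode_left[symmetric] lin; simp)
  also have "\<dots> = sw y z ?P (\<lambda>l1 k. sw y z ?P (\<lambda>l2 b. ?g (mul z y z (S y z l1) l2) b) k) l"
    by (rule sw_coassoc; (intro lin)?; simp)
  also have "\<dots> = sw y z ?P (\<lambda>l1 k. eps y z k \<odot>\<^bsub>?P\<^esub> mul z y x (S y z l1) (S x y h)) l"
  proof (rule sw_cong; simp?)
    fix l1 k assume lk [simp]: "l1 \<in> carrier (C y z)" "k \<in> carrier (C y z)"
    have "sw y z ?P (\<lambda>l2 b. ?g (mul z y z (S y z l1) l2) b) k =
        sw y z ?P (\<lambda>l2 b. mul z y x (S y z l1) (mul y z x l2 (S x z (mul x y z h b)))) k"
      by (intro sw_cong; simp add: cat_assoc mul_closed antipode_closed)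
    also have "\<dots> = mul z y x (S y z l1) (sw y z (C y x) (\<lambda>l2 b. mul y z x l2 (S x z (mul x y z h b))) k)"
      by (rule sw_commute[symmetric]; (intro lin)?; simp)
    also have "\<dots> = eps y z k \<odot>\<^bsub>?P\<^esub> mul z y x (S y z l1) (S x y h)"
      by (simp add: antipode_mul_aux linear_maps_smult[OF bilinear_maps_right[OF mul_bilinear]]
          antipode_closed counit_closed)
    finally show "sw y z ?P (\<lambda>l2 b. ?g (mul z y z (S y z l1) l2) b) k = \<dots>" .
  qed
  also have "\<dots> = mul z y x (S y z l) (S x y h)"
    by (rule sw_counit_right; (intro lin)?; simp)
  finally show ?thesis .
qed

text \<open>Take the coproduct of \<epsilon>(h_2) 1_x = h_2 S(h_3), multiply its left leg by S(h_1)
  and cancel S(h_1) h_2. As 1_x is group-like, what remains is S(h) \<otimes> 1_x = S(h_2)_1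
  \<otimes> h_1 S(h_2)_2.\<close>

lemma sw_antipode_aux:
  assumes xy: "x \<in> Obj A" "y \<in> Obj A" and P: "module R P" and h: "h \<in> carrier (C x y)"
    and F: "F \<in> bilinear_maps R (C y x) (C x x) P"
  shows "sw x y P (\<lambda>k b. sw y x P (\<lambda>u v. F u (mul x y x k v)) (S x y b)) h = F (S x y h) (ident A x)"
proof -
  note [simp] = xy h P ident_closed[OF xy(1)] ident_closed[OF xy(2)]
  note lin = lin bilinear_maps_compose_left[OF F] bilinear_maps_compose_right[OF F]
    bilinear_maps_closed[OF F]
  let ?f = "\<lambda>w a b. sw y x P (\<lambda>u v. F (mul y y x w u) (mul x y x a v)) (S x y b)"
  have "F (S x y h) (ident A x) = sw x y P (\<lambda>h1 h2. eps x y h2 \<odot>\<^bsub>P\<^esub> F (S x y h1) (ident A x)) h"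
    by (rule sw_counit_right[symmetric]; (intro lin)?; simp)
  also have "\<dots> = sw x y P (\<lambda>h1 h2. sw x y P (\<lambda>a b. sw x y P (\<lambda>a1 a2. ?f (mul y x y (S x y h1) a1) a2 b) a) h2) h"
  proof (rule sw_cong; simp?)
    fix h1 h2 assume h12 [simp]: "h1 \<in> carrier (C x y)" "h2 \<in> carrier (C x y)"
    let ?G = "\<lambda>s t. F (mul y x x (S x y h1) s) t"
    have G: "?G \<in> bilinear_maps R (C x x) (C x x) P"
      by (intro lin; simp)
    have "eps x y h2 \<odot>\<^bsub>P\<^esub> F (S x y h1) (ident A x) = eps x y h2 \<odot>\<^bsub>P\<^esub> sw x x P ?G (ident A x)"
      by (simp add: sw_ident[OF _ P G] ident_right antipode_closed)
    also have "\<dots> = sw x y P (\<lambda>a b. sw x x P ?G (mul x y x a (S x y b))) h2"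
      by (rule sw_antipode_right[symmetric]; (intro lin)?; simp)
    also have "\<dots> = sw x y P (\<lambda>a b. sw x y P (\<lambda>a1 a2. sw y x P (\<lambda>u v. ?G (mul x y x a1 u) (mul x y x a2 v)) (S x y b)) a) h2"
      by (intro sw_cong sw_mul G lin; simp)
    also have "\<dots> = sw x y P (\<lambda>a b. sw x y P (\<lambda>a1 a2. ?f (mul y x y (S x y h1) a1) a2 b) a) h2"
      by (intro sw_cong; simp add: cat_assoc mul_closed antipode_closed)
    finally show "eps x y h2 \<odot>\<^bsub>P\<^esub> F (S x y h1) (ident A x) = \<dots>" .
  qed
  also have "\<dots> = sw x y P (\<lambda>k b. sw x y P (\<lambda>h1 a. sw x y P (\<lambda>a1 a2. ?f (mul y x y (S x y h1) a1) a2 b) a) k) h"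
    by (rule sw_coassoc[symmetric]; (intro lin)?; simp)
  \<comment> \<open>A second regrouping, inside the outer sum, makes h1 and a1 the two legs of one
    coproduct, where S(h1) a1 cancels.\<close>
  also have "\<dots> = sw x y P (\<lambda>k b. sw x y P (\<lambda>m a2. sw x y P (\<lambda>h1 a1. ?f (mul y x y (S x y h1) a1) a2 b) m) k) h"
    by (intro sw_cong sw_coassoc[symmetric] lin; simp)
  also have "\<dots> = sw x y P (\<lambda>k b. sw x y P (\<lambda>m a2. eps x y m \<odot>\<^bsub>P\<^esub> ?f (ident A y) a2 b) k) h"
    by (intro sw_cong sw_antipode_left lin; simp)
  also have "\<dots> = sw x y P (\<lambda>k b. ?f (ident A y) k b) h"
    by (intro sw_cong sw_counit_left lin; simp)
  also have "\<dots> = sw x y P (\<lambda>k b. sw y x P (\<lambda>u v. F u (mul x y x k v)) (S x y b)) h"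
    by (intro sw_cong; simp add: ident_left antipode_closed)
  finally show ?thesis by simp
qed

text \<open>Insert S(h_1) h_2 before the right leg of the coproduct of S(h_3). The auxiliary
  identity, applied to h_2 and h_3, replaces S(h_3)_1 \<otimes> h_2 S(h_3)_2 by S(h_2) \<otimes>
  1_x, which leaves S(h_2) \<otimes> S(h_1).\<close>

lemma sw_antipode:
  assumes xy: "x \<in> Obj A" "y \<in> Obj A" and P: "module R P" and h: "h \<in> carrier (C x y)"
    and F: "F \<in> bilinear_maps R (C y x) (C y x) P"
  shows "sw y x P F (S x y h) = sw x y P (\<lambda>a b. F (S x y b) (S x y a)) h"
proof -
  note [simp] = xy h P ident_closed[OF xy(1)] ident_closed[OF xy(2)]
  note lin = lin bilinear_maps_compose_left[OF F] bilinear_maps_compose_right[OF F]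
    bilinear_maps_closed[OF F]
  let ?f = "\<lambda>w b. sw y x P (\<lambda>u v. F u (mul y y x w v)) (S x y b)"
  have "sw y x P F (S x y h) = ?f (ident A y) h"
    by (intro sw_cong; simp add: ident_left antipode_closed)
  also have "\<dots> = sw x y P (\<lambda>k b. eps x y k \<odot>\<^bsub>P\<^esub> ?f (ident A y) b) h"
    by (rule sw_counit_left[symmetric]; (intro lin)?; simp)
  also have "\<dots> = sw x y P (\<lambda>k b. sw x y P (\<lambda>h1 h2. ?f (mul y x y (S x y h1) h2) b) k) h"
    by (intro sw_cong sw_antipode_left[symmetric] lin; simp)
  also have "\<dots> = sw x y P (\<lambda>h1 k. sw x y P (\<lambda>h2 b. ?f (mul y x y (S x y h1) h2) b) k) h"
    by (rule sw_coassoc; (intro lin)?; simp)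
  also have "\<dots> = sw x y P (\<lambda>h1 k. F (S x y k) (S x y h1)) h"
  proof (rule sw_cong; simp?)
    fix h1 k assume hk [simp]: "h1 \<in> carrier (C x y)" "k \<in> carrier (C x y)"
    let ?G = "\<lambda>u v. F u (mul y x x (S x y h1) v)"
    have G: "?G \<in> bilinear_maps R (C y x) (C x x) P"
      by (intro lin; simp)
    have "sw x y P (\<lambda>h2 b. ?f (mul y x y (S x y h1) h2) b) k =
        sw x y P (\<lambda>h2 b. sw y x P (\<lambda>u v. ?G u (mul x y x h2 v)) (S x y b)) k"
      by (intro sw_cong; simp add: cat_assoc mul_closed antipode_closed)
    also have "\<dots> = ?G (S x y k) (ident A x)"
      by (rule sw_antipode_aux[OF _ _ P _ G]; simp)
    finally show "sw x y P (\<lambda>h2 b. ?f (mul y x y (S x y h1) h2) b) k = F (S x y k) (S x y h1)"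
      by (simp add: ident_right antipode_closed)
  qed
  finally show ?thesis .
qed

subsection \<open>The action on the dual\<close>

abbreviation "D x y \<equiv> dual R (Mor A x y)"

lemma D_module: "\<lbrakk>x \<in> Obj A; y \<in> Obj A\<rbrakk> \<Longrightarrow> module R (D x y)"
  by (intro dual_module Mor_module)

text \<open>\<open>harpoon R A x y\<close> is \<open>act x x y\<close>. The free middle index lets
  S(c) in A_{y,x} carry a functional on A_{x,y} back to one on A_{x,x}, as the projection onto the
  integrals requires.\<close>

definition act :: "'c \<Rightarrow> 'c \<Rightarrow> 'c \<Rightarrow> ('d \<Rightarrow> 'a) \<Rightarrow> 'd \<Rightarrow> 'd \<Rightarrow> 'a"
  where "act x y z \<psi> a = (\<lambda>b\<in>carrier (C x z). \<psi> (mul x z y b (S y z a)))"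

lemma act_apply: "b \<in> carrier (C x z) \<Longrightarrow> act x y z \<psi> a b = \<psi> (mul x z y b (S y z a))"
  by (simp add: act_def)

lemma act_closed:
  assumes "\<psi> \<in> carrier (D x y)" "a \<in> carrier (C y z)" and xyz: "x \<in> Obj A" "y \<in> Obj A" "z \<in> Obj A"
  shows "act x y z \<psi> a \<in> carrier (D x z)"
  unfolding act_def
  by (intro dual_restrictI linear_maps_compose[OF dual_linear[OF assms(1)]] lin assms)

lemma act_bilinear:
  assumes xyz: "x \<in> Obj A" "y \<in> Obj A" "z \<in> Obj A"
  shows "act x y z \<in> bilinear_maps R (D x y) (C y z) (D x z)"
proof (rule bilinear_mapsI)
  fix \<psi> assume \<psi>: "\<psi> \<in> carrier (D x y)"
  show "act x y z \<psi> \<in> linear_maps R (C y z) (D x z)"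
    by (rule linear_maps_into_dual; (simp add: act_apply)?;
        intro act_closed linear_maps_compose[OF dual_linear[OF \<psi>]] lin xyz \<psi>)
next
  fix a assume a: "a \<in> carrier (C y z)"
  show "(\<lambda>\<psi>. act x y z \<psi> a) \<in> linear_maps R (D x y) (D x z)"
    by (rule linear_maps_into_dual; (simp add: act_apply)?;
        intro act_closed dual_eval_linear D_module lin xyz a)
qed

lemma lin_act_left:
  "\<lbrakk>g \<in> linear_maps R M (D x y); a \<in> carrier (C y z); x \<in> Obj A; y \<in> Obj A; z \<in> Obj A\<rbrakk> \<Longrightarrow>
    (\<lambda>u. act x y z (g u) a) \<in> linear_maps R M (D x z)"
  by (rule bilinear_maps_compose_left[OF act_bilinear])

lemma lin_act_right:
  "\<lbrakk>g \<in> linear_maps R M (C y z); \<psi> \<in> carrier (D x y); x \<in> Obj A; y \<in> Obj A; z \<in> Obj A\<rbrakk> \<Longrightarrow>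
    (\<lambda>u. act x y z \<psi> (g u)) \<in> linear_maps R M (D x z)"
  by (rule bilinear_maps_compose_right[OF act_bilinear])

lemma lin_act_left_eval:
  "\<lbrakk>g \<in> linear_maps R M (D x y); a \<in> carrier (C y z); h \<in> carrier (C x z); x \<in> Obj A; y \<in> Obj A; z \<in> Obj A\<rbrakk> \<Longrightarrow>
    (\<lambda>u. act x y z (g u) a h) \<in> linear_maps R M K"
  by (rule linear_maps_compose[OF dual_eval_linear[OF Mor_module] lin_act_left])

lemma lin_act_right_eval:
  "\<lbrakk>g \<in> linear_maps R M (C y z); \<psi> \<in> carrier (D x y); h \<in> carrier (C x z); x \<in> Obj A; y \<in> Obj A; z \<in> Obj A\<rbrakk> \<Longrightarrow>
    (\<lambda>u. act x y z \<psi> (g u) h) \<in> linear_maps R M K"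
  by (rule linear_maps_compose[OF dual_eval_linear[OF Mor_module] lin_act_right])

lemma act_eval_closed:
  "\<lbrakk>\<psi> \<in> carrier (D x y); a \<in> carrier (C y z); h \<in> carrier (C x z); x \<in> Obj A; y \<in> Obj A; z \<in> Obj A\<rbrakk> \<Longrightarrow>
    act x y z \<psi> a h \<in> carrier R"
  by (rule dual_closed[OF act_closed])

text \<open>At c both sides are \<psi>(c S(b) S(a)): the order of the factors is restored because S
  reverses products.\<close>

lemma act_act:
  assumes xyz: "x \<in> Obj A" "y \<in> Obj A" "z \<in> Obj A" "w \<in> Obj A"
    and \<psi>: "\<psi> \<in> carrier (D x y)" and a: "a \<in> carrier (C y z)" and b: "b \<in> carrier (C z w)"
  shows "act x z w (act x y z \<psi> a) b = act x y w \<psi> (mul y z w a b)"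
  by (rule dual_eqI[of _ R "C x w"])
    (use assms in \<open>simp_all add: act_closed act_apply mul_closed antipode_closed antipode_mul cat_assoc\<close>)

lemma act_ident:
  assumes xy: "x \<in> Obj A" "y \<in> Obj A" and \<psi>: "\<psi> \<in> carrier (D x y)"
  shows "act x y y \<psi> (ident A y) = \<psi>"
  by (rule dual_eqI[of _ R "C x y"])
    (use assms in \<open>simp_all add: act_closed act_apply antipode_ident ident_right ident_closed\<close>)


subsection \<open>The coaction on the dual\<close>

text \<open>\<open>coact x y \<psi>\<close> is the element of \<open>A\<^sub>x\<^sub>,\<^sub>y\<^sup>* \<otimes> A\<^sub>x\<^sub>,\<^sub>y\<close> that corresponds to the map
  \<open>h \<mapsto> \<langle>\<psi>, h\<^sub>(\<^sub>2\<^sub>)\<rangle> h\<^sub>(\<^sub>1\<^sub>)\<close>.\<close>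

definition coact :: "'c \<Rightarrow> 'c \<Rightarrow> ('d \<Rightarrow> 'a) \<Rightarrow> (('d \<Rightarrow> 'a) \<times> 'd \<Rightarrow> 'a) set"
  where "coact x y \<psi> = (SOME t. t \<in> carrier (tensor R (D x y) (C x y)) \<and>
    (\<forall>h\<in>carrier (C x y). tensor_lift R (C x y) (\<lambda>m c. m h \<odot>\<^bsub>C x y\<^esub> c) t =
      sw x y (C x y) (\<lambda>a b. \<psi> b \<odot>\<^bsub>C x y\<^esub> a) h))"

lemma coact_bilinear:
  assumes xy: "x \<in> Obj A" "y \<in> Obj A" and \<psi>: "\<psi> \<in> carrier (D x y)" and P: "module R P"
    and g: "g \<in> linear_maps R (C x y) P"
  shows "(\<lambda>a b. \<psi> b \<odot>\<^bsub>P\<^esub> g a) \<in> bilinear_maps R (C x y) (C x y) P"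
  by (rule bilinear_mapsI)
    (use assms in \<open>auto intro!: linear_maps_smult_left linear_maps_smult_right
        simp: dual_linear dual_closed linear_maps_closed[OF g]\<close>)

lemma
  assumes xy: "x \<in> Obj A" "y \<in> Obj A" and \<psi>: "\<psi> \<in> carrier (D x y)"
  shows coact_closed: "coact x y \<psi> \<in> carrier (tensor R (D x y) (C x y))"
    and coact_eval: "h \<in> carrier (C x y) \<Longrightarrow>
      tensor_lift R (C x y) (\<lambda>m c. m h \<odot>\<^bsub>C x y\<^esub> c) (coact x y \<psi>) =
      sw x y (C x y) (\<lambda>a b. \<psi> b \<odot>\<^bsub>C x y\<^esub> a) h"
proof -
  note M = Mor_module[OF xy]
  have "sw x y (C x y) (\<lambda>a b. \<psi> b \<odot>\<^bsub>C x y\<^esub> a) \<in> linear_maps R (C x y) (C x y)"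
    by (intro coalgebra.sweedler_linear[OF Mor_coalgebra] xy M coact_bilinear \<psi> linear_maps_ident)
  from dual_tensor_exists[OF M Mor_finitely_generated[OF xy] Mor_projective[OF xy] M this]
  have "\<exists>t. t \<in> carrier (tensor R (D x y) (C x y)) \<and>
    (\<forall>h\<in>carrier (C x y). tensor_lift R (C x y) (\<lambda>m c. m h \<odot>\<^bsub>C x y\<^esub> c) t =
      sw x y (C x y) (\<lambda>a b. \<psi> b \<odot>\<^bsub>C x y\<^esub> a) h)"
    by blast
  from someI_ex[OF this]
  show "coact x y \<psi> \<in> carrier (tensor R (D x y) (C x y))"
    and "h \<in> carrier (C x y) \<Longrightarrow>
      tensor_lift R (C x y) (\<lambda>m c. m h \<odot>\<^bsub>C x y\<^esub> c) (coact x y \<psi>) =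
      sw x y (C x y) (\<lambda>a b. \<psi> b \<odot>\<^bsub>C x y\<^esub> a) h"
    unfolding coact_def by blast+
qed

lemmas dual_eqI_tensor =
  dual_tensor_eqI[OF Mor_module Mor_finitely_generated Mor_projective]

text \<open>\<open>coact\<close> chooses a tensor for each functional, but this tensor is determined
  by its values at all h, and these depend linearly on \<psi>.\<close>

lemma coact_linear:
  assumes xy: "x \<in> Obj A" "y \<in> Obj A"
  shows "coact x y \<in> linear_maps R (D x y) (tensor R (D x y) (C x y))"
proof -
  let ?T = "tensor R (D x y) (C x y)"
  note M = Mor_module[OF xy] and DM = D_module[OF xy]
  interpret DM: module R "D x y" by (rule DM)
  interpret T: module R ?T by (intro tensor_module M DM)
  have e: "tensor_lift R (C x y) (\<lambda>m c. m h \<odot>\<^bsub>C x y\<^esub> c) \<in> linear_maps R ?T (C x y)"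
    if "h \<in> carrier (C x y)" for h
    by (intro tensor_lift_linear M DM dual_eval_bilinear that)
  have s: "(\<lambda>\<psi>. sw x y (C x y) (\<lambda>a b. \<psi> b \<odot>\<^bsub>C x y\<^esub> a) h) \<in> linear_maps R (D x y) (C x y)"
    if "h \<in> carrier (C x y)" for h
    using that by (intro lin_sw_param linear_maps_smult_left dual_eval_linear coact_bilinear linear_maps_ident M DM xy)
  note cl = coact_closed[OF xy]
  show ?thesis
  proof (rule linear_mapsI[OF cl])
    fix \<psi> \<psi>' assume *: "\<psi> \<in> carrier (D x y)" "\<psi>' \<in> carrier (D x y)"
    show "coact x y (\<psi> \<oplus>\<^bsub>D x y\<^esub> \<psi>') = coact x y \<psi> \<oplus>\<^bsub>?T\<^esub> coact x y \<psi>'"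
      by (rule dual_eqI_tensor[OF xy xy xy M])
        (use * in \<open>simp_all add: cl coact_eval xy linear_maps_add[OF s] linear_maps_add[OF e] del: dual_simps\<close>)
  next
    fix r \<psi> assume *: "r \<in> carrier R" "\<psi> \<in> carrier (D x y)"
    show "coact x y (r \<odot>\<^bsub>D x y\<^esub> \<psi>) = r \<odot>\<^bsub>?T\<^esub> coact x y \<psi>"
      by (rule dual_eqI_tensor[OF xy xy xy M])
        (use * in \<open>simp_all add: cl coact_eval xy linear_maps_smult[OF s] linear_maps_smult[OF e] del: dual_simps\<close>)
  qed
qed

text \<open>Obtained by applying g to \<open>coact_eval\<close>. Written \<psi>_0(h) g(\<psi>_1) =
  \<psi>(h_2) g(h_1), it is the bridge from sums over the coaction to sums over the
  coproduct.\<close>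

lemma coact_eval_linear:
  assumes xy: "x \<in> Obj A" "y \<in> Obj A" and P: "module R P" and \<psi>: "\<psi> \<in> carrier (D x y)"
    and h: "h \<in> carrier (C x y)" and g: "g \<in> linear_maps R (C x y) P"
  shows "tensor_lift R P (\<lambda>m c. m h \<odot>\<^bsub>P\<^esub> g c) (coact x y \<psi>) = sw x y P (\<lambda>a b. \<psi> b \<odot>\<^bsub>P\<^esub> g a) h"
proof -
  note M = Mor_module[OF xy] and DM = D_module[OF xy] and cl = coact_closed[OF xy \<psi>]
  have "tensor_lift R P (\<lambda>m c. m h \<odot>\<^bsub>P\<^esub> g c) (coact x y \<psi>) =
      tensor_lift R P (\<lambda>m c. g (m h \<odot>\<^bsub>C x y\<^esub> c)) (coact x y \<psi>)"
    by (intro tensor_lift_cong[OF DM M cl]) (simp add: linear_maps_smult[OF g] dual_closed[OF _ h])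
  also have "\<dots> = g (tensor_lift R (C x y) (\<lambda>m c. m h \<odot>\<^bsub>C x y\<^esub> c) (coact x y \<psi>))"
    by (intro bilinear_tensor_lift_commute[symmetric, OF DM M M P _ g cl] dual_eval_bilinear M h)
  also have "\<dots> = g (sw x y (C x y) (\<lambda>a b. \<psi> b \<odot>\<^bsub>C x y\<^esub> a) h)"
    by (simp add: coact_eval xy \<psi> h)
  also have "\<dots> = sw x y P (\<lambda>a b. g (\<psi> b \<odot>\<^bsub>C x y\<^esub> a)) h"
    by (intro sw_commute xy M P h g coact_bilinear \<psi> linear_maps_ident)
  also have "\<dots> = sw x y P (\<lambda>a b. \<psi> b \<odot>\<^bsub>P\<^esub> g a) h"
    by (intro sw_cong xy h) (simp add: linear_maps_smult[OF g] dual_closed[OF \<psi>])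
  finally show ?thesis .
qed

text \<open>Sweedler notation for the coaction, standing for f \<psi>_0 \<psi>_1; its rules parallel
  those for \<open>sweedler\<close>.\<close>

abbreviation "rs x y P f \<psi> \<equiv> tensor_lift R P f (coact x y \<psi>)"

lemma lin_coact:
  "\<lbrakk>g \<in> linear_maps R M (D x y); x \<in> Obj A; y \<in> Obj A\<rbrakk> \<Longrightarrow>
    (\<lambda>u. coact x y (g u)) \<in> linear_maps R M (tensor R (D x y) (C x y))"
  by (rule linear_maps_compose[OF coact_linear])

lemma lin_rs:
  "\<lbrakk>g \<in> linear_maps R M (D x y); f \<in> bilinear_maps R (D x y) (C x y) P; module R P; x \<in> Obj A; y \<in> Obj A\<rbrakk> \<Longrightarrow>
    (\<lambda>u. rs x y P f (g u)) \<in> linear_maps R M P"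
  by (rule linear_maps_compose[OF tensor_lift_linear lin_coact]) (auto intro: D_module Mor_module)

lemma lin_rs_param:
  "\<lbrakk>\<And>a b. \<lbrakk>a \<in> carrier (D x y); b \<in> carrier (C x y)\<rbrakk> \<Longrightarrow> (\<lambda>u. F u a b) \<in> linear_maps R M P;
    \<And>u. u \<in> carrier M \<Longrightarrow> F u \<in> bilinear_maps R (D x y) (C x y) P;
    \<psi> \<in> carrier (D x y); module R M; module R P; x \<in> Obj A; y \<in> Obj A\<rbrakk> \<Longrightarrow>
    (\<lambda>u. rs x y P (F u) \<psi>) \<in> linear_maps R M P"
  by (rule tensor_lift_linear_param[of R "D x y" "C x y"]) (auto intro: D_module Mor_module coact_closed)

lemma rs_closed:
  "\<lbrakk>\<psi> \<in> carrier (D x y); f \<in> bilinear_maps R (D x y) (C x y) P; module R P; x \<in> Obj A; y \<in> Obj A\<rbrakk> \<Longrightarrow>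
    rs x y P f \<psi> \<in> carrier P"
  by (rule linear_maps_closed[OF tensor_lift_linear[OF D_module Mor_module _ ] coact_closed])

lemma rs_cong:
  assumes "x \<in> Obj A" "y \<in> Obj A" "\<psi> \<in> carrier (D x y)"
    "\<And>m c. \<lbrakk>m \<in> carrier (D x y); c \<in> carrier (C x y)\<rbrakk> \<Longrightarrow> f m c = g m c"
  shows "rs x y P f \<psi> = rs x y P g \<psi>"
  by (rule tensor_lift_cong[OF D_module Mor_module coact_closed]) (use assms in auto)

lemma rs_commute:
  assumes "x \<in> Obj A" "y \<in> Obj A" "\<psi> \<in> carrier (D x y)" "module R P" "module R Q"
    "f \<in> bilinear_maps R (D x y) (C x y) P" "g \<in> linear_maps R P Q"
  shows "g (rs x y P f \<psi>) = rs x y Q (\<lambda>m c. g (f m c)) \<psi>"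
  by (rule bilinear_tensor_lift_commute[OF D_module Mor_module _ _ _ _ coact_closed]) (use assms in auto)

lemma rs_sw_swap:
  assumes "x \<in> Obj A" "y \<in> Obj A" "x' \<in> Obj A" "y' \<in> Obj A" "module R P"
    "\<psi> \<in> carrier (D x y)" "h \<in> carrier (C x' y')"
    "\<And>m c. \<lbrakk>m \<in> carrier (D x y); c \<in> carrier (C x y)\<rbrakk> \<Longrightarrow>
      F m c \<in> bilinear_maps R (C x' y') (C x' y') P"
    "\<And>a b. \<lbrakk>a \<in> carrier (C x' y'); b \<in> carrier (C x' y')\<rbrakk> \<Longrightarrow>
      (\<lambda>m c. F m c a b) \<in> bilinear_maps R (D x y) (C x y) P"
  shows "rs x y P (\<lambda>m c. sw x' y' P (F m c) h) \<psi> = sw x' y' P (\<lambda>a b. rs x y P (\<lambda>m c. F m c a b) \<psi>) h"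
  unfolding sweedler_def
  by (rule tensor_lift_swap[of R "D x y" "C x y" "C x' y'" "C x' y'"])
    (use assms in \<open>simp_all add: Mor_module D_module coact_closed coalgebra.comult_closed[OF Mor_coalgebra]\<close>)

text \<open>The counterpart of \<open>lin\<close> for functionals. Evaluated actions such as
  \<open>act x y z \<psi> a h\<close> have rules of their own, with values in k.\<close>

lemmas lin_dual = lin_act_left lin_act_right lin_act_left_eval lin_act_right_eval act_closed
  act_eval_closed lin_coact coact_closed lin_rs lin_rs_param rs_closed D_module
  dual_eval_linear[OF Mor_module]

text \<open>In the universal case, with values in \<open>D x y\<close> \<otimes> (C \<otimes> C),
  evaluation at h turns both sides into \<psi>(h_3) h_1 \<otimes> h_2, so coassociativity of the
  coproduct decides. The linear map \<open>?W\<close> induced by G transports the universal equation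
  to P.\<close>

lemma coact_coassoc:
  assumes xy: "x \<in> Obj A" "y \<in> Obj A" and P: "module R P" and \<psi>: "\<psi> \<in> carrier (D x y)"
    and 1: "\<And>m a. \<lbrakk>m \<in> carrier (D x y); a \<in> carrier (C x y)\<rbrakk> \<Longrightarrow> (\<lambda>b. G m a b) \<in> linear_maps R (C x y) P"
    and 2: "\<And>m b. \<lbrakk>m \<in> carrier (D x y); b \<in> carrier (C x y)\<rbrakk> \<Longrightarrow> (\<lambda>a. G m a b) \<in> linear_maps R (C x y) P"
    and 3: "\<And>a b. \<lbrakk>a \<in> carrier (C x y); b \<in> carrier (C x y)\<rbrakk> \<Longrightarrow> (\<lambda>m. G m a b) \<in> linear_maps R (D x y) P"
  shows "rs x y P (\<lambda>m b. rs x y P (\<lambda>n a. G n a b) m) \<psi> = rs x y P (\<lambda>m c. sw x y P (\<lambda>a b. G m a b) c) \<psi>"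
proof -
  note [simp] = xy P \<psi> 
  note M = Mor_module[OF xy] and DM = D_module[OF xy]
  let ?Q = "tensor R (C x y) (C x y)"
  let ?T = "tensor R (D x y) ?Q"
  note Q = tensor_module[OF M M]
  note T = tensor_module[OF DM Q]
  interpret Q: module R ?Q by (rule Q)
  have com: "comult (C x y) \<in> linear_maps R (C x y) ?Q"
    by (rule coalgebra.comult_linear[OF Mor_coalgebra]; simp)
  have comc: "comult (C x y) c \<in> carrier ?Q" if "c \<in> carrier (C x y)" for c
    by (rule linear_maps_closed[OF com that])
  let ?G = "\<lambda>n a b. pure_tensor R (D x y) ?Q n (pure_tensor R (C x y) (C x y) a b)"
  let ?X = "rs x y ?T (\<lambda>m b. rs x y ?T (\<lambda>n a. ?G n a b) m) \<psi>"
  let ?Y = "rs x y ?T (\<lambda>m c. pure_tensor R (D x y) ?Q m (comult (C x y) c)) \<psi>"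
  have bX: "(\<lambda>m b. rs x y ?T (\<lambda>n a. ?G n a b) m) \<in> bilinear_maps R (D x y) (C x y) ?T"
    by (intro lin lin_dual; simp)
  have bX': "(\<lambda>n a. ?G n a b) \<in> bilinear_maps R (D x y) (C x y) ?T" if "b \<in> carrier (C x y)" for b
    using that by (intro lin lin_dual; simp)
  have bY: "(\<lambda>m c. pure_tensor R (D x y) ?Q m (comult (C x y) c)) \<in> bilinear_maps R (D x y) (C x y) ?T"
    by (intro lin lin_dual com comc; simp)
  have "?X = ?Y"
  proof (rule dual_eqI_tensor[OF xy xy xy Q])
    show "?X \<in> carrier ?T" by (rule rs_closed[OF _ bX T]; simp)
    show "?Y \<in> carrier ?T" by (rule rs_closed[OF _ bY T]; simp)
    fix h assume h [simp]: "h \<in> carrier (C x y)"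
    let ?e = "tensor_lift R ?Q (\<lambda>m q. m h \<odot>\<^bsub>?Q\<^esub> q)"
    note be = dual_eval_bilinear[OF M Q h]
    have e: "?e \<in> linear_maps R ?T ?Q"
      by (rule tensor_lift_linear[OF DM Q Q be])
    have ep: "?e (pure_tensor R (D x y) ?Q m q) = m h \<odot>\<^bsub>?Q\<^esub> q"
      if "m \<in> carrier (D x y)" "q \<in> carrier ?Q" for m q
      using tensor_lift_pure[OF DM Q Q be that] .
    have pc: "pure_tensor R (C x y) (C x y) a b \<in> carrier ?Q" if "a \<in> carrier (C x y)" "b \<in> carrier (C x y)" for a b
      using that xy by (intro lin)
    have "?e ?X = rs x y ?Q (\<lambda>m b. ?e (rs x y ?T (\<lambda>n a. ?G n a b) m)) \<psi>"
      by (rule rs_commute[OF _ _ _ T Q bX e]; simp)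
    also have "\<dots> = rs x y ?Q (\<lambda>m b. rs x y ?Q (\<lambda>n a. ?e (?G n a b)) m) \<psi>"
      by (intro rs_cong rs_commute[OF _ _ _ T Q bX' e]; simp)
    also have "\<dots> = rs x y ?Q (\<lambda>m b. rs x y ?Q (\<lambda>n a. n h \<odot>\<^bsub>?Q\<^esub> pure_tensor R (C x y) (C x y) a b) m) \<psi>"
      by (intro rs_cong ep pc; simp)
    also have "\<dots> = rs x y ?Q (\<lambda>m b. sw x y ?Q (\<lambda>c d. m d \<odot>\<^bsub>?Q\<^esub> pure_tensor R (C x y) (C x y) c b) h) \<psi>"
      by (intro rs_cong coact_eval_linear Q lin; simp)
    also have "\<dots> = sw x y ?Q (\<lambda>c d. rs x y ?Q (\<lambda>m b. m d \<odot>\<^bsub>?Q\<^esub> pure_tensor R (C x y) (C x y) c b) \<psi>) h"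
      by (intro rs_sw_swap Q lin lin_dual; (simp add: dual_linear)?; erule dual_closed; simp)
    also have "\<dots> = sw x y ?Q (\<lambda>c d. sw x y ?Q (\<lambda>a b. \<psi> b \<odot>\<^bsub>?Q\<^esub> pure_tensor R (C x y) (C x y) c a) d) h"
      by (intro sw_cong coact_eval_linear Q lin; simp)
    also have "\<dots> = sw x y ?Q (\<lambda>d b. sw x y ?Q (\<lambda>c a. \<psi> b \<odot>\<^bsub>?Q\<^esub> pure_tensor R (C x y) (C x y) c a) d) h"
      by (intro sw_coassoc[symmetric] Q lin; simp add: dual_linear dual_closed[OF \<psi>])
    also have "\<dots> = sw x y ?Q (\<lambda>d b. \<psi> b \<odot>\<^bsub>?Q\<^esub> comult (C x y) d) h"
    proof (rule sw_cong; simp?)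
      fix d b assume db [simp]: "d \<in> carrier (C x y)" "b \<in> carrier (C x y)"
      have "sw x y ?Q (\<lambda>c a. \<psi> b \<odot>\<^bsub>?Q\<^esub> pure_tensor R (C x y) (C x y) c a) d =
          \<psi> b \<odot>\<^bsub>?Q\<^esub> sw x y ?Q (pure_tensor R (C x y) (C x y)) d"
        by (intro sw_commute[symmetric] pure_tensor_bilinear M Q lin; simp add: dual_closed[OF \<psi>])
      then show "sw x y ?Q (\<lambda>c a. \<psi> b \<odot>\<^bsub>?Q\<^esub> pure_tensor R (C x y) (C x y) c a) d =
          \<psi> b \<odot>\<^bsub>?Q\<^esub> comult (C x y) d"
        by (simp add: sweedler_def tensor_lift_ident[OF M M] comc)
    qed
    also have "\<dots> = rs x y ?Q (\<lambda>m c. m h \<odot>\<^bsub>?Q\<^esub> comult (C x y) c) \<psi>"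
      by (rule coact_eval_linear[symmetric, OF _ _ Q _ _ com]; simp)
    also have "\<dots> = rs x y ?Q (\<lambda>m c. ?e (pure_tensor R (D x y) ?Q m (comult (C x y) c))) \<psi>"
      by (intro rs_cong ep[symmetric] comc; simp)
    also have "\<dots> = ?e ?Y"
      by (rule rs_commute[symmetric, OF _ _ _ T Q bY e]; simp)
    finally show "?e ?X = ?e ?Y" .
  qed
  have bG: "G m \<in> bilinear_maps R (C x y) (C x y) P" if "m \<in> carrier (D x y)" for m
    using that 1 2 by (intro bilinear_mapsI)
  let ?w = "\<lambda>m q. tensor_lift R P (G m) q"
  have w: "?w \<in> bilinear_maps R (D x y) ?Q P"
    by (rule bilinear_mapsI[OF tensor_lift_linear[OF M M P bG] tensor_lift_linear_param[OF M M P 3 bG _ DM]])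
  let ?W = "tensor_lift R P ?w"
  have W: "?W \<in> linear_maps R ?T P"
    by (rule tensor_lift_linear[OF DM Q P w])
  have Wp: "?W (pure_tensor R (D x y) ?Q m q) = ?w m q" if "m \<in> carrier (D x y)" "q \<in> carrier ?Q" for m q
    by (rule tensor_lift_pure[OF DM Q P w that])
  have "rs x y P (\<lambda>m b. rs x y P (\<lambda>n a. G n a b) m) \<psi> = rs x y P (\<lambda>m b. rs x y P (\<lambda>n a. ?W (?G n a b)) m) \<psi>"
    by (intro rs_cong; simp add: Wp pure_closed M tensor_lift_pure[OF M M P bG])
  also have "\<dots> = rs x y P (\<lambda>m b. ?W (rs x y ?T (\<lambda>n a. ?G n a b) m)) \<psi>"
    by (intro rs_cong rs_commute[symmetric, OF _ _ _ T P bX' W]; simp)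
  also have "\<dots> = ?W ?X"
    by (rule rs_commute[symmetric, OF _ _ _ T P bX W]; simp)
  also have "\<dots> = ?W ?Y"
    using \<open>?X = ?Y\<close> by simp
  also have "\<dots> = rs x y P (\<lambda>m c. ?W (pure_tensor R (D x y) ?Q m (comult (C x y) c))) \<psi>"
    by (rule rs_commute[OF _ _ _ T P bY W]; simp)
  also have "\<dots> = rs x y P (\<lambda>m c. sw x y P (\<lambda>a b. G m a b) c) \<psi>"
    by (intro rs_cong; simp add: Wp comc sweedler_def)
  finally show ?thesis .
qed

text \<open>At h the left side is \<psi>_0(h) \<epsilon>(\<psi>_1) = \<psi>(h_2) \<epsilon>(h_1),
  which is \<psi>(h) by the counit axiom.\<close>

lemma coact_counit:
  assumes xy: "x \<in> Obj A" "y \<in> Obj A" and \<psi>: "\<psi> \<in> carrier (D x y)"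
  shows "rs x y (D x y) (\<lambda>m c. eps x y c \<odot>\<^bsub>D x y\<^esub> m) \<psi> = \<psi>"
proof -
  note [simp] = xy \<psi>
  note M = Mor_module[OF xy] and DM = D_module[OF xy]
  have bil: "(\<lambda>m c. eps x y c \<odot>\<^bsub>D x y\<^esub> m) \<in> bilinear_maps R (D x y) (C x y) (D x y)"
    by (intro lin lin_dual; simp)
  show ?thesis
  proof (rule dual_eqI[of _ R "C x y"])
    show "rs x y (D x y) (\<lambda>m c. eps x y c \<odot>\<^bsub>D x y\<^esub> m) \<psi> \<in> carrier (D x y)"
      by (rule rs_closed[OF _ bil DM]; simp)
    fix h assume h [simp]: "h \<in> carrier (C x y)"
    have "rs x y (D x y) (\<lambda>m c. eps x y c \<odot>\<^bsub>D x y\<^esub> m) \<psi> h =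
        rs x y K (\<lambda>m c. (eps x y c \<odot>\<^bsub>D x y\<^esub> m) h) \<psi>"
      by (rule rs_commute[OF _ _ _ DM K_module bil dual_eval_linear[OF M h]]; simp)
    \<comment> \<open>Commutativity of k puts the product into the order that
      \<open>coact_eval_linear\<close> expects.\<close>
    also have "\<dots> = rs x y K (\<lambda>m c. m h \<odot>\<^bsub>K\<^esub> eps x y c) \<psi>"
      using m_comm by (intro rs_cong; simp add: counit_closed dual_closed[of _ R "C x y" h])
    also have "\<dots> = sw x y K (\<lambda>a b. \<psi> b \<odot>\<^bsub>K\<^esub> eps x y a) h"
      by (rule coact_eval_linear[OF _ _ K_module _ _ counit_linear]; simp)
    also have "\<dots> = sw x y K (\<lambda>a b. eps x y a \<odot>\<^bsub>K\<^esub> \<psi> b) h"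
      using dual_closed[OF \<psi>] by (intro sw_cong; simp add: m_comm counit_closed)
    also have "\<dots> = \<psi> h"
      by (rule sw_counit_left[OF _ _ K_module _ dual_linear[OF \<psi>]]; simp)
    finally show "rs x y (D x y) (\<lambda>m c. eps x y c \<odot>\<^bsub>D x y\<^esub> m) \<psi> h = \<psi> h" .
  qed simp
qed

text \<open>Evaluated at h, the right side is \<psi>_0(h S(a_1)) \<psi>_1 a_2. The definition of the
  coaction at the point h S(a_1) and the reversal of coproducts by S give \<psi>(h_2 S(a_1)) h_1
  S(a_2) a_3, in which S(a_2) a_3 cancels. What remains is (\<psi> \<leftharpoonup> a)(h_2) h_1, the
  value of the left side.\<close>

lemma coact_act:
  assumes xyz: "x \<in> Obj A" "y \<in> Obj A" "z \<in> Obj A" and \<psi>: "\<psi> \<in> carrier (D x y)"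
    and a: "a \<in> carrier (C y z)"
  shows "coact x z (act x y z \<psi> a) =
    rs x y (tensor R (D x z) (C x z)) (\<lambda>m c. sw y z (tensor R (D x z) (C x z))
      (\<lambda>a1 a2. pure_tensor R (D x z) (C x z) (act x y z m a1) (mul x y z c a2)) a) \<psi>"
    (is "_ = ?Y")
proof -
  note [simp] = xyz \<psi> a
  note M = Mor_module[OF xyz(1,3)] and DM = D_module[OF xyz(1,3)]
  let ?T = "tensor R (D x z) (C x z)"
  note T = tensor_module[OF DM M]
  interpret M: module R "C x z" by (rule M)
  let ?F = "\<lambda>m c a1 a2. pure_tensor R (D x z) (C x z) (act x y z m a1) (mul x y z c a2)"
  have bF: "?F m c \<in> bilinear_maps R (C y z) (C y z) ?T"
    if "m \<in> carrier (D x y)" "c \<in> carrier (C x y)" for m c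
    using that by (intro lin lin_dual; simp)
  have bY: "(\<lambda>m c. sw y z ?T (?F m c) a) \<in> bilinear_maps R (D x y) (C x y) ?T"
    by (intro lin lin_dual; simp)
  note lin\<psi> = linear_maps_compose[OF dual_linear[OF \<psi>]] dual_closed[OF \<psi>]
  show ?thesis
  proof (rule dual_eqI_tensor[OF xyz(1,3) xyz(1,3) xyz(1,3) M])
    show "coact x z (act x y z \<psi> a) \<in> carrier ?T" by (intro lin_dual; simp)
    show "?Y \<in> carrier ?T" by (rule rs_closed[OF _ bY T]; simp)
    fix h assume h [simp]: "h \<in> carrier (C x z)"
    let ?e = "tensor_lift R (C x z) (\<lambda>m q. m h \<odot>\<^bsub>C x z\<^esub> q)"
    note be = dual_eval_bilinear[OF M M h]
    have e: "?e \<in> linear_maps R ?T (C x z)"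
      by (rule tensor_lift_linear[OF DM M M be])
    have "?e ?Y = rs x y (C x z) (\<lambda>m c. ?e (sw y z ?T (?F m c) a)) \<psi>"
      by (rule rs_commute[OF _ _ _ T M bY e]; simp)
    also have "\<dots> = rs x y (C x z) (\<lambda>m c. sw y z (C x z) (\<lambda>a1 a2. ?e (?F m c a1 a2)) a) \<psi>"
      by (intro rs_cong sw_commute[OF _ _ T M _ bF e]; simp)
    also have "\<dots> = rs x y (C x z) (\<lambda>m c. sw y z (C x z) (\<lambda>a1 a2. act x y z m a1 h \<odot>\<^bsub>C x z\<^esub> mul x y z c a2) a) \<psi>"
      by (intro rs_cong sw_cong tensor_lift_pure[OF DM M M be] act_closed mul_closed; simp)
    also have "\<dots> = sw y z (C x z) (\<lambda>a1 a2. rs x y (C x z) (\<lambda>m c. act x y z m a1 h \<odot>\<^bsub>C x z\<^esub> mul x y z c a2) \<psi>) a"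
      by (intro rs_sw_swap lin lin_dual; simp)
    also have "\<dots> = sw y z (C x z) (\<lambda>a1 a2. sw x y (C x z) (\<lambda>p q. \<psi> q \<odot>\<^bsub>C x z\<^esub> mul x y z p a2) (mul x z y h (S y z a1))) a"
      unfolding act_apply[OF h] by (intro sw_cong coact_eval_linear lin; simp)
    also have "\<dots> = sw y z (C x z) (\<lambda>a1 a2. sw x z (C x z) (\<lambda>p q. sw z y (C x z)
        (\<lambda>u v. \<psi> (mul x z y q v) \<odot>\<^bsub>C x z\<^esub> mul x y z (mul x z y p u) a2) (S y z a1)) h) a"
      by (intro sw_cong sw_mul coact_bilinear lin; simp)
    also have "\<dots> = sw y z (C x z) (\<lambda>a1 a2. sw x z (C x z) (\<lambda>p q. sw y z (C x z)
        (\<lambda>b c. \<psi> (mul x z y q (S y z b)) \<odot>\<^bsub>C x z\<^esub> mul x y z (mul x z y p (S y z c)) a2) a1) h) a"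
      by (intro sw_cong sw_antipode lin lin\<psi>; simp)
    also have "\<dots> = sw x z (C x z) (\<lambda>p q. sw y z (C x z) (\<lambda>a1 a2. sw y z (C x z)
        (\<lambda>b c. \<psi> (mul x z y q (S y z b)) \<odot>\<^bsub>C x z\<^esub> mul x y z (mul x z y p (S y z c)) a2) a1) a) h"
      by (intro sw_swap lin lin\<psi>; simp)
    also have "\<dots> = sw x z (C x z) (\<lambda>p q. sw y z (C x z) (\<lambda>b r. sw y z (C x z)
        (\<lambda>c a2. \<psi> (mul x z y q (S y z b)) \<odot>\<^bsub>C x z\<^esub> mul x y z (mul x z y p (S y z c)) a2) r) a) h"
      by (intro sw_cong sw_coassoc lin lin\<psi>; simp)
    also have "\<dots> = sw x z (C x z) (\<lambda>p q. sw y z (C x z) (\<lambda>b r. sw y z (C x z)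
        (\<lambda>c a2. \<psi> (mul x z y q (S y z b)) \<odot>\<^bsub>C x z\<^esub> mul x z z p (mul z y z (S y z c) a2)) r) a) h"
      by (intro sw_cong; simp add: cat_assoc mul_closed antipode_closed)
    also have "\<dots> = sw x z (C x z) (\<lambda>p q. sw y z (C x z) (\<lambda>b r.
        eps y z r \<odot>\<^bsub>C x z\<^esub> (\<psi> (mul x z y q (S y z b)) \<odot>\<^bsub>C x z\<^esub> mul x z z p (ident A z))) a) h"
      by (intro sw_cong sw_antipode_left lin lin\<psi>; simp)
    also have "\<dots> = sw x z (C x z) (\<lambda>p q. \<psi> (mul x z y q (S y z a)) \<odot>\<^bsub>C x z\<^esub> mul x z z p (ident A z)) h"
      by (intro sw_cong sw_counit_right lin lin\<psi>; simp)
    also have "\<dots> = sw x z (C x z) (\<lambda>p q. act x y z \<psi> a q \<odot>\<^bsub>C x z\<^esub> p) h"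
      by (intro sw_cong; simp add: act_apply ident_right)
    also have "\<dots> = ?e (coact x z (act x y z \<psi> a))"
      by (rule coact_eval[symmetric]; simp add: act_closed)
    finally show "?e (coact x z (act x y z \<psi> a)) = ?e ?Y" by simp
  qed
qed


subsection \<open>Integrals\<close>

lemma left_integrals_simps:
  "add (left_integrals R A x) = add (D x x)"
  "smult (left_integrals R A x) = smult (D x x)"
  "zero (left_integrals R A x) = zero (D x x)"
  by (simp_all add: left_integrals_def Let_def)

text \<open>Multiplying by a functional f gives the condition \<phi>(h_2) f(h_1) = f(1_x) \<phi>(h).
  Since functionals separate points, these conditions together say \<phi>(h_2) h_1 = \<phi>(h) 1_x,
  which is the coinvariance equation evaluated at h.\<close>

lemma left_integrals_iff:
  assumes x: "x \<in> Obj A"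
  shows "\<phi> \<in> carrier (left_integrals R A x) \<longleftrightarrow>
    \<phi> \<in> carrier (D x x) \<and> coact x x \<phi> = pure_tensor R (D x x) (C x x) \<phi> (ident A x)"
proof -
  note M = Mor_module[OF x x] and DM = D_module[OF x x] and i = ident_closed[OF x]
  interpret M: module R "C x x" by (rule M)
  have mult: "(\<phi> \<otimes>\<^bsub>D x x\<^esub> f) h = sw x x K (\<lambda>a b. \<phi> b \<otimes> f a) h" if "h \<in> carrier (C x x)" for \<phi> f h
    using that by simp
  show ?thesis
  proof (intro iffI conjI)
    assume "\<phi> \<in> carrier (left_integrals R A x)"
    then have \<phi>: "\<phi> \<in> carrier (D x x)"
      and int: "\<And>f. f \<in> carrier (D x x) \<Longrightarrow> \<phi> \<otimes>\<^bsub>D x x\<^esub> f = f (ident A x) \<odot>\<^bsub>D x x\<^esub> \<phi>"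
      by (auto simp: left_integrals_def Let_def simp del: dual_simps)
    show "\<phi> \<in> carrier (D x x)" by fact
    note bil = coact_bilinear[OF x x \<phi> M linear_maps_ident]
    show "coact x x \<phi> = pure_tensor R (D x x) (C x x) \<phi> (ident A x)"
    proof (rule dual_eqI_tensor[OF x x x x x x M])
      show "coact x x \<phi> \<in> carrier (tensor R (D x x) (C x x))" by (rule coact_closed[OF x x \<phi>])
      show "pure_tensor R (D x x) (C x x) \<phi> (ident A x) \<in> carrier (tensor R (D x x) (C x x))"
        by (intro pure_closed \<phi> i M DM)
      fix h assume h: "h \<in> carrier (C x x)"
      have "sw x x (C x x) (\<lambda>a b. \<phi> b \<odot>\<^bsub>C x x\<^esub> a) h = \<phi> h \<odot>\<^bsub>C x x\<^esub> ident A x"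
      proof (rule dual_separates[OF M Mor_finitely_generated[OF x x] Mor_projective[OF x x]])
        show "sw x x (C x x) (\<lambda>a b. \<phi> b \<odot>\<^bsub>C x x\<^esub> a) h \<in> carrier (C x x)"
          by (rule sw_closed[OF h bil M x x])
        show "\<phi> h \<odot>\<^bsub>C x x\<^esub> ident A x \<in> carrier (C x x)"
          by (intro M.smult_closed i dual_closed[OF \<phi> h])
        fix f assume f: "f \<in> carrier (D x x)"
        have "f (sw x x (C x x) (\<lambda>a b. \<phi> b \<odot>\<^bsub>C x x\<^esub> a) h) = sw x x K (\<lambda>a b. f (\<phi> b \<odot>\<^bsub>C x x\<^esub> a)) h"
          by (rule sw_commute[OF x x M K_module h bil dual_linear[OF f]])
        also have "\<dots> = sw x x K (\<lambda>a b. \<phi> b \<otimes> f a) h"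
          by (intro sw_cong x h) (simp add: linear_maps_smult[OF dual_linear[OF f]] dual_closed[OF \<phi>])
        also have "\<dots> = f (ident A x) \<otimes> \<phi> h"
          \<comment> \<open>The rule \<open>dual_simps(4)\<close> is withheld so that the
            convolution product stays folded and \<open>int\<close> can rewrite it.\<close>
          using h by (simp add: mult[symmetric] int[OF f] del: dual_simps(4))
        also have "\<dots> = f (\<phi> h \<odot>\<^bsub>C x x\<^esub> ident A x)"
          by (simp add: linear_maps_smult[OF dual_linear[OF f]] dual_closed[OF \<phi> h] dual_closed[OF f i] i m_comm)
        finally show "f (sw x x (C x x) (\<lambda>a b. \<phi> b \<odot>\<^bsub>C x x\<^esub> a) h) = \<dots>" .
      qed
      then show "tensor_lift R (C x x) (\<lambda>m c. m h \<odot>\<^bsub>C x x\<^esub> c) (coact x x \<phi>) =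
          tensor_lift R (C x x) (\<lambda>m c. m h \<odot>\<^bsub>C x x\<^esub> c) (pure_tensor R (D x x) (C x x) \<phi> (ident A x))"
        by (simp add: coact_eval[OF x x \<phi> h] tensor_lift_pure[OF DM M M dual_eval_bilinear[OF M M h] \<phi> i])
    qed
  next
    assume "\<phi> \<in> carrier (D x x) \<and> coact x x \<phi> = pure_tensor R (D x x) (C x x) \<phi> (ident A x)"
    then have \<phi>: "\<phi> \<in> carrier (D x x)"
      and co: "coact x x \<phi> = pure_tensor R (D x x) (C x x) \<phi> (ident A x)"
      by auto
    have "sw x x K (\<lambda>a b. \<phi> b \<otimes> f a) h = f (ident A x) \<otimes> \<phi> h"
      if f: "f \<in> carrier (D x x)" and h: "h \<in> carrier (C x x)" for f h
    proof -
      have bil: "(\<lambda>m c. m h \<otimes> f c) \<in> bilinear_maps R (D x x) (C x x) K"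
        by (intro bilinear_mapsI linear_maps_mult_left linear_maps_mult_right is_cring
            dual_eval_linear M h dual_linear[OF f] dual_closed[OF f] dual_closed[OF _ h])
      have "sw x x K (\<lambda>a b. \<phi> b \<otimes> f a) h = rs x x K (\<lambda>m c. m h \<otimes> f c) \<phi>"
        using coact_eval_linear[OF x x K_module \<phi> h dual_linear[OF f]] by simp
      also have "\<dots> = \<phi> h \<otimes> f (ident A x)"
        unfolding co by (rule tensor_lift_pure[OF DM M K_module bil \<phi> i])
      finally show ?thesis
        by (simp add: m_comm dual_closed[OF \<phi> h] dual_closed[OF f i])
    qed
    then have "\<phi> \<otimes>\<^bsub>D x x\<^esub> f = f (ident A x) \<odot>\<^bsub>D x x\<^esub> \<phi>" if "f \<in> carrier (D x x)" for f
      using that by (auto intro!: restrict_ext)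
    with \<phi> show "\<phi> \<in> carrier (left_integrals R A x)"
      by (simp add: left_integrals_def Let_def del: dual_simps)
  qed
qed

text \<open>By the preceding characterisation the integrals are the set on which two linear maps on
  \<open>D x x\<close>, the coaction and \<phi> \<mapsto> \<phi> \<otimes> 1_x, agree.\<close>

lemma left_integrals_module:
  assumes x: "x \<in> Obj A"
  shows "module R (left_integrals R A x)"
proof -
  note M = Mor_module[OF x x] and DM = D_module[OF x x] and i = ident_closed[OF x]
  note T = tensor_module[OF DM M]
  interpret DM: module R "D x x" by (rule DM)
  note p = bilinear_maps_left[OF pure_tensor_bilinear[OF DM M] i] and co = coact_linear[OF x x]
  have "submodule (carrier (left_integrals R A x)) R (D x x)"
    by (rule DM.submoduleI)
      (auto simp: left_integrals_iff[OF x] linear_maps_add[OF p] linear_maps_add[OF co]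
        linear_maps_smult[OF p] linear_maps_smult[OF co] linear_maps_zero[OF DM T p]
        linear_maps_zero[OF DM T co] linear_maps_minus[OF DM T p] linear_maps_minus[OF DM T co]
        simp del: dual_simps)
  from submodule.submodule_is_module[OF this DM] show ?thesis
    by (simp add: left_integrals_def Let_def)
qed

lemma linear_maps_from_integrals:
  assumes "x \<in> Obj A" "f \<in> linear_maps R (D x x) P"
  shows "f \<in> linear_maps R (left_integrals R A x) P"
  using assms(2) left_integrals_iff[OF assms(1)]
  by (auto simp: linear_maps_def left_integrals_simps simp del: dual_simps)

text \<open>In the formula of \<open>coact_act\<close>, coinvariance replaces \<psi>_0 \<otimes>
  \<psi>_1 by \<phi> \<otimes> 1_x, and the identity drops out of the product.\<close>

lemma coact_act_integral:
  assumes xy: "x \<in> Obj A" "y \<in> Obj A" and \<phi>: "\<phi> \<in> carrier (left_integrals R A x)"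
    and a: "a \<in> carrier (C x y)"
  shows "coact x y (act x x y \<phi> a) = sw x y (tensor R (D x y) (C x y))
    (\<lambda>a1 a2. pure_tensor R (D x y) (C x y) (act x x y \<phi> a1) a2) a"
proof -
  note [simp] = xy a ident_closed[OF xy(1)]
  have \<phi>D [simp]: "\<phi> \<in> carrier (D x x)"
    and co: "coact x x \<phi> = pure_tensor R (D x x) (C x x) \<phi> (ident A x)"
    using \<phi> left_integrals_iff[OF xy(1)] by auto
  let ?T = "tensor R (D x y) (C x y)"
  have bil: "(\<lambda>m c. sw x y ?T (\<lambda>a1 a2. pure_tensor R (D x y) (C x y) (act x x y m a1) (mul x x y c a2)) a)
      \<in> bilinear_maps R (D x x) (C x x) ?T"
    by (intro lin lin_dual; simp)
  have "coact x y (act x x y \<phi> a) = sw x y ?T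
      (\<lambda>a1 a2. pure_tensor R (D x y) (C x y) (act x x y \<phi> a1) (mul x x y (ident A x) a2)) a"
    unfolding coact_act[OF xy(1,1,2) \<phi>D a] co
    by (rule tensor_lift_pure[OF _ _ _ bil]; (intro lin lin_dual)?; simp)
  also have "\<dots> = sw x y ?T (\<lambda>a1 a2. pure_tensor R (D x y) (C x y) (act x x y \<phi> a1) a2) a"
    by (intro sw_cong; simp add: ident_left)
  finally show ?thesis .
qed

section \<open>The projection onto the integrals\<close>

definition proj :: "'c \<Rightarrow> 'c \<Rightarrow> ('d \<Rightarrow> 'a) \<Rightarrow> 'd \<Rightarrow> 'a"
  where "proj x y \<psi> = rs x y (D x x) (\<lambda>m c. act x y x m (S x y c)) \<psi>"

lemma proj_bilinear:
  "\<lbrakk>x \<in> Obj A; y \<in> Obj A\<rbrakk> \<Longrightarrow>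
    (\<lambda>m c. act x y x m (S x y c)) \<in> bilinear_maps R (D x y) (C x y) (D x x)"
  by (intro lin lin_dual)

text \<open>Since S reverses coproducts, the coaction of \<psi>_0 \<leftharpoonup> S(\<psi>_1) is
  (\<psi>_0 \<leftharpoonup> S(\<psi>_3)) \<otimes> \<psi>_1 S(\<psi>_2). The factors \<psi>_1 and
  S(\<psi>_2) now stand side by side and cancel to a multiple of 1_x.\<close>

lemma proj_integral:
  assumes xy: "x \<in> Obj A" "y \<in> Obj A" and \<psi>: "\<psi> \<in> carrier (D x y)"
  shows "proj x y \<psi> \<in> carrier (left_integrals R A x)"
proof -
  note [simp] = xy \<psi> ident_closed[OF xy(1)]
  let ?T = "tensor R (D x x) (C x x)" and ?p = "pure_tensor R (D x x) (C x x)"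
  note DM = D_module[OF xy(1,1)]
  have T: "module R ?T" by (intro lin lin_dual; simp)
  note bil = proj_bilinear[OF xy]
  have "coact x x (proj x y \<psi>) = rs x y ?T (\<lambda>m c. coact x x (act x y x m (S x y c))) \<psi>"
    unfolding proj_def by (rule rs_commute[OF _ _ _ DM T bil coact_linear]; simp)
  also have "\<dots> = rs x y ?T (\<lambda>m c. rs x y ?T (\<lambda>n d. sw y x ?T
      (\<lambda>s t. ?p (act x y x n s) (mul x y x d t)) (S x y c)) m) \<psi>"
    by (intro rs_cong coact_act; simp add: antipode_closed)
  also have "\<dots> = rs x y ?T (\<lambda>m c. rs x y ?T (\<lambda>n d. sw x y ?T
      (\<lambda>a b. ?p (act x y x n (S x y b)) (mul x y x d (S x y a))) c) m) \<psi>"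
    by (intro rs_cong sw_antipode lin lin_dual; simp)
  also have "\<dots> = rs x y ?T (\<lambda>m k. sw x y ?T (\<lambda>d c. sw x y ?T
      (\<lambda>a b. ?p (act x y x m (S x y b)) (mul x y x d (S x y a))) c) k) \<psi>"
    by (intro coact_coassoc lin lin_dual; simp)
  also have "\<dots> = rs x y ?T (\<lambda>m k. sw x y ?T (\<lambda>k' b. sw x y ?T
      (\<lambda>d a. ?p (act x y x m (S x y b)) (mul x y x d (S x y a))) k') k) \<psi>"
    by (intro rs_cong sw_coassoc[symmetric] lin lin_dual; simp)
  also have "\<dots> = rs x y ?T (\<lambda>m k. sw x y ?T (\<lambda>k' b.
      eps x y k' \<odot>\<^bsub>?T\<^esub> ?p (act x y x m (S x y b)) (ident A x)) k) \<psi>"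
    by (intro rs_cong sw_cong sw_antipode_right lin lin_dual; simp)
  also have "\<dots> = rs x y ?T (\<lambda>m k. ?p (act x y x m (S x y k)) (ident A x)) \<psi>"
    by (intro rs_cong sw_counit_left lin lin_dual; simp)
  also have "\<dots> = ?p (proj x y \<psi>) (ident A x)"
    unfolding proj_def
    by (rule rs_commute[symmetric, OF _ _ _ DM T bil]; (intro lin lin_dual)?; simp)
  finally have "coact x x (proj x y \<psi>) = ?p (proj x y \<psi>) (ident A x)" .
  moreover have "proj x y \<psi> \<in> carrier (D x x)"
    unfolding proj_def by (rule rs_closed[OF _ bil DM]; simp)
  ultimately show ?thesis by (simp add: left_integrals_iff)
qed

lemma proj_linear:
  assumes xy: "x \<in> Obj A" "y \<in> Obj A"
  shows "proj x y \<in> linear_maps R (D x y) (left_integrals R A x)"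
proof -
  have "proj x y \<in> linear_maps R (D x y) (D x x)"
    unfolding proj_def[abs_def] using xy by (intro lin_rs lin lin_dual)
  then show ?thesis
    using proj_integral[OF xy] by (simp add: linear_maps_def left_integrals_simps del: dual_simps)
qed

text \<open>The action of a_1 followed by that of S(a_2) is the action of a_1 S(a_2), which the
  antipode axiom makes \<epsilon>(a) times the action of 1_x.\<close>

lemma proj_act:
  assumes xy: "x \<in> Obj A" "y \<in> Obj A" and \<phi>: "\<phi> \<in> carrier (left_integrals R A x)"
    and a: "a \<in> carrier (C x y)"
  shows "proj x y (act x x y \<phi> a) = eps x y a \<odot>\<^bsub>left_integrals R A x\<^esub> \<phi>"
proof -
  note [simp] = xy a ident_closed[OF xy(1)]
  have \<phi>D [simp]: "\<phi> \<in> carrier (D x x)"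
    using \<phi> left_integrals_iff[OF xy(1)] by auto
  let ?T = "tensor R (D x y) (C x y)"
  note DM = D_module[OF xy] and DMx = D_module[OF xy(1,1)] and M = Mor_module[OF xy]
  have T: "module R ?T" by (intro lin lin_dual; simp)
  note bil = proj_bilinear[OF xy]
  have b2: "(\<lambda>a1 a2. pure_tensor R (D x y) (C x y) (act x x y \<phi> a1) a2) \<in> bilinear_maps R (C x y) (C x y) ?T"
    by (intro lin lin_dual; simp)
  have "proj x y (act x x y \<phi> a) = sw x y (D x x) (\<lambda>a1 a2. tensor_lift R (D x x)
      (\<lambda>m c. act x y x m (S x y c)) (pure_tensor R (D x y) (C x y) (act x x y \<phi> a1) a2)) a"
    unfolding proj_def coact_act_integral[OF xy \<phi> a]
    by (rule sw_commute[OF _ _ T DMx _ b2 tensor_lift_linear[OF DM M DMx bil]]; simp)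
  also have "\<dots> = sw x y (D x x) (\<lambda>a1 a2. act x x x \<phi> (mul x y x a1 (S x y a2))) a"
    by (intro sw_cong; simp add: tensor_lift_pure[OF DM M DMx bil] act_closed act_act antipode_closed)
  also have "\<dots> = eps x y a \<odot>\<^bsub>D x x\<^esub> act x x x \<phi> (ident A x)"
    by (rule sw_antipode_right; (intro lin lin_dual)?; simp)
  finally show ?thesis by (simp add: act_ident left_integrals_simps del: dual_simps)
qed

section \<open>The isomorphism and its inverse\<close>

lemma harpoon_bilinear:
  assumes xy: "x \<in> Obj A" "y \<in> Obj A"
  shows "harpoon R A x y \<in> bilinear_maps R (left_integrals R A x) (C x y) (D x y)"
proof -
  have eq: "harpoon R A x y = act x x y"
    by (simp add: fun_eq_iff harpoon_def act_def)
  note b = act_bilinear[OF xy(1,1,2)]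
  show ?thesis unfolding eq
  proof (rule bilinear_mapsI)
    show "act x x y \<phi> \<in> linear_maps R (C x y) (D x y)" if "\<phi> \<in> carrier (left_integrals R A x)" for \<phi>
      using bilinear_maps_right[OF b] that left_integrals_iff[OF xy(1)] by auto
  qed (intro linear_maps_from_integrals xy bilinear_maps_left[OF b])
qed

theorem alpha_iso:
  assumes xy: "x \<in> Obj A" "y \<in> Obj A"
  shows "alpha R A x y \<in> linear_isos R (tensor R (left_integrals R A x) (C x y)) (D x y)"
proof -
  let ?I = "left_integrals R A x"
  let ?T = "tensor R ?I (C x y)" and ?p = "pure_tensor R ?I (C x y)" and ?\<alpha> = "alpha R A x y"
  note [simp] = xy ident_closed[OF xy(1)] ident_closed[OF xy(2)]
  note I = left_integrals_module[OF xy(1)] and DM = D_module[OF xy] and M = Mor_module[OF xy]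
  note T = tensor_module[OF I M]
  interpret T: module R ?T by (rule T)
  note hb = harpoon_bilinear[OF xy]
  have ID [simp]: "\<phi> \<in> carrier (D x x)" if "\<phi> \<in> carrier ?I" for \<phi>
    using that left_integrals_iff[OF xy(1)] by auto
  have \<alpha>: "?\<alpha> \<in> linear_maps R ?T (D x y)"
    unfolding alpha_def by (rule tensor_lift_linear[OF I M DM hb])
  have \<alpha>p: "?\<alpha> (?p \<phi> a) = act x x y \<phi> a" if "\<phi> \<in> carrier ?I" "a \<in> carrier (C x y)" for \<phi> a
    using tensor_lift_pure[OF I M DM hb that] by (simp add: alpha_def harpoon_def act_def)
  \<comment> \<open>The tensor is formed over the module of integrals, not over
    \<open>D x x\<close>. The two tensor products are different quotients, so \<open>proj\<close>
    has to be linear into the integrals themselves.\<close>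
  let ?B = "\<lambda>m c. ?p (proj x y m) c"
  have B: "?B \<in> bilinear_maps R (D x y) (C x y) ?T"
    using linear_maps_closed[OF proj_linear[OF xy]]
    by (intro bilinear_mapsI linear_maps_pure_left linear_maps_pure_right proj_linear linear_maps_ident I M; simp)
  define \<beta> where "\<beta> = (\<lambda>\<psi>. rs x y ?T ?B \<psi>)"
  have \<beta>: "\<beta> \<in> linear_maps R (D x y) ?T"
    unfolding \<beta>_def by (intro lin_rs linear_maps_ident B T; simp)
  \<comment> \<open>By coassociativity the composite is \<psi>_0 \<leftharpoonup> (S(\<psi>_1)
    \<psi>_2), which the antipode axiom and the counit reduce to \<psi>.\<close>
  have "?\<alpha> (\<beta> \<psi>) = \<psi>" if \<psi> [simp]: "\<psi> \<in> carrier (D x y)" for \<psi>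
  proof -
    have "?\<alpha> (\<beta> \<psi>) = rs x y (D x y) (\<lambda>m c. ?\<alpha> (?B m c)) \<psi>"
      unfolding \<beta>_def by (rule rs_commute[OF _ _ _ T DM B \<alpha>]; simp)
    also have "\<dots> = rs x y (D x y) (\<lambda>m c. act x x y (proj x y m) c) \<psi>"
      by (intro rs_cong; simp add: \<alpha>p proj_integral)
    also have "\<dots> = rs x y (D x y) (\<lambda>m c. rs x y (D x y) (\<lambda>n d. act x x y (act x y x n (S x y d)) c) m) \<psi>"
      unfolding proj_def
      by (intro rs_cong rs_commute[OF _ _ _ D_module _ proj_bilinear] lin lin_dual; simp)
    also have "\<dots> = rs x y (D x y) (\<lambda>m c. rs x y (D x y) (\<lambda>n d. act x y y n (mul y x y (S x y d) c)) m) \<psi>"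
      by (intro rs_cong; simp add: act_act antipode_closed)
    also have "\<dots> = rs x y (D x y) (\<lambda>m k. sw x y (D x y) (\<lambda>d c. act x y y m (mul y x y (S x y d) c)) k) \<psi>"
      by (intro coact_coassoc lin lin_dual; simp)
    also have "\<dots> = rs x y (D x y) (\<lambda>m k. eps x y k \<odot>\<^bsub>D x y\<^esub> act x y y m (ident A y)) \<psi>"
      by (intro rs_cong sw_antipode_left lin lin_dual; simp)
    also have "\<dots> = rs x y (D x y) (\<lambda>m k. eps x y k \<odot>\<^bsub>D x y\<^esub> m) \<psi>"
      by (intro rs_cong; simp add: act_ident del: dual_simps)
    also have "\<dots> = \<psi>"
      by (rule coact_counit; simp)
    finally show ?thesis .
  qed
  \<comment> \<open>On \<phi> \<otimes> a the coaction gives (\<phi> \<leftharpoonup> a_1) \<otimes>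
    a_2, which \<open>proj_act\<close> turns into \<epsilon>(a_1) \<phi> \<otimes> a_2.\<close>
  moreover have "\<beta> (?\<alpha> t) = t" if t: "t \<in> carrier ?T" for t
  proof (rule tensor_ext[OF I M T linear_maps_compose[OF \<beta> \<alpha>] linear_maps_ident _ t])
    fix \<phi> a assume \<phi>: "\<phi> \<in> carrier ?I" and a [simp]: "a \<in> carrier (C x y)"
    note [simp] = ID[OF \<phi>]
    let ?TD = "tensor R (D x y) (C x y)"
    have b2: "(\<lambda>a1 a2. pure_tensor R (D x y) (C x y) (act x x y \<phi> a1) a2) \<in> bilinear_maps R (C x y) (C x y) ?TD"
      by (intro lin lin_dual; simp)
    have "\<beta> (?\<alpha> (?p \<phi> a)) = sw x y ?T (\<lambda>a1 a2. tensor_lift R ?T ?B (pure_tensor R (D x y) (C x y) (act x x y \<phi> a1) a2)) a"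
      unfolding \<beta>_def \<alpha>p[OF \<phi> a] coact_act_integral[OF xy \<phi> a]
      by (rule sw_commute[OF _ _ tensor_module[OF DM M] T _ b2 tensor_lift_linear[OF DM M T B]]; simp)
    also have "\<dots> = sw x y ?T (\<lambda>a1 a2. ?p (eps x y a1 \<odot>\<^bsub>?I\<^esub> \<phi>) a2) a"
      by (intro sw_cong; simp add: tensor_lift_pure[OF DM M T B] act_closed proj_act \<phi>)
    also have "\<dots> = sw x y ?T (\<lambda>a1 a2. eps x y a1 \<odot>\<^bsub>?T\<^esub> ?p \<phi> a2) a"
      using linear_maps_smult[OF bilinear_maps_left[OF pure_tensor_bilinear[OF I M]]]
      by (intro sw_cong; simp add: counit_closed \<phi>)
    also have "\<dots> = ?p \<phi> a"
      by (intro sw_counit_left T linear_maps_pure_right linear_maps_ident I M \<phi>; simp)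
    finally show "\<beta> (?\<alpha> (?p \<phi> a)) = ?p \<phi> a" .
  qed
  ultimately have "bij_betw ?\<alpha> (carrier ?T) (carrier (D x y))"
    using linear_maps_closed[OF \<alpha>] linear_maps_closed[OF \<beta>]
    by (intro bij_betw_byWitness[where f' = \<beta>]) auto
  with \<alpha> show ?thesis by (simp add: linear_isos_def)
qed

end

text \<open>\<open>tensor_lift\<close> carries meaning only for bilinear maps, so the formula on
  pure tensors is established along with the isomorphism; it rests on the bilinearity of
  \<open>harpoon\<close> on integrals.\<close>

theorem corollary9p5:
  fixes k :: "('k, 'r) ring_scheme" and A :: "('x, 'k, 'a, 'h) hopf_category_scheme"
  assumes "hopf_category k A" and "x \<in> Obj A" and "y \<in> Obj A"
  shows "(\<forall>\<phi>\<in>carrier (left_integrals k A x). \<forall>a\<in>carrier (Mor A x y).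
      alpha k A x y (pure_tensor k (left_integrals k A x) (Mor A x y) \<phi> a) = harpoon k A x y \<phi> a) \<and>
    alpha k A x y \<in>
      linear_isos k (tensor k (left_integrals k A x) (Mor A x y)) (dual k (Mor A x y))"
proof -
  interpret hopf_category k A by fact
  show ?thesis
    unfolding alpha_def
    using tensor_lift_pure[OF left_integrals_module[OF assms(2)] Mor_module[OF assms(2,3)]
        D_module[OF assms(2,3)] harpoon_bilinear[OF assms(2,3)]]
      alpha_iso[OF assms(2,3), unfolded alpha_def]
    by blast
qed

end
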